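(* Let $n\geqslant2$, $\lambda\in\mathbb R_+$, and let $u\in\mathring B^\ast_2$ solve \[\left(-\Delta-\lambda\right)u=f\quad\text{in }\mathbb R^n,\] where $e^{\gamma\left\langle\cdot\right\rangle}f\in L^2(\mathbb R^n)$ for all $\gamma\in\mathbb R_+$, and suppose that $f$ vanishes in the lower half-space $\mathbb R^{n-1}\times\mathbb R_-$. Then $u$ also vanishes in $\mathbb R^{n-1}\times\mathbb R_-$.
   Context: For $x\in\mathbb R^n$, $\left\langle x\right\rangle=\sqrt{1+|x|^2}$, and $\mathbb R_-=\left]-\infty,0\right[$. The space $\mathring B^\ast$ consists of those $u\in L^2_{\mathrm{loc}}(\mathbb R^n)$ with $\frac1R\int_{B(0,R)}|u|^2\to0$ as $R\to\infty$, where $B(0,R)$ is the open ball of radius $R$ centered at the origin. The notation $u\in\mathring B^\ast_2$ means that $u$ and all its (distributional) partial derivatives of order at most $2$ belong to $\mathring B^\ast$. *)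

theory Defs
  imports "HOL-Analysis.Analysis"
begin

definition pderiv_dir :: "'n::finite \<Rightarrow> (real^'n \<Rightarrow> real) \<Rightarrow> (real^'n \<Rightarrow> real)" where
  "pderiv_dir i \<phi> = (\<lambda>x. frechet_derivative \<phi> (at x) (axis i 1))"

fun iter_pderiv :: "'n::finite list \<Rightarrow> (real^'n \<Rightarrow> real) \<Rightarrow> (real^'n \<Rightarrow> real)" where
  "iter_pderiv [] \<phi> = \<phi>"
| "iter_pderiv (i # is) \<phi> = pderiv_dir i (iter_pderiv is \<phi>)"

definition test_fun :: "(real^'n::finite \<Rightarrow> real) \<Rightarrow> bool" where
  "test_fun \<phi> \<longleftrightarrow> (\<forall>is x. iter_pderiv is \<phi> differentiable (at x))
                    \<and> compact (closure {x. \<phi> x \<noteq> 0})"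

definition L2_loc :: "(real^'n::finite \<Rightarrow> complex) \<Rightarrow> bool" where
  "L2_loc u \<longleftrightarrow> u \<in> borel_measurable lebesgue \<and>
     (\<forall>K. compact K \<longrightarrow> set_integrable lebesgue K (\<lambda>x. (norm (u x))\<^sup>2))"

definition Bstar0 :: "(real^'n::finite \<Rightarrow> complex) \<Rightarrow> bool" where
  "Bstar0 u \<longleftrightarrow> L2_loc u \<and>
     ((\<lambda>R. (1 / R) * (LINT x : ball 0 R | lebesgue. (norm (u x))\<^sup>2)) \<longlongrightarrow> 0) at_top"

definition weak_deriv :: "'n::finite list \<Rightarrow> (real^'n \<Rightarrow> complex) \<Rightarrow> (real^'n \<Rightarrow> complex) \<Rightarrow> bool" where
  "weak_deriv is u g \<longleftrightarrow> (\<forall>\<phi>. test_fun \<phi> \<longrightarrow>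
      (LINT x | lebesgue. u x * complex_of_real (iter_pderiv is \<phi> x))
        = (-1) ^ length is * (LINT x | lebesgue. g x * complex_of_real (\<phi> x)))"

definition Bstar2 :: "(real^'n::finite \<Rightarrow> complex) \<Rightarrow> bool" where
  "Bstar2 u \<longleftrightarrow> Bstar0 u \<and>
     (\<forall>is::'n list. length is \<le> 2 \<longrightarrow> (\<exists>g. Bstar0 g \<and> weak_deriv is u g))"

definition L2 :: "(real^'n::finite \<Rightarrow> complex) \<Rightarrow> bool" where
  "L2 g \<longleftrightarrow> g \<in> borel_measurable lebesgue \<and> integrable lebesgue (\<lambda>x. (norm (g x))\<^sup>2)"

definition solves_helmholtz :: "real \<Rightarrow> (real^'n::finite \<Rightarrow> complex) \<Rightarrow> (real^'n \<Rightarrow> complex) \<Rightarrow> bool" where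
  "solves_helmholtz lam u f \<longleftrightarrow> (\<forall>\<phi>. test_fun \<phi> \<longrightarrow>
      (LINT x | lebesgue. u x * complex_of_real
          (- (\<Sum>i\<in>UNIV. iter_pderiv [i, i] \<phi> x) - lam * \<phi> x))
        = (LINT x | lebesgue. f x * complex_of_real (\<phi> x)))"

end

theory Submission
  imports Defs "HOL-Probability.Probability" "HOL-Complex_Analysis.Conformal_Mappings"
begin

text \<open>Write \<open>x = (x', x\<^sub>k)\<close>, let \<open>\<xi>'\<close> be a frequency dual to \<open>x'\<close> and put \<open>e(x) = exp (i \<xi>' \<sqdot> x') H(x\<^sub>k)\<close>, where
  \<open>H'' = (|\<xi>'|\<^sup>2 - \<lambda>) H + h\<close>. Testing the equation with \<open>\<chi>(x/R) e(x)\<close>, integrating against a density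
  \<open>a(\<xi>')\<close> and letting \<open>R\<close> tend to infinity gives \<open>\<integral> u p(x') h(x\<^sub>k) dx = - \<integral> a(\<xi>') \<integral> f e dx d\<xi>'\<close>, where \<open>p\<close> is
  the Fourier transform of \<open>a\<close>: the commutator terms disappear because a superposition of plane waves
  has \<open>L\<^sup>2\<close> norm \<open>O(\<surd>R)\<close> on \<open>B(0, R)\<close>, while that of \<open>u\<close> is \<open>o(\<surd>R)\<close>.

  With \<open>h = 0\<close> and oscillating \<open>H\<close> this shows that the Fourier transform of \<open>f\<close>, an entire function,
  vanishes on the real sphere \<open>|\<xi>|\<^sup>2 = \<lambda>\<close>, hence on the complex one, which contains the evanescent waves
  \<open>exp (i \<xi>' \<sqdot> x') exp (- \<kappa> x\<^sub>k)\<close> with \<open>\<kappa>\<^sup>2 = |\<xi>'|\<^sup>2 - \<lambda> > 0\<close>. Now let \<open>h = \<sigma>'\<close> with \<open>\<sigma>\<close> a bump in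
  \<open>x\<^sub>k < 0\<close>. For \<open>|\<xi>'|\<^sup>2 \<le> \<lambda>\<close> there is a bounded \<open>H\<close> vanishing for \<open>x\<^sub>k \<ge> 0\<close>; for \<open>|\<xi>'|\<^sup>2 > \<lambda>\<close> the decaying
  \<open>H\<close> is a multiple of \<open>exp (- \<kappa> x\<^sub>k)\<close> there. As \<open>f\<close> lives in \<open>x\<^sub>k \<ge> 0\<close>, the right-hand side is zero in
  both cases. Hence \<open>u\<close> does not depend on \<open>x\<^sub>k\<close> in the lower half-space, and the growth condition forces
  it to vanish.\<close>

subsection \<open>Smooth functions of one real variable\<close>

text \<open>The obstacle is the size of a single plane wave. Its norm on B(0, R) grows like R^(n/2),
  so against a function of size o(R^(1/2)) the commutator terms, which carry a factor 1/R, need not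
  vanish for n at least 2. Spreading the wave over n - 1 tangential frequencies lowers the growth to
  R^(1/2), exactly dual to that of u; hence densities instead of individual frequencies. The
  estimate behind this, \<open>wave_L2\<close>, sees only absolute values of the amplitude, so
  amplitudes may be merely measurable in the frequency. This freedom is spent twice: the conjugate
  of the Fourier integral of f itself serves as density, which turns the identity into the vanishing
  of a square, and H may be given by different formulas on the two sides of |\<xi>'|^2 = \<lambda>.
  Every exponential weight on f is called for because the continuation from real to evanescent
  frequencies passes through exponentials of arbitrary real growth. Densities with Gaussian decay
  keep all exchanges of integrals elementary. They suffice because indicators of boxes, smoothed by
  a Gaussian, are their Fourier transforms, and boxes determine u almost everywhere.\<close>

primrec Ck :: "nat \<Rightarrow> (real \<Rightarrow> complex) \<Rightarrow> bool" where
  "Ck 0 g = True"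
| "Ck (Suc m) g = (\<exists>g'. (\<forall>t. (g has_vector_derivative g' t) (at t)) \<and> Ck m g')"

lemma Ck_SucI: "(\<And>t. (g has_vector_derivative g' t) (at t)) \<Longrightarrow> Ck m g' \<Longrightarrow> Ck (Suc m) g"
  by auto

text \<open>The base case of \<open>Ck\<close> demands no continuity; it comes from the
  quantification over all \<open>m\<close>, since every derivative is itself differentiable. The
  recursion through an existential derivative gives closure properties by induction on
  \<open>m\<close> with the function generalised.\<close>

definition smooth :: "(real \<Rightarrow> complex) \<Rightarrow> bool" where
  "smooth g \<longleftrightarrow> (\<forall>m. Ck m g)"

definition vd :: "(real \<Rightarrow> complex) \<Rightarrow> real \<Rightarrow> complex" where
  "vd g t = vector_derivative g (at t)"

lemma vd_eqI:
  assumes "\<And>t. (g has_vector_derivative g' t) (at t)"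
  shows "vd g = g'"
  using assms by (auto simp: vd_def fun_eq_iff intro!: vector_derivative_at)

lemma Ck_Suc_vd: "Ck (Suc m) g \<longleftrightarrow> (\<forall>t. (g has_vector_derivative vd g t) (at t)) \<and> Ck m (vd g)"
  using vd_eqI by (metis Ck.simps(2))

lemma smooth_vd:
  assumes "smooth g"
  shows "smooth (vd g)" "(g has_vector_derivative vd g t) (at t)"
  using assms Ck_Suc_vd unfolding smooth_def by blast+

lemma smooth_funpow_vd: "smooth g \<Longrightarrow> smooth ((vd ^^ m) g)"
  by (induction m) (auto intro: smooth_vd)

lemma Ck_Suc_D: "Ck (Suc m) g \<Longrightarrow> Ck m g"
proof (induction m arbitrary: g)
  case (Suc m)
  then show ?case by (metis Ck.simps(2))
qed auto

lemma Ck_const: "Ck m (\<lambda>_. c)"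
proof (induction m arbitrary: c)
  case (Suc m)
  have "\<forall>t. ((\<lambda>_. c) has_vector_derivative (\<lambda>_. 0) t) (at t)" by (simp add: has_vector_derivative_const)
  with Suc show ?case by (metis Ck.simps(2))
qed auto

lemma Ck_add: "Ck m f \<Longrightarrow> Ck m g \<Longrightarrow> Ck m (\<lambda>t. f t + g t)"
proof (induction m arbitrary: f g)
  case (Suc m)
  then obtain f' g' where "\<forall>t. (f has_vector_derivative f' t) (at t)" "Ck m f'"
     "\<forall>t. (g has_vector_derivative g' t) (at t)" "Ck m g'" by auto
  then show ?case using Suc.IH[of f' g'] by (auto intro!: exI[of _ "\<lambda>t. f' t + g' t"] derivative_intros)
qed auto

lemma Ck_mult: "Ck m f \<Longrightarrow> Ck m g \<Longrightarrow> Ck m (\<lambda>t. f t * g t)"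
proof (induction m arbitrary: f g)
  case (Suc m)
  then obtain f' g' where d: "\<forall>t. (f has_vector_derivative f' t) (at t)" "Ck m f'"
     "\<forall>t. (g has_vector_derivative g' t) (at t)" "Ck m g'" by auto
  have "Ck m (\<lambda>t. f t * g' t + f' t * g t)"
    using Suc.IH d Suc.prems Ck_Suc_D Ck_add by simp
  then show ?case using d by (auto intro!: exI[of _ "\<lambda>t. f t * g' t + f' t * g t"] has_vector_derivative_mult)
qed auto

lemma Ck_affine: "Ck m f \<Longrightarrow> Ck m (\<lambda>t. f (a * t + b))"
proof (induction m arbitrary: f)
  case (Suc m)
  then obtain f' where d: "\<forall>t. (f has_vector_derivative f' t) (at t)" "Ck m f'" by auto
  have "((\<lambda>t. f (a * t + b)) has_vector_derivative of_real a * f' (a * t + b)) (at t)" for t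
  proof -
    have "((\<lambda>t. a * t + b) has_vector_derivative a) (at t)"
      by (auto intro!: derivative_eq_intros)
    from vector_diff_chain_at[OF this, of f "f' (a * t + b)"] d
    show ?thesis by (simp add: o_def scaleR_conv_of_real)
  qed
  moreover have "Ck m (\<lambda>t. of_real a * f' (a * t + b))"
    by (intro Ck_mult Ck_const Suc.IH d)
  ultimately show ?case by (rule Ck_SucI)
qed auto

lemma vd_affine:
  assumes "smooth f"
  shows "vd (\<lambda>t. f (a * t + b)) = (\<lambda>t. of_real a * vd f (a * t + b))"
proof (rule vd_eqI)
  fix t
  have "((\<lambda>t. a * t + b) has_vector_derivative a) (at t)"
    by (auto intro!: derivative_eq_intros)
  from vector_diff_chain_at[OF this, of f "vd f (a * t + b)"] smooth_vd(2)[OF assms]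
  show "((\<lambda>t. f (a * t + b)) has_vector_derivative of_real a * vd f (a * t + b)) (at t)"
    by (simp add: o_def scaleR_conv_of_real)
qed

lemma vd_mult:
  assumes "smooth f" "smooth g"
  shows "vd (\<lambda>t. f t * g t) = (\<lambda>t. f t * vd g t + vd f t * g t)"
  using assms smooth_vd by (intro vd_eqI has_vector_derivative_mult) auto

lemma vd_add:
  assumes "smooth f" "smooth g"
  shows "vd (\<lambda>t. f t + g t) = (\<lambda>t. vd f t + vd g t)"
  using assms smooth_vd by (intro vd_eqI has_vector_derivative_add) auto

lemma smooth_const: "smooth (\<lambda>_. c)"
  and smooth_add: "smooth f \<Longrightarrow> smooth g \<Longrightarrow> smooth (\<lambda>t. f t + g t)"
  and smooth_mult: "smooth f \<Longrightarrow> smooth g \<Longrightarrow> smooth (\<lambda>t. f t * g t)"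
  and smooth_affine: "smooth f \<Longrightarrow> smooth (\<lambda>t. f (a * t + b))"
  using Ck_const Ck_add Ck_mult Ck_affine by (auto simp: smooth_def)

lemma vd_exp: "vd (\<lambda>t. exp (c * of_real t)) = (\<lambda>t. c * exp (c * of_real t))"
  and smooth_exp: "smooth (\<lambda>t. exp (c * of_real t))"
proof -
  have d: "((\<lambda>t. exp (c * of_real t)) has_vector_derivative c * exp (c * of_real t)) (at t)" for t
    by (auto intro!: derivative_eq_intros has_vector_derivative_real_field simp: mult.commute)
  show "vd (\<lambda>t. exp (c * of_real t)) = (\<lambda>t. c * exp (c * of_real t))"
    by (rule vd_eqI[OF d])
  have "Ck m (\<lambda>t. exp (c * of_real t))" for m
  proof (induction m)
    case (Suc m)
    have "Ck m (\<lambda>t. c * exp (c * of_real t))" by (intro Ck_mult Ck_const Suc)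
    with d show ?case by (rule Ck_SucI)
  qed auto
  then show "smooth (\<lambda>t. exp (c * of_real t))" by (simp add: smooth_def)
qed

lemma smooth_continuous: "smooth g \<Longrightarrow> continuous_on S g"
  by (meson continuous_at_imp_continuous_on has_vector_derivative_continuous smooth_vd(2))

text \<open>Bootstrapping: \<open>Ck m\<close> is carried for H and H1 together, and the equation
  raises both by one order. It makes the solutions H of the ordinary equation admissible as factors
  of test functions.\<close>

lemma smooth_of_second_derivative:
  assumes "\<And>t. (H has_vector_derivative H1 t) (at t)"
    and "\<And>t. (H1 has_vector_derivative c * H t + h t) (at t)" and "smooth h"
  shows "smooth H"
proof -
  have "Ck m H \<and> Ck m H1" for m
  proof (induction m)
    case (Suc m)
    have "Ck m (\<lambda>t. c * H t + h t)"
      using assms(3) Suc by (intro Ck_add Ck_mult Ck_const) (auto simp: smooth_def)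
    with Suc assms(1,2) show ?case
      using Ck_SucI[of H H1 m] Ck_SucI[of H1 "\<lambda>t. c * H t + h t" m] by blast
  qed auto
  then show ?thesis by (auto simp: smooth_def)
qed

text \<open>The flat functions \<open>t\<^sup>-\<^sup>m exp (-1/t)\<close> are closed under differentiation up to linear combinations.\<close>

definition flatfn :: "nat \<Rightarrow> real \<Rightarrow> real" where
  "flatfn m t = (if t > 0 then (1 / t) ^ m * exp (- 1 / t) else 0)"

text \<open>This is the difference quotient of \<open>flatfn m\<close> at 0 from the right; s = 1/t
  turns it into s^(m+1) / exp s.\<close>

lemma flat_over_t_tendsto: "((\<lambda>t. flatfn m t / t) \<longlongrightarrow> 0) (at_right 0)"
proof -
  have "((\<lambda>s. s ^ Suc m / exp s) \<longlongrightarrow> (0::real)) at_top"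
    by (rule tendsto_power_div_exp_0)
  then have "((\<lambda>t. (inverse t) ^ Suc m / exp (inverse t)) \<longlongrightarrow> (0::real)) (at_right 0)"
    by (rule filterlim_compose[OF _ filterlim_inverse_at_top_right])
  moreover have "eventually (\<lambda>t. (inverse t) ^ Suc m / exp (inverse t) = flatfn m t / t) (at_right (0::real))"
    by (rule eventually_at_right_less[THEN eventually_mono])
       (auto simp: flatfn_def exp_minus field_simps)
  ultimately show ?thesis by (simp add: tendsto_cong)
qed

lemma flat_has_derivative:
  "(flatfn m has_real_derivative (flatfn (m + 2) t - m * flatfn (m + 1) t)) (at t)"
proof -
  consider "t > 0" | "t < 0" | "t = 0" by linarith
  then show ?thesis
  proof cases
    case 1
    have inv: "((\<lambda>t. 1 / t) has_real_derivative - ((1 / t) ^ 2)) (at t)"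
      using 1 by (auto intro!: derivative_eq_intros simp: power2_eq_square)
    have e: "((\<lambda>t. exp (- (1 / t))) has_real_derivative exp (- (1 / t)) * (1 / t) ^ 2) (at t)"
      using DERIV_chain2[OF DERIV_exp DERIV_minus[OF inv]] by simp
    \<comment> \<open>The truncated exponent \<open>m - Suc 0\<close> is harmless at m = 0, where
      the factor \<open>real m\<close> annihilates both sides.\<close>
    have pw: "real m * (1 / t) ^ (m - Suc 0) * (1 / t) ^ 2 = real m * (1 / t) ^ (m + 1)"
      by (cases m) (simp_all add: power2_eq_square)
    have "((\<lambda>t. (1 / t) ^ m * exp (- 1 / t)) has_real_derivative
            ((1 / t) ^ (m+2) * exp (- 1 / t) - m * ((1 / t) ^ (m + 1) * exp (- 1 / t)))) (at t)"
    proof (rule DERIV_cong[OF DERIV_mult[OF DERIV_power[OF inv, of m] e, simplified minus_divide_left]])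
      have "real m * ((1 / t) ^ (m - Suc 0) * (1 / t) ^ 2) * exp (- 1 / t) =
         real m * (1 / t) ^ (m + 1) * exp (- 1 / t)"
        using pw by (simp add: mult.assoc)
      then show "real m * (- ((1 / t)\<^sup>2) * (1 / t) ^ (m - Suc 0)) * exp (- 1 / t) +
          exp (- 1 / t) * (1 / t)\<^sup>2 * (1 / t) ^ m =
         (1 / t) ^ (m + 2) * exp (- 1 / t) - real m * ((1 / t) ^ (m + 1) * exp (- 1 / t))"
        by (simp add: power_add power2_eq_square mult.commute mult.left_commute)
    qed
    then have "(flatfn m has_real_derivative
            ((1 / t) ^ (m+2) * exp (- 1 / t) - m * ((1 / t) ^ (m + 1) * exp (- 1 / t)))) (at t)"
      by (rule has_field_derivative_transform_within_open[where S="{0<..}"]) (use 1 in \<open>auto simp: flatfn_def\<close>)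
    with 1 show ?thesis by (simp add: flatfn_def)
  next
    case 2
    have "((\<lambda>t. 0) has_real_derivative 0) (at t)" by simp
    then have "(flatfn m has_real_derivative 0) (at t)"
      by (rule has_field_derivative_transform_within_open[where S="{..<0}"]) (use 2 in \<open>auto simp: flatfn_def\<close>)
    with 2 show ?thesis by (simp add: flatfn_def)
  next
    case 3
    have "((\<lambda>t. flatfn m t / t) \<longlongrightarrow> 0) (at_left 0)"
    proof -
      have "eventually (\<lambda>t. flatfn m t / t = 0) (at_left (0::real))"
        by (simp add: flatfn_def eventually_at_filter)
      from tendsto_cong[OF this] show ?thesis by simp
    qed
    with flat_over_t_tendsto have "((\<lambda>t. flatfn m t / t) \<longlongrightarrow> 0) (at 0)"
      by (simp add: filterlim_split_at)
    with 3 show ?thesis by (simp add: has_field_derivative_iff flatfn_def)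
  qed
qed

lemma smooth_flat: "smooth (\<lambda>t. of_real (flatfn 0 t))"
proof -
  have "Ck j (\<lambda>t. of_real (flatfn m t))" for j m
  proof (induction j arbitrary: m)
    case (Suc j)
    have "((\<lambda>t. complex_of_real (flatfn m t)) has_vector_derivative
        of_real (flatfn (m + 2) t) + of_real (- real m) * of_real (flatfn (m + 1) t)) (at t)" for t
      using has_vector_derivative_of_real[OF flat_has_derivative[of m t], where ?'a = complex]
      by simp
    moreover have "Ck j (\<lambda>t. of_real (flatfn (m + 2) t) + of_real (- real m) * of_real (flatfn (m + 1) t))"
      by (intro Ck_add Ck_mult Ck_const Suc)
    ultimately show ?case by (rule Ck_SucI)
  qed auto
  then show ?thesis by (simp add: smooth_def)
qed

text \<open>Strictly beyond radius r the function vanishes in a neighbourhood. On the boundary |t| =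
  r the derivative is the limit of its values at t (1 + 1/(n+1)), which lie strictly outside because
  r is positive.\<close>

lemma vd_eq_0_outside:
  assumes "smooth g" "\<And>t. \<bar>t\<bar> \<ge> r \<Longrightarrow> g t = 0" "\<bar>t\<bar> \<ge> r" "r > 0"
  shows "vd g t = 0"
proof -
  have "vd g s = 0" if "\<bar>s\<bar> > r" for s
  proof -
    have "((\<lambda>t. 0) has_vector_derivative 0) (at s)" by simp
    moreover have "open {s. \<bar>s\<bar> > r}" by (intro open_Collect_less continuous_intros)
    ultimately have "(g has_vector_derivative 0) (at s)"
      by (rule has_vector_derivative_transform_within_open[of _ _ _ "{s. \<bar>s\<bar> > r}"])
         (use that assms(2) in auto)
    then show ?thesis by (simp add: vd_def vector_derivative_at)
  qed note * = this
  have c: "continuous (at t) (vd g)"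
    using smooth_continuous[OF smooth_vd(1)[OF assms(1)], of UNIV]
    by (simp add: continuous_on_eq_continuous_at)
  have "(\<lambda>n. t * (1 + 1 / real (Suc n))) \<longlonglongrightarrow> t * (1 + 0)"
    by (intro tendsto_intros LIMSEQ_Suc[OF lim_1_over_n])
  then have lim: "(\<lambda>n. vd g (t * (1 + 1 / real (Suc n)))) \<longlonglongrightarrow> vd g t"
    using isCont_tendsto_compose[OF c] by simp
  have "vd g (t * (1 + 1 / real (Suc n))) = 0" for n
  proof (rule *)
    have "\<bar>t\<bar> * 1 < \<bar>t\<bar> * (1 + 1 / real (Suc n))"
      using assms(3,4) by (intro mult_strict_left_mono) auto
    then show "r < \<bar>t * (1 + 1 / real (Suc n))\<bar>" using assms(3) by (simp add: abs_mult)
  qed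
  with lim show ?thesis by (simp add: LIMSEQ_const_iff)
qed

text \<open>Only the value 1 at the origin is wanted, not a plateau around it: the dilated cutoffs
  then tend to 1 pointwise, which is enough for dominated convergence.\<close>

definition bump :: "real \<Rightarrow> complex" where
  "bump t = of_real (flatfn 0 (1 + t) * flatfn 0 (1 - t) / (flatfn 0 1)\<^sup>2)"

lemma smooth_bump: "smooth bump"
proof -
  have "smooth (\<lambda>t. of_real (flatfn 0 (1 * t + 1)) * of_real (flatfn 0 ((-1) * t + 1)) * of_real (1 / (flatfn 0 1)\<^sup>2))"
    by (intro smooth_mult smooth_const smooth_affine[OF smooth_flat])
  also have "(\<lambda>t. of_real (flatfn 0 (1 * t + 1)) * of_real (flatfn 0 ((-1) * t + 1)) * of_real (1 / (flatfn 0 1)\<^sup>2)) = bump"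
    by (auto simp: bump_def fun_eq_iff add.commute)
  finally show ?thesis .
qed

lemma bump_0: "bump 0 = 1"
  by (simp add: bump_def flatfn_def power2_eq_square)

lemma bump_outside: "\<bar>t\<bar> \<ge> 1 \<Longrightarrow> bump t = 0"
  by (auto simp: bump_def flatfn_def)

lemma bounded_of_compact_support:
  fixes g :: "real \<Rightarrow> complex"
  assumes "continuous_on UNIV g" "\<And>t. \<bar>t\<bar> \<ge> r \<Longrightarrow> g t = 0"
  obtains K where "K \<ge> 0" "\<And>t. norm (g t) \<le> K"
proof -
  have "compact (g ` {-r..r})"
    by (intro compact_continuous_image continuous_on_subset[OF assms(1)]) auto
  from compact_imp_bounded[OF this] obtain K where K: "\<And>x. x \<in> g ` {-r..r} \<Longrightarrow> norm x \<le> K"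
    unfolding bounded_iff by auto
  have "norm (g t) \<le> max K 0" for t
  proof (cases "\<bar>t\<bar> \<ge> r")
    case False
    then have "norm (g t) \<le> K" by (intro K imageI) auto
    then show ?thesis by simp
  qed (simp add: assms(2))
  with that show ?thesis by (metis max.cobounded2)
qed

subsection \<open>Test functions of product form\<close>

lemma has_derivative_prod_coords:
  fixes g :: "'n::finite \<Rightarrow> real \<Rightarrow> complex"
  assumes "\<And>j. smooth (g j)"
  shows "((\<lambda>x. \<Prod>j\<in>UNIV. g j (x $ j)) has_derivative
     (\<lambda>v. \<Sum>i\<in>UNIV. (v $ i) *\<^sub>R vd (g i) (x $ i) * (\<Prod>j\<in>UNIV - {i}. g j (x $ j)))) (at x)"
proof (rule has_derivative_prod)
  fix i :: 'n
  have "(g i has_derivative (\<lambda>h. h *\<^sub>R vd (g i) (x $ i))) (at (x $ i))"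
    using smooth_vd(2)[OF assms] by (simp add: has_vector_derivative_def)
  from has_derivative_compose[OF bounded_linear_imp_has_derivative[OF bounded_linear_vec_nth] this]
  show "((\<lambda>x. g i (x $ i)) has_derivative (\<lambda>v. (v $ i) *\<^sub>R vd (g i) (x $ i))) (at x)" .
qed

text \<open>Test functions are real, so a complex product enters as the real part of c times it; c =
  1 and c = -i later recover its real and imaginary parts. A derivative changes a single factor and
  preserves the shape, which allows induction over iterated derivatives.\<close>

lemma pderiv_dir_prod:
  fixes g :: "'n::finite \<Rightarrow> real \<Rightarrow> complex"
  assumes "\<And>j. smooth (g j)"
  shows "(\<lambda>x. Re (c * (\<Prod>j\<in>UNIV. g j (x $ j)))) differentiable (at x)"
    and "pderiv_dir i (\<lambda>x. Re (c * (\<Prod>j\<in>UNIV. g j (x $ j))))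
       = (\<lambda>x. Re (c * (\<Prod>j\<in>UNIV. (if j = i then vd (g j) else g j) (x $ j))))"
proof -
  let ?D = "\<lambda>x v. Re (c * (\<Sum>i\<in>UNIV. (v $ i) *\<^sub>R vd (g i) (x $ i) * (\<Prod>j\<in>UNIV - {i}. g j (x $ j))))"
  have D: "((\<lambda>x. Re (c * (\<Prod>j\<in>UNIV. g j (x $ j)))) has_derivative ?D x) (at x)" for x
    by (intro has_derivative_Re has_derivative_mult_right has_derivative_prod_coords assms)
  from D[of x] show "(\<lambda>x. Re (c * (\<Prod>j\<in>UNIV. g j (x $ j)))) differentiable (at x)"
    unfolding differentiable_def by blast
  show "pderiv_dir i (\<lambda>x. Re (c * (\<Prod>j\<in>UNIV. g j (x $ j))))
       = (\<lambda>x. Re (c * (\<Prod>j\<in>UNIV. (if j = i then vd (g j) else g j) (x $ j))))"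
  proof
    fix x :: "real^'n"
    have "pderiv_dir i (\<lambda>x. Re (c * (\<Prod>j\<in>UNIV. g j (x $ j)))) x = ?D x (axis i 1)"
      unfolding pderiv_dir_def frechet_derivative_at[OF D[of x], symmetric] ..
    also have "(\<Sum>l\<in>UNIV. (axis i 1 $ l) *\<^sub>R vd (g l) (x $ l) * (\<Prod>j\<in>UNIV - {l}. g j (x $ j)))
       = (\<Sum>l\<in>UNIV. if l = i then vd (g i) (x $ i) * (\<Prod>j\<in>UNIV - {i}. g j (x $ j)) else 0)"
      by (intro sum.cong) (auto simp: axis_def)
    also have "\<dots> = vd (g i) (x $ i) * (\<Prod>j\<in>UNIV - {i}. g j (x $ j))"
      by simp
    also have "\<dots> = (\<Prod>j\<in>UNIV. (if j = i then vd (g j) else g j) (x $ j))"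
      by (subst prod.remove[of UNIV i]) (auto intro!: prod.cong)
    finally show "pderiv_dir i (\<lambda>x. Re (c * (\<Prod>j\<in>UNIV. g j (x $ j)))) x
       = Re (c * (\<Prod>j\<in>UNIV. (if j = i then vd (g j) else g j) (x $ j)))" .
  qed
qed

lemma iter_pderiv_prod:
  fixes g :: "'n::finite \<Rightarrow> real \<Rightarrow> complex"
  assumes "\<And>j. smooth (g j)"
  shows "iter_pderiv is (\<lambda>x. Re (c * (\<Prod>j\<in>UNIV. g j (x $ j))))
     = (\<lambda>x. Re (c * (\<Prod>j\<in>UNIV. (vd ^^ count_list is j) (g j) (x $ j))))"
proof (induction "is")
  case (Cons i "is")
  have "\<And>j. smooth ((vd ^^ count_list is j) (g j))" by (intro smooth_funpow_vd assms)
  note d = pderiv_dir_prod(2)[OF this, of i c]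
  have "(\<Prod>j\<in>UNIV. (if j = i then vd ((vd ^^ count_list is j) (g j)) else (vd ^^ count_list is j) (g j)) (x $ j))
     = (\<Prod>j\<in>UNIV. (vd ^^ count_list (i # is) j) (g j) (x $ j))" for x
    by (intro prod.cong) auto
  with d show ?case by (simp only: iter_pderiv.simps Cons.IH)
qed simp

lemma test_fun_prod:
  fixes g :: "'n::finite \<Rightarrow> real \<Rightarrow> complex"
  assumes "\<And>j. smooth (g j)" and "\<And>j t. \<bar>t\<bar> \<ge> r \<Longrightarrow> g j t = 0"
  shows "test_fun (\<lambda>x. Re (c * (\<Prod>j\<in>UNIV. g j (x $ j))))"
  unfolding test_fun_def
proof (intro conjI allI)
  fix "is" and x :: "real^'n"
  show "iter_pderiv is (\<lambda>x. Re (c * (\<Prod>j\<in>UNIV. g j (x $ j)))) differentiable at x"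
    unfolding iter_pderiv_prod[OF assms(1)]
    by (intro pderiv_dir_prod(1) smooth_funpow_vd assms)
next
  have "{x. Re (c * (\<Prod>j\<in>UNIV. g j (x $ j))) \<noteq> 0} \<subseteq> cbox (\<chi> i. -r) (\<chi> i. r)"
  proof
    fix x assume x: "x \<in> {x. Re (c * (\<Prod>j\<in>UNIV. g j (x $ j))) \<noteq> 0}"
    have "\<bar>x $ j\<bar> < r" for j
    proof (rule ccontr)
      assume "\<not> \<bar>x $ j\<bar> < r"
      then have "(\<Prod>j\<in>UNIV. g j (x $ j)) = 0" using assms(2)[of "x $ j" j] by (intro prod_zero) auto
      with x show False by simp
    qed
    then show "x \<in> cbox (\<chi> i. -r) (\<chi> i. r)"
      by (simp add: mem_box_cart abs_less_iff less_imp_le minus_less_iff)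
  qed
  then have "bounded {x. Re (c * (\<Prod>j\<in>UNIV. g j (x $ j))) \<noteq> 0}"
    using bounded_cbox bounded_subset by blast
  then show "compact (closure {x. Re (c * (\<Prod>j\<in>UNIV. g j (x $ j))) \<noteq> 0})"
    by simp
qed

text \<open>The Laplacian of the complex product, written out by factors because
  \<open>iter_pderiv\<close> acts on real functions; \<open>sum_iter_pderiv_prod\<close> connects
  the two.\<close>

definition laplace_prod :: "('n::finite \<Rightarrow> real \<Rightarrow> complex) \<Rightarrow> real^'n \<Rightarrow> complex" where
  "laplace_prod g x = (\<Sum>i\<in>UNIV. vd (vd (g i)) (x $ i) * (\<Prod>j\<in>UNIV - {i}. g j (x $ j)))"

lemma sum_iter_pderiv_prod:
  fixes g :: "'n::finite \<Rightarrow> real \<Rightarrow> complex"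
  assumes "\<And>j. smooth (g j)"
  shows "(\<Sum>i\<in>UNIV. iter_pderiv [i, i] (\<lambda>x. Re (c * (\<Prod>j\<in>UNIV. g j (x $ j)))) x)
     = Re (c * laplace_prod g x)"
proof -
  have "(\<Prod>j\<in>UNIV. (vd ^^ count_list [i, i] j) (g j) (x $ j))
       = vd (vd (g i)) (x $ i) * (\<Prod>j\<in>UNIV - {i}. g j (x $ j))" for i
    by (subst prod.remove[of UNIV i]) (auto intro!: prod.cong)
  then show ?thesis
    unfolding iter_pderiv_prod[OF assms] laplace_prod_def by (simp add: sum_distrib_left)
qed

lemma continuous_on_coord: "continuous_on UNIV g \<Longrightarrow> continuous_on S (\<lambda>x::real^'n. g (x $ j))"
  by (rule continuous_on_compose2[of UNIV g]) (auto intro: continuous_intros)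

lemma continuous_on_smooth_prod:
  fixes g :: "'n::finite \<Rightarrow> real \<Rightarrow> complex"
  assumes "\<And>j. smooth (g j)"
  shows "continuous_on S (\<lambda>x. \<Prod>j\<in>I. g j (x $ j))" "continuous_on S (laplace_prod g)"
  unfolding laplace_prod_def[abs_def]
  by (intro continuous_on_prod continuous_on_coord continuous_on_sum continuous_on_mult
      smooth_continuous assms smooth_vd(1))+

lemma laplace_prod_outside:
  fixes g :: "'n::finite \<Rightarrow> real \<Rightarrow> complex"
  assumes "\<And>j. smooth (g j)" "\<And>j t. \<bar>t\<bar> \<ge> r \<Longrightarrow> g j t = 0" "r > 0" "\<bar>x $ l\<bar> \<ge> r"
  shows "(\<Prod>j\<in>UNIV. g j (x $ j)) = 0" "laplace_prod g x = 0"
proof -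
  show "(\<Prod>j\<in>UNIV. g j (x $ j)) = 0"
    using assms(2)[of "x $ l" l] assms(4) by (intro prod_zero) auto
  have z: "vd (vd (g l)) (x $ l) = 0"
    using assms by (intro vd_eq_0_outside smooth_vd(1)) auto
  have "vd (vd (g i)) (x $ i) * (\<Prod>j\<in>UNIV - {i}. g j (x $ j)) = 0" for i
  proof (cases "i = l")
    case True then show ?thesis using z by simp
  next
    case False
    then have "(\<Prod>j\<in>UNIV - {i}. g j (x $ j)) = 0"
      using assms(2)[of "x $ l" l] assms(4) by (intro prod_zero) auto
    then show ?thesis by simp
  qed
  then show "laplace_prod g x = 0" unfolding laplace_prod_def by (intro sum.neutral) blast
qed

section \<open>The weak equation for complex test functions of product form\<close>

lemma set_integrable_ball_of_norm_square:
  fixes u :: "real^'n::finite \<Rightarrow> complex"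
  assumes [measurable]: "u \<in> borel_measurable borel"
    and "\<And>R. set_integrable lborel (ball 0 R) (\<lambda>x. (norm (u x))\<^sup>2)"
  shows "set_integrable lborel (ball 0 R) u"
proof -
  have "set_integrable lborel (ball 0 R) (\<lambda>x::real^'n. 1::real)"
    by (auto simp: set_integrable_def intro!: integrable_real_indicator emeasure_bounded_finite)
  from set_integral_add(1)[OF assms(2)[of R] this]
  show ?thesis
    unfolding set_integrable_def
  proof (rule Bochner_Integration.integrable_bound)
    show "AE x in lborel. norm (indicator (ball 0 R) x *\<^sub>R u x) \<le> norm (indicator (ball 0 R) x *\<^sub>R ((norm (u x))\<^sup>2 + 1))"
    proof (rule AE_I2)
      fix x
      have "2 * norm (u x) \<le> (norm (u x))\<^sup>2 + 1"
        using zero_le_power2[of "norm (u x) - 1"] by (simp add: power2_eq_square algebra_simps)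
      then have "norm (u x) \<le> (norm (u x))\<^sup>2 + 1" using norm_ge_zero[of "u x"] by linarith
      then show "norm (indicator (ball 0 R) x *\<^sub>R u x) \<le> norm (indicator (ball 0 R) x *\<^sub>R ((norm (u x))\<^sup>2 + 1))"
        by (auto simp: indicator_def)
    qed
  qed (auto intro!: borel_measurable_scaleR borel_measurable_indicator)
qed

lemma integrable_mult_continuous_compact_support:
  fixes u w :: "real^'n::finite \<Rightarrow> complex"
  assumes [measurable]: "u \<in> borel_measurable borel"
    and "\<And>R. set_integrable lborel (ball 0 R) u"
    and w: "continuous_on UNIV w" "\<And>x. norm x \<ge> r \<Longrightarrow> w x = 0"
  shows "integrable lborel (\<lambda>x. u x * w x)"
proof -
  have [measurable]: "w \<in> borel_measurable borel" by (rule borel_measurable_continuous_onI[OF w(1)])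
  have "compact (w ` cball 0 r)"
    by (intro compact_continuous_image continuous_on_subset[OF w(1)]) auto
  from compact_imp_bounded[OF this] obtain K where "\<forall>z\<in>w ` cball 0 r. norm z \<le> K"
    unfolding bounded_iff by auto
  then have K: "norm (w x) \<le> K" if "norm x \<le> r" for x using that by simp
  have "set_integrable lborel (ball 0 r) (\<lambda>x. u x * complex_of_real K)"
    using assms(2) by (rule set_integrable_mult_left)
  then show ?thesis
    unfolding set_integrable_def
  proof (rule Bochner_Integration.integrable_bound)
    show "AE x in lborel. norm (u x * w x) \<le> norm (indicator (ball 0 r) x *\<^sub>R (u x * complex_of_real K))"
    proof (rule AE_I2)
      fix x
      show "norm (u x * w x) \<le> norm (indicator (ball 0 r) x *\<^sub>R (u x * complex_of_real K))"
      proof (cases "norm x < r")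
        case True
        then show ?thesis using K[of x] by (auto simp: norm_mult intro!: mult_left_mono)
      qed (use w(2)[of x] in auto)
    qed
  qed measurable
qed

text \<open>Both sides of the weak equation are complex linear in the test function, so the real and
  imaginary parts of the product are tested separately and recombined. The sign is reversed to have
  the Laplacian plus \<open>lam\<close> on the left.\<close>

lemma helmholtz_prod:
  fixes u f :: "real^'n::finite \<Rightarrow> complex" and g :: "'n \<Rightarrow> real \<Rightarrow> complex"
  assumes u [measurable]: "u \<in> borel_measurable borel" and "\<And>R. set_integrable lborel (ball 0 R) u"
    and f [measurable]: "f \<in> borel_measurable borel" and "\<And>R. set_integrable lborel (ball 0 R) f"
    and weak: "\<And>\<phi>. test_fun \<phi> \<Longrightarrow>
      (LINT x | lborel. u x * complex_of_real
          (- (\<Sum>i\<in>UNIV. iter_pderiv [i, i] \<phi> x) - lam * \<phi> x))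
        = (LINT x | lborel. f x * complex_of_real (\<phi> x))"
    and g: "\<And>j. smooth (g j)" "\<And>j t. \<bar>t\<bar> \<ge> r \<Longrightarrow> g j t = 0" and "r > 0"
  shows "(LINT x | lborel. u x * (laplace_prod g x + lam * (\<Prod>j\<in>UNIV. g j (x $ j))))
     = - (LINT x | lborel. f x * (\<Prod>j\<in>UNIV. g j (x $ j)))"
proof -
  let ?P = "\<lambda>x. \<Prod>j\<in>UNIV. g j (x $ j)"
  let ?L = "\<lambda>x. laplace_prod g x + complex_of_real lam * ?P x"
  \<comment> \<open>If every coordinate were below r in absolute value, the l1 norm, which dominates
    the Euclidean one, would be below \<open>CARD('n) * r\<close>.\<close>
  have far: "?P x = 0 \<and> laplace_prod g x = 0" if "norm x \<ge> real CARD('n) * r" for x :: "real^'n"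
  proof -
    have "\<exists>l. \<bar>x $ l\<bar> \<ge> r"
    proof (rule ccontr)
      assume "\<not> (\<exists>l. \<bar>x $ l\<bar> \<ge> r)"
      then have "\<bar>x $ l\<bar> < r" for l by (auto simp: not_le)
      then have "(\<Sum>l\<in>UNIV. \<bar>x $ l\<bar>) < (\<Sum>l\<in>(UNIV::'n set). r)" by (intro sum_strict_mono) auto
      with norm_le_l1_cart[of x] that show False by simp
    qed
    with laplace_prod_outside[of g r x] g \<open>r > 0\<close> show ?thesis by auto
  qed
  have cont: "continuous_on UNIV ?P" "continuous_on UNIV ?L"
    by (intro continuous_intros continuous_on_smooth_prod g)+
  have re: "integrable lborel (\<lambda>x. v x * complex_of_real (Re (c * w x)))"
    if "v = u \<or> v = f" "w = ?P \<or> w = ?L" for v w and c :: complex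
  proof (rule integrable_mult_continuous_compact_support[where r = "real CARD('n) * r"])
    show "continuous_on UNIV (\<lambda>x. complex_of_real (Re (c * w x)))"
      using that(2) cont by (auto intro!: continuous_intros)
    show "complex_of_real (Re (c * w x)) = 0" if "real CARD('n) * r \<le> norm x" for x
    proof -
      have "w x = 0" using \<open>w = ?P \<or> w = ?L\<close> far[OF that] by (elim disjE) (simp_all only:, simp_all)
      then show ?thesis by simp
    qed
  qed (use that(1) assms in auto)
  have eq: "(LINT x | lborel. u x * complex_of_real (Re (c * ?L x)))
      = - (LINT x | lborel. f x * complex_of_real (Re (c * ?P x)))" for c
  proof -
    have "(LINT x | lborel. u x * complex_of_real (Re (c * ?L x))) =
       - (LINT x | lborel. u x * complex_of_real
          (- (\<Sum>i\<in>UNIV. iter_pderiv [i, i] (\<lambda>x. Re (c * ?P x)) x) - lam * Re (c * ?P x)))"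
      unfolding sum_iter_pderiv_prod[OF g(1)]
      by (subst Bochner_Integration.integral_minus[symmetric], intro Bochner_Integration.integral_cong refl)
         (simp add: algebra_simps)
    also have "\<dots> = - (LINT x | lborel. f x * complex_of_real (Re (c * ?P x)))"
      by (subst weak[OF test_fun_prod[OF g]]) auto
    finally show ?thesis .
  qed
  have split: "(LINT x | lborel. v x * w x) =
      (LINT x | lborel. v x * complex_of_real (Re (1 * w x))) +
      \<i> * (LINT x | lborel. v x * complex_of_real (Re ((-\<i>) * w x)))"
    if "v = u \<or> v = f" "w = ?P \<or> w = ?L" for v w
  proof -
    have "(LINT x | lborel. v x * w x) = (LINT x | lborel. v x * complex_of_real (Re (1 * w x)) +
      \<i> * (v x * complex_of_real (Re ((-\<i>) * w x))))"
    proof (intro Bochner_Integration.integral_cong refl)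
      fix x
      have "w x = complex_of_real (Re (1 * w x)) + \<i> * complex_of_real (Re ((-\<i>) * w x))"
        by (simp add: complex_eq_iff)
      then show "v x * w x = v x * complex_of_real (Re (1 * w x)) + \<i> * (v x * complex_of_real (Re ((-\<i>) * w x)))"
        by (metis (no_types, lifting) distrib_left mult.left_commute)
    qed
    also have "\<dots> = (LINT x | lborel. v x * complex_of_real (Re (1 * w x))) +
      (LINT x | lborel. \<i> * (v x * complex_of_real (Re ((-\<i>) * w x))))"
      by (intro Bochner_Integration.integral_add integrable_mult_right re that)
    finally show ?thesis by simp
  qed
  show ?thesis
    unfolding split[of u ?L, OF disjI1[OF refl] disjI2[OF refl]]
      split[of f ?P, OF disjI2[OF refl] disjI1[OF refl]] eq by simp
qed

subsection \<open>Integration over Euclidean space\<close>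

lemma borel_measurable_vec_nth' [measurable (raw)]:
  fixes f :: "'a \<Rightarrow> real^'n"
  shows "f \<in> borel_measurable M \<Longrightarrow> (\<lambda>x. f x $ k) \<in> borel_measurable M"
  by (rule measurable_compose[of f M borel "\<lambda>v. v $ k"])
     (auto intro!: borel_measurable_continuous_onI continuous_intros)

text \<open>\<open>lborel\<close> on \<open>real^'n\<close> is the image of a product measure
  indexed by \<open>Basis\<close>. The bijection from i to \<open>axis i 1\<close> relabels the
  factors, and the product theorem for finitely many measures applies.\<close>

lemma
  fixes g :: "'n::finite \<Rightarrow> real \<Rightarrow> 'b::{real_normed_field, banach, second_countable_topology}"
  assumes int: "\<And>i. integrable lborel (g i)"
  shows integrable_prod_coords: "integrable lborel (\<lambda>x::real^'n. \<Prod>i\<in>UNIV. g i (x $ i))"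
    and integral_prod_coords: "(LINT x|lborel. (\<Prod>i\<in>UNIV. g i ((x::real^'n) $ i))) = (\<Prod>i\<in>UNIV. integral\<^sup>L lborel (g i))"
proof -
  interpret product_sigma_finite "\<lambda>_::real^'n. lborel :: real measure" by standard
  define e :: "'n \<Rightarrow> real^'n" where "e i = axis i 1" for i
  have inj: "inj e" by (auto simp: inj_def e_def axis_eq_axis)
  have Basis: "(Basis :: (real^'n) set) = range e" by (auto simp: Basis_vec_def e_def)
  define G where "G b = g (inv e b)" for b
  have intG: "integrable lborel (G b)" for b using int by (simp add: G_def)
  have [measurable]: "g i \<in> borel_measurable borel" for i using borel_measurable_integrable[OF int] by simp
  have eq: "(\<Prod>i\<in>UNIV. g i ((\<Sum>b\<in>Basis. f b *\<^sub>R b) $ i)) = (\<Prod>b\<in>Basis. G b (f b))" for f :: "real^'n \<Rightarrow> real"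
  proof -
    have "(\<Sum>b\<in>Basis. f b *\<^sub>R b) $ i = f (e i)" for i
    proof -
      have "(\<Sum>b\<in>Basis. f b *\<^sub>R b) $ i = (\<Sum>b\<in>Basis. f b * (b $ i))" by simp
      also have "\<dots> = (\<Sum>j\<in>UNIV. f (e j) * (e j $ i))"
        unfolding Basis by (subst sum.reindex[OF inj]) simp
      also have "\<dots> = (\<Sum>j\<in>UNIV. if j = i then f (e i) else 0)"
        by (intro sum.cong) (auto simp: e_def axis_def)
      finally show ?thesis by simp
    qed
    moreover have "(\<Prod>b\<in>Basis. G b (f b)) = (\<Prod>i\<in>UNIV. g i (f (e i)))"
      unfolding Basis by (subst prod.reindex[OF inj]) (simp add: G_def inj)
    ultimately show ?thesis by simp
  qed
  have m: "(\<lambda>f::real^'n \<Rightarrow> real. \<Sum>b\<in>Basis. f b *\<^sub>R b) \<in> (\<Pi>\<^sub>M b\<in>Basis. lborel) \<rightarrow>\<^sub>M borel"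
    by measurable
  have mg: "(\<lambda>x::real^'n. \<Prod>i\<in>UNIV. g i (x $ i)) \<in> borel_measurable borel" by measurable
  show "integrable lborel (\<lambda>x::real^'n. \<Prod>i\<in>UNIV. g i (x $ i))"
    by (subst lborel_eq, subst integrable_distr_eq[OF m mg], subst eq)
       (rule product_integrable_prod, auto intro: intG)
  have "(LINT x|lborel. (\<Prod>i\<in>UNIV. g i ((x::real^'n) $ i))) = (\<Prod>b\<in>Basis. integral\<^sup>L lborel (G b))"
    by (subst lborel_eq, subst integral_distr[OF m mg], subst eq)
       (rule product_integral_prod, auto intro: intG)
  also have "\<dots> = (\<Prod>i\<in>UNIV. integral\<^sup>L lborel (g i))"
    unfolding Basis by (subst prod.reindex[OF inj]) (simp add: G_def inj)
  finally show "(LINT x|lborel. (\<Prod>i\<in>UNIV. g i ((x::real^'n) $ i))) = (\<Prod>i\<in>UNIV. integral\<^sup>L lborel (g i))" .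
qed

section \<open>Exponential and Gaussian weights\<close>

lemma power_le_fact_mult_exp:
  fixes x :: real assumes "x \<ge> 0" shows "x ^ q \<le> fact q * exp x"
proof -
  have s: "summable (\<lambda>n. x ^ n / fact n)"
    using summable_exp[of x] by (simp add: divide_inverse mult.commute)
  have "(\<Sum>n\<in>{q}. x ^ n / fact n) \<le> (\<Sum>n. x ^ n / fact n)"
    by (rule sum_le_suminf[OF s]) (use assms in auto)
  also have "\<dots> = exp x" by (simp add: exp_def divide_inverse mult.commute)
  finally show ?thesis by (simp add: field_simps)
qed

text \<open>Decomposition by the integer part N of |x|: there the weight is at most exp (-cN) and
  the mass of g at most that of the ball of radius N + 1, which grows polynomially.\<close>

lemma integrable_mult_exp_norm:
  fixes g :: "'a::euclidean_space \<Rightarrow> real"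
  assumes [measurable]: "g \<in> borel_measurable borel" and pos: "\<And>x. g x \<ge> 0"
    and int: "\<And>N::nat. set_integrable lborel (ball 0 (real N)) g"
    and bd: "\<And>N::nat. N \<ge> 1 \<Longrightarrow> (LINT x:ball 0 (real N)|lborel. g x) \<le> C * real N ^ q"
    and "C \<ge> 0" "c > 0"
  shows "integrable lborel (\<lambda>x. g x * exp (- c * norm x))"
proof (rule integrableI_bounded)
  define T where "T N x = indicator (ball 0 (real (Suc N))) x * g x * exp (- c * real N)" for N x
  have [measurable]: "ball (0::'a) r \<in> sets borel" for r by simp
  have Tm [measurable]: "(\<lambda>x. T N x) \<in> borel_measurable borel" for N
    unfolding T_def by measurable
  have Tpos: "T N x \<ge> 0" for N x by (simp add: T_def pos)
  have le: "ennreal (norm (g x * exp (- c * norm x))) \<le> (\<Sum>N. ennreal (T N x))" for x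
  proof -
    define N where "N = nat \<lfloor>norm x\<rfloor>"
    have N: "real N \<le> norm x" "norm x < real (Suc N)"
      unfolding N_def by (auto simp: of_nat_floor) linarith
    have "norm (g x * exp (- c * norm x)) \<le> T N x"
      using N \<open>c > 0\<close> pos[of x] by (auto simp: T_def abs_mult intro!: mult_left_mono)
    then have "ennreal (norm (g x * exp (- c * norm x))) \<le> (\<Sum>N\<in>{N}. ennreal (T N x))"
      by (simp add: ennreal_leI)
    also have "\<dots> \<le> (\<Sum>N. ennreal (T N x))" by (rule sum_le_suminf) auto
    finally show ?thesis .
  qed
  define D where "D = C * ((2 / c) ^ q * fact q * exp (c / 2))"
  have IT: "(\<integral>\<^sup>+x. ennreal (T N x) \<partial>lborel) \<le> ennreal (D * exp (- c / 2) ^ N)" for N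
  proof -
    have i: "integrable lborel (T N)"
      using int[of "Suc N"] unfolding set_integrable_def T_def
      by (intro integrable_mult_left) (simp add: mult.commute)
    have "(\<integral>\<^sup>+x. ennreal (T N x) \<partial>lborel) = ennreal (LINT x|lborel. T N x)"
      by (rule nn_integral_eq_integral[OF i]) (simp add: Tpos)
    also have "(LINT x|lborel. T N x) = (LINT x:ball 0 (real (Suc N))|lborel. g x) * exp (- c * real N)"
      unfolding T_def set_lebesgue_integral_def by simp
    also have "\<dots> \<le> C * real (Suc N) ^ q * exp (- c * real N)"
      by (intro mult_right_mono bd) auto
    \<comment> \<open>Half of the exponential decay is spent on the polynomial, through y^q <= q!
      exp y with y = c (N+1) / 2. The other half leaves a geometric series.\<close>
    also have "real (Suc N) ^ q = (2 / c) ^ q * (c / 2 * real (Suc N)) ^ q"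
      unfolding power_mult_distrib[symmetric] using \<open>c > 0\<close> by (intro arg_cong[where f = "\<lambda>x. x ^ q"]) (simp add: field_simps)
    also have "C * ((2 / c) ^ q * (c / 2 * real (Suc N)) ^ q) * exp (- c * real N)
        \<le> C * ((2 / c) ^ q * (fact q * exp (c / 2 * real (Suc N)))) * exp (- c * real N)"
      using assms(5,6) by (intro mult_right_mono mult_left_mono power_le_fact_mult_exp) auto
    also have "\<dots> = C * ((2 / c) ^ q * fact q) * exp (c / 2 * real (Suc N) - c * real N)"
      by (simp add: exp_add[symmetric] mult.assoc)
    also have "c / 2 * real (Suc N) - c * real N = c / 2 + real N * (- c / 2)"
      by (simp add: field_simps)
    also have "C * ((2 / c) ^ q * fact q) * exp (c / 2 + real N * (- c / 2)) = D * exp (- c / 2) ^ N"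
      unfolding D_def exp_add exp_of_nat_mult by simp
    finally show ?thesis by (simp add: ennreal_leI)
  qed
  have D0: "D \<ge> 0" using assms(5,6) by (simp add: D_def)
  have sm: "summable (\<lambda>N. D * exp (- c / 2) ^ N)"
    using \<open>c > 0\<close> by (intro summable_mult summable_geometric) simp
  have "(\<integral>\<^sup>+x. ennreal (norm (g x * exp (- c * norm x))) \<partial>lborel) \<le> (\<integral>\<^sup>+x. (\<Sum>N. ennreal (T N x)) \<partial>lborel)"
    by (intro nn_integral_mono le)
  also have "\<dots> = (\<Sum>N. \<integral>\<^sup>+x. ennreal (T N x) \<partial>lborel)"
    by (intro nn_integral_suminf) simp
  also have "\<dots> \<le> (\<Sum>N. ennreal (D * exp (- c / 2) ^ N))"
    by (intro suminf_le IT) auto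
  also have "\<dots> = ennreal (\<Sum>N. D * exp (- c / 2) ^ N)"
    by (intro suminf_ennreal2 sm) (simp add: D0)
  also have "\<dots> < \<infinity>" by simp
  finally show "(\<integral>\<^sup>+x. ennreal (norm (g x * exp (- c * norm x))) \<partial>lborel) < \<infinity>" .
qed measurable

lemma integrable_exp_norm:
  assumes "c > 0"
  shows "integrable lborel (\<lambda>x::'a::euclidean_space. exp (- c * norm x))"
proof -
  have "integrable lborel (\<lambda>x::'a. 1 * exp (- c * norm x))"
  proof (rule integrable_mult_exp_norm[where q = "DIM('a)" and C = "unit_ball_vol DIM('a)"])
    show "set_integrable lborel (ball 0 (real N)) (\<lambda>x::'a. 1::real)" for N
      by (auto simp: set_integrable_def intro!: integrable_real_indicator emeasure_bounded_finite)
    show "(LINT x:ball (0::'a) (real N)|lborel. 1) \<le> unit_ball_vol DIM('a) * real N ^ DIM('a)" for N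
      by (simp add: set_lebesgue_integral_def content_ball)
  qed (use assms in auto)
  then show ?thesis by simp
qed

text \<open>Completing the square: c (r - d / (2c))^2 is nonnegative.\<close>

lemma exp_square_le:
  fixes r :: real assumes "c > 0"
  shows "exp (- c * r\<^sup>2) \<le> exp (d\<^sup>2 / (4 * c)) * exp (- d * r)"
proof -
  have "0 \<le> c * (r - d / (2 * c))\<^sup>2" using assms by simp
  also have "\<dots> = c * r\<^sup>2 - d * r + d\<^sup>2 / (4 * c)"
    using assms by (simp add: power2_eq_square field_simps)
  finally have "- c * r\<^sup>2 \<le> d\<^sup>2 / (4 * c) + (- d * r)" by simp
  then show ?thesis unfolding exp_add[symmetric] by simp
qed

lemma integrable_gauss:
  assumes "c > 0"
  shows "integrable lborel (\<lambda>x::'a::euclidean_space. exp (- c * (norm x)\<^sup>2))"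
proof (rule Bochner_Integration.integrable_bound)
  show "integrable lborel (\<lambda>x::'a. exp (1\<^sup>2 / (4 * c)) * exp (- 1 * norm x))"
    by (intro integrable_mult_right integrable_exp_norm) simp
  show "AE x::'a in lborel. norm (exp (- c * (norm x)\<^sup>2)) \<le> norm (exp (1\<^sup>2 / (4 * c)) * exp (- 1 * norm x))"
    using exp_square_le[OF assms, of _ 1] by (intro AE_I2) (simp add: abs_mult del: power_one)
qed measurable

text \<open>A pointwise majorant that splits into a function of x times a function of y gives
  integrability on the product, and of every section rather than almost every one.\<close>

lemma fubini_bound:
  fixes f :: "'a::euclidean_space \<Rightarrow> 'b::euclidean_space \<Rightarrow> complex"
  assumes f: "(\<lambda>(x, y). f x y) \<in> borel_measurable (borel \<Otimes>\<^sub>M borel)"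
    and g: "integrable lborel g" and h: "integrable lborel h"
    and le: "\<And>x y. norm (f x y) \<le> g x * h y"
  shows "(LINT x|lborel. LINT y|lborel. f x y) = (LINT y|lborel. LINT x|lborel. f x y)"
    and "integrable lborel (\<lambda>x. LINT y|lborel. f x y)"
    and "integrable lborel (\<lambda>y. LINT x|lborel. f x y)"
    and "integrable lborel (f x)" and "integrable lborel (\<lambda>x. f x y)"
proof -
  have [measurable]: "g \<in> borel_measurable borel" "h \<in> borel_measurable borel"
    using borel_measurable_integrable[OF g] borel_measurable_integrable[OF h] by auto
  have f' [measurable]: "(\<lambda>(x, y). f x y) \<in> borel_measurable (lborel \<Otimes>\<^sub>M lborel)"
    using f by (simp cong: measurable_cong_sets add: sets_pair_measure_cong[OF sets_lborel sets_lborel])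
  have gh: "integrable (lborel \<Otimes>\<^sub>M lborel) (\<lambda>(x, y). g x * h y)"
  proof (rule lborel_pair.Fubini_integrable)
    show "integrable lborel (\<lambda>x. LINT y|lborel. norm (case (x, y) of (x, y) \<Rightarrow> g x * h y))"
      using g by (simp add: abs_mult)
    show "AE x in lborel. integrable lborel (\<lambda>y. case (x, y) of (x, y) \<Rightarrow> g x * h y)"
      using h by simp
  qed measurable
  have int: "integrable (lborel \<Otimes>\<^sub>M lborel) (\<lambda>(x, y). f x y)"
    by (rule Bochner_Integration.integrable_bound[OF gh f'])
       (use order_trans[OF le abs_ge_self] in \<open>auto\<close>)
  show "(LINT x|lborel. LINT y|lborel. f x y) = (LINT y|lborel. LINT x|lborel. f x y)"
    using lborel_pair.Fubini_integral[of f] int by (simp add: case_prod_beta')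
  show "integrable lborel (\<lambda>x. LINT y|lborel. f x y)"
    using lborel_pair.integrable_fst[of f] int by (simp add: case_prod_beta')
  show "integrable lborel (\<lambda>y. LINT x|lborel. f x y)"
    using lborel_pair.integrable_snd[of f] int by (simp add: case_prod_beta')
  have "integrable lborel (\<lambda>y. g x * h y)" using h by simp
  then show "integrable lborel (f x)"
    by (rule Bochner_Integration.integrable_bound)
       (use order_trans[OF le abs_ge_self] f in \<open>auto\<close>)
  have "integrable lborel (\<lambda>x. g x * h y)" using g by simp
  then show "integrable lborel (\<lambda>x. f x y)"
    by (rule Bochner_Integration.integrable_bound)
       (use order_trans[OF le abs_ge_self] f in \<open>auto\<close>)
qed

section \<open>The Fourier transform of a Gaussian\<close>

lemma integrable_gauss_1:
  assumes "R > 0"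
  shows "integrable lborel (\<lambda>t::real. complex_of_real (exp (- t\<^sup>2 / (2 * R\<^sup>2))))"
  using integrable_gauss[of "1 / (2 * R\<^sup>2)", where 'a = real] assms
  by (intro integrable_of_real) simp

text \<open>The substitution of R t for t reduces this to the characteristic function of the
  standard normal distribution.\<close>

lemma gauss_fourier:
  assumes "R > 0"
  shows "(LINT t|lborel. iexp (s * t) * complex_of_real (exp (- t\<^sup>2 / (2 * R\<^sup>2)))) =
     complex_of_real (R * sqrt (2 * pi) * exp (- (R * s)\<^sup>2 / 2))"
proof -
  have "(LINT t|lborel. iexp (s * t) * complex_of_real (exp (- t\<^sup>2 / (2 * R\<^sup>2)))) =
      \<bar>R\<bar> *\<^sub>R (LINT t|lborel. iexp (s * (0 + R * t)) * complex_of_real (exp (- (0 + R * t)\<^sup>2 / (2 * R\<^sup>2))))"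
    by (rule lborel_integral_real_affine) (use assms in simp)
  also have "(LINT t|lborel. iexp (s * (0 + R * t)) * complex_of_real (exp (- (0 + R * t)\<^sup>2 / (2 * R\<^sup>2)))) =
      (LINT t|lborel. sqrt (2 * pi) * (std_normal_density t *\<^sub>R iexp (R * s * t)))"
    using assms by (intro Bochner_Integration.integral_cong)
      (auto simp: std_normal_density_def power_mult_distrib scaleR_conv_of_real mult_ac)
  also have "\<dots> = sqrt (2 * pi) * (LINT t|lborel. std_normal_density t *\<^sub>R iexp (R * s * t))"
    by (rule integral_mult_right_zero)
  also have "(LINT t|lborel. std_normal_density t *\<^sub>R iexp (R * s * t)) = char std_normal_distribution (R * s)"
    unfolding char_def by (subst integral_density) auto
  also have "sqrt (2 * pi) * char std_normal_distribution (R * s) = complex_of_real (sqrt (2 * pi) * exp (- (R * s)\<^sup>2 / 2))"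
    unfolding char_std_normal_distribution by simp
  finally show ?thesis using assms by (simp add: scaleR_conv_of_real)
qed

subsection \<open>Superpositions of plane waves\<close>

text \<open>To avoid a second type of dimension \<open>n - 1\<close>, frequencies range over \<open>real^'n\<close> as well; their
  \<open>k\<close>-th component is a dummy over which the amplitudes are integrated.\<close>

definition phase :: "'n::finite \<Rightarrow> real^'n \<Rightarrow> real^'n \<Rightarrow> real" where
  "phase k \<xi> x = (\<Sum>i\<in>UNIV - {k}. \<xi> $ i * x $ i)"

definition wave :: "'n::finite \<Rightarrow> (real^'n \<Rightarrow> real \<Rightarrow> complex) \<Rightarrow> real^'n \<Rightarrow> complex" where
  "wave k A x = (LINT \<xi>|lborel. iexp (phase k \<xi> x) * A \<xi> (x $ k))"

text \<open>No regularity in \<xi> is imposed, so that amplitudes may jump across |\<xi>'|^2 =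
  \<lambda>. The Gaussian bound includes the dummy component, and its uniformity in t is what limits
  the growth of the wave in the direction \<open>k\<close> to one factor R.\<close>

definition amplitude :: "(real^'n::finite \<Rightarrow> real \<Rightarrow> complex) \<Rightarrow> bool" where
  "amplitude A \<longleftrightarrow> (\<lambda>(\<xi>, t). A \<xi> t) \<in> borel_measurable (borel \<Otimes>\<^sub>M borel) \<and>
     (\<exists>C c. c > 0 \<and> (\<forall>\<xi> t. norm (A \<xi> t) \<le> C * exp (- c * (norm \<xi>)\<^sup>2)))"

lemma borel_measurable_phase [measurable (raw)]:
  assumes [measurable]: "f \<in> borel_measurable M" "g \<in> borel_measurable M"
  shows "(\<lambda>p. phase k (f p) (g p)) \<in> borel_measurable M"
  unfolding phase_def by measurable

lemma borel_measurable_cnj [measurable (raw)]: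
  "f \<in> borel_measurable M \<Longrightarrow> (\<lambda>x. cnj (f x)) \<in> borel_measurable M"
  by (rule measurable_compose[of f M borel cnj])
     (auto intro!: borel_measurable_continuous_onI continuous_intros)

text \<open>If f is not integrable its integral has the default value 0, and the majorant is
  nonnegative; so the bound holds for arbitrary f.\<close>

lemma norm_lebesgue_integral_le:
  fixes f :: "'a \<Rightarrow> 'b::{banach, second_countable_topology}"
  assumes g: "integrable M g" and le: "\<And>x. norm (f x) \<le> g x"
  shows "norm (integral\<^sup>L M f) \<le> integral\<^sup>L M g"
proof (cases "integrable M f")
  case True
  have "norm (integral\<^sup>L M f) \<le> (LINT x|M. norm (f x))" by (rule integral_norm_bound)
  also have "\<dots> \<le> integral\<^sup>L M g" using True g le by (intro integral_mono) auto
  finally show ?thesis .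
next
  case False
  have "0 \<le> g x" for x by (rule order_trans[OF norm_ge_zero le])
  then show ?thesis by (simp add: not_integrable_integral_eq[OF False])
qed

lemma norm_power2_vec: "(norm (x::real^'n::finite))\<^sup>2 = (\<Sum>i\<in>UNIV. (x $ i)\<^sup>2)"
  by (simp add: norm_vec_def L2_set_def sum_nonneg)

lemma amplitudeE:
  assumes "amplitude A"
  obtains C c where "C \<ge> 0" "c > 0" "\<And>\<xi> t. norm (A \<xi> t) \<le> C * exp (- c * (norm \<xi>)\<^sup>2)"
proof -
  obtain C c where *: "c > 0" "\<And>\<xi> t. norm (A \<xi> t) \<le> C * exp (- c * (norm \<xi>)\<^sup>2)"
    using assms unfolding amplitude_def by blast
  have "C \<ge> 0" using order_trans[OF norm_ge_zero *(2)[of 0 0]] by simp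
  with * that show ?thesis by blast
qed

lemma amplitude_measurable:
  "amplitude A \<Longrightarrow> (\<lambda>(\<xi>, t). A \<xi> t) \<in> borel_measurable (borel \<Otimes>\<^sub>M borel)"
  by (simp add: amplitude_def)

lemma
  fixes v :: "real^'n::finite \<Rightarrow> complex"
  assumes A: "amplitude A" and v: "integrable lborel v"
  shows integral_mult_wave: "(LINT x|lborel. v x * wave k A x) =
      (LINT \<xi>|lborel. LINT x|lborel. v x * (iexp (phase k \<xi> x) * A \<xi> (x $ k)))"
    and integrable_mult_wave: "integrable lborel (\<lambda>x. v x * wave k A x)"
    and integrable_mult_wave': "integrable lborel (\<lambda>\<xi>. LINT x|lborel. v x * (iexp (phase k \<xi> x) * A \<xi> (x $ k)))"
    and integrable_mult_wave_integrand: "integrable lborel (\<lambda>x. v x * (iexp (phase k \<xi> x) * A \<xi> (x $ k)))"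
proof -
  obtain C c where C: "C \<ge> 0" "c > 0" "\<And>\<xi> t. norm (A \<xi> t) \<le> C * exp (- c * (norm \<xi>)\<^sup>2)"
    using amplitudeE[OF A] by blast
  note [measurable] = amplitude_measurable[OF A]
  have [measurable]: "v \<in> borel_measurable borel" using borel_measurable_integrable[OF v] by simp
  have m: "(\<lambda>(x, \<xi>). v x * (iexp (phase k \<xi> x) * A \<xi> (x $ k))) \<in> borel_measurable (borel \<Otimes>\<^sub>M borel)"
    by measurable
  have b: "norm (v x * (iexp (phase k \<xi> x) * A \<xi> (x $ k))) \<le> norm (v x) * (C * exp (- c * (norm \<xi>)\<^sup>2))" for x \<xi>
    using C(3)[of \<xi> "x $ k"] by (simp add: norm_mult mult_left_mono)
  have i: "integrable lborel (\<lambda>\<xi>::real^'n. C * exp (- c * (norm \<xi>)\<^sup>2))"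
    by (intro integrable_mult_right integrable_gauss C)
  note F = fubini_bound[OF m integrable_norm[OF v] i b]
  show "(LINT x|lborel. v x * wave k A x) =
      (LINT \<xi>|lborel. LINT x|lborel. v x * (iexp (phase k \<xi> x) * A \<xi> (x $ k)))"
    using F(1) by (simp add: wave_def)
  show "integrable lborel (\<lambda>x. v x * wave k A x)"
    using F(2) by (simp add: wave_def)
  show "integrable lborel (\<lambda>\<xi>. LINT x|lborel. v x * (iexp (phase k \<xi> x) * A \<xi> (x $ k)))"
    "integrable lborel (\<lambda>x. v x * (iexp (phase k \<xi> x) * A \<xi> (x $ k)))"
    using F(3,5) by auto
qed

lemma borel_measurable_wave [measurable]:
  assumes "amplitude A"
  shows "wave k A \<in> borel_measurable borel"
proof -
  note [measurable] = amplitude_measurable[OF assms]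
  show ?thesis unfolding wave_def[abs_def] by measurable
qed

lemma wave_bounded:
  fixes A :: "real^'n::finite \<Rightarrow> real \<Rightarrow> complex"
  assumes "amplitude A"
  obtains B where "B \<ge> 0" "\<And>x. norm (wave k A x) \<le> B"
proof -
  obtain C c where C: "C \<ge> 0" "c > 0" "\<And>\<xi> t. norm (A \<xi> t) \<le> C * exp (- c * (norm \<xi>)\<^sup>2)"
    using amplitudeE[OF assms] by blast
  have i: "integrable lborel (\<lambda>\<xi>::real^'n. C * exp (- c * (norm \<xi>)\<^sup>2))"
    by (intro integrable_mult_right integrable_gauss C)
  show ?thesis
  proof
    show "0 \<le> (LINT \<xi>|lborel. C * exp (- c * (norm (\<xi>::real^'n))\<^sup>2))"
      using C by (intro Bochner_Integration.integral_nonneg) auto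
    show "norm (wave k A x) \<le> (LINT \<xi>|lborel. C * exp (- c * (norm (\<xi>::real^'n))\<^sup>2))" for x
      unfolding wave_def by (rule norm_lebesgue_integral_le[OF i])
        (use C in \<open>auto simp: norm_mult\<close>)
  qed
qed

text \<open>The kernel has height of order R and width of order 1/R, so its mass is independent of
  R. This is the bounded row integral in Schur's test of \<open>wave_L2\<close>.\<close>

lemma integral_gauss_shift:
  assumes "R > 0"
  shows "integrable lborel (\<lambda>t. R * sqrt (2 * pi) * exp (- (R * (s - t))\<^sup>2 / 2))"
    and "(LINT t|lborel. R * sqrt (2 * pi) * exp (- (R * (s - t))\<^sup>2 / 2)) = 2 * pi"
proof -
  have eq: "exp (- (R * (s - (s + 1 * t)))\<^sup>2 / 2) = exp (- t\<^sup>2 / (2 * (1 / R)\<^sup>2))" for t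
    using assms by (simp add: power_mult_distrib power_divide)
  have i: "integrable lborel (\<lambda>t. exp (- (R * (s - (s + 1 * t)))\<^sup>2 / 2))"
    unfolding eq using integrable_gauss[of "1 / (2 * (1 / R)\<^sup>2)", where 'a = real] assms by simp
  then have "integrable lborel (\<lambda>t. exp (- (R * (s - t))\<^sup>2 / 2))"
    using lborel_integrable_real_affine_iff[of 1 "\<lambda>t. exp (- (R * (s - t))\<^sup>2 / 2)" s] by simp
  then show "integrable lborel (\<lambda>t. R * sqrt (2 * pi) * exp (- (R * (s - t))\<^sup>2 / 2))"
    by simp
  have "(LINT t|lborel. exp (- (R * (s - t))\<^sup>2 / 2)) = (LINT t|lborel. exp (- t\<^sup>2 / (2 * (1 / R)\<^sup>2)))"
    using lborel_integral_real_affine[of 1 "\<lambda>t. exp (- (R * (s - t))\<^sup>2 / 2)" s] unfolding eq by simp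
  also have "complex_of_real \<dots> = complex_of_real (sqrt (2 * pi) / R)"
    using gauss_fourier[of "1 / R" 0] assms
    by (simp del: of_real_exp of_real_divide add: integral_complex_of_real)
  finally have "(LINT t|lborel. exp (- (R * (s - t))\<^sup>2 / 2)) = sqrt (2 * pi) / R"
    using of_real_eq_iff by blast
  then show "(LINT t|lborel. R * sqrt (2 * pi) * exp (- (R * (s - t))\<^sup>2 / 2)) = 2 * pi"
    using assms by simp
qed

lemma integral_gauss_real:
  assumes "R > 0"
  shows "integrable lborel (\<lambda>t. exp (- t\<^sup>2 / (2 * R\<^sup>2)))"
    and "(LINT t|lborel. exp (- t\<^sup>2 / (2 * R\<^sup>2))) = R * sqrt (2 * pi)"
proof -
  show "integrable lborel (\<lambda>t. exp (- t\<^sup>2 / (2 * R\<^sup>2)))"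
    using integrable_gauss[of "1 / (2 * R\<^sup>2)", where 'a = real] assms by simp
  have "complex_of_real (LINT t|lborel. exp (- t\<^sup>2 / (2 * R\<^sup>2))) = complex_of_real (R * sqrt (2 * pi))"
    using gauss_fourier[of R 0] assms
    by (simp del: of_real_exp of_real_mult add: integral_complex_of_real)
  then show "(LINT t|lborel. exp (- t\<^sup>2 / (2 * R\<^sup>2))) = R * sqrt (2 * pi)"
    using of_real_eq_iff by blast
qed

text \<open>The integrand is a product over the coordinates. For i different from \<open>k\<close>
  the factor is the exact transform of a Gaussian at \<xi>_i - \<eta>_i; for \<open>k\<close> only
  absolute values are used, at the price of R sqrt (2 pi). Of the decay in \<eta> just the dummy
  component is kept: in the other components the kernel itself is integrable.\<close>

lemma gauss_mult_wave_pair: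
  fixes A :: "real^'n::finite \<Rightarrow> real \<Rightarrow> complex"
  assumes A: "amplitude A" and "R > 0"
    and C: "C \<ge> 0" "c > 0" "\<And>\<xi> t. norm (A \<xi> t) \<le> C * exp (- c * (norm \<xi>)\<^sup>2)"
  shows "norm (LINT x|lborel. complex_of_real (exp (- (norm x)\<^sup>2 / (2 * R\<^sup>2))) *
       (iexp (phase k \<xi> x) * A \<xi> (x $ k)) * cnj (iexp (phase k \<eta> x) * A \<eta> (x $ k)))
     \<le> C\<^sup>2 * exp (- c * (norm \<xi>)\<^sup>2) * (R * sqrt (2 * pi)) *
        (\<Prod>i\<in>UNIV. if i = k then exp (- c * (\<eta> $ i)\<^sup>2) else R * sqrt (2 * pi) * exp (- (R * (\<xi> $ i - \<eta> $ i))\<^sup>2 / 2))"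
proof -
  note [measurable] = amplitude_measurable[OF A]
  define h where "h i t = (if i = k then complex_of_real (exp (- t\<^sup>2 / (2 * R\<^sup>2))) * (A \<xi> t * cnj (A \<eta> t))
     else iexp ((\<xi> $ i - \<eta> $ i) * t) * complex_of_real (exp (- t\<^sup>2 / (2 * R\<^sup>2))))" for i t
  have bk: "norm (h k t) \<le> exp (- t\<^sup>2 / (2 * R\<^sup>2)) * (C\<^sup>2 * exp (- c * (norm \<xi>)\<^sup>2) * exp (- c * (\<eta> $ k)\<^sup>2))" for t
  proof -
    have "(\<eta> $ k)\<^sup>2 \<le> (norm \<eta>)\<^sup>2"
      using power_mono[OF component_le_norm_cart[of \<eta> k] abs_ge_zero, of 2] by simp
    then have "exp (- c * (norm \<eta>)\<^sup>2) \<le> exp (- c * (\<eta> $ k)\<^sup>2)" using C(2) by simp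
    then have "norm (A \<eta> t) \<le> C * exp (- c * (\<eta> $ k)\<^sup>2)"
      using C(3)[of \<eta> t] mult_left_mono[OF _ C(1)] by (rule_tac order_trans) blast+
    then have "norm (A \<xi> t) * norm (A \<eta> t) \<le> C * exp (- c * (norm \<xi>)\<^sup>2) * (C * exp (- c * (\<eta> $ k)\<^sup>2))"
      using C by (intro mult_mono) auto
    then show ?thesis
      by (simp add: h_def norm_mult power2_eq_square mult_ac mult_left_mono del: of_real_exp)
  qed
  have ik: "integrable lborel (\<lambda>t. exp (- t\<^sup>2 / (2 * R\<^sup>2)) * (C\<^sup>2 * exp (- c * (norm \<xi>)\<^sup>2) * exp (- c * (\<eta> $ k)\<^sup>2)))"
    using integral_gauss_real(1)[OF \<open>R > 0\<close>] by simp
  have int: "integrable lborel (h i)" for i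
  proof (cases "i = k")
    case True
    have "h k \<in> borel_measurable lborel"
      unfolding h_def[abs_def] by simp measurable
    then have "integrable lborel (h k)"
      by (rule Bochner_Integration.integrable_bound[OF ik])
        (use order_trans[OF bk abs_ge_self] in auto)
    with True show ?thesis by simp
  next
    case False
    show ?thesis
      using integrable_gauss_1[OF \<open>R > 0\<close>]
    proof (rule Bochner_Integration.integrable_bound)
      show "h i \<in> borel_measurable lborel" using False unfolding h_def by simp
      show "AE t in lborel. norm (h i t) \<le> norm (complex_of_real (exp (- t\<^sup>2 / (2 * R\<^sup>2))))"
        using False by (simp add: h_def norm_mult)
    qed
  qed
  have "(LINT x|lborel. complex_of_real (exp (- (norm x)\<^sup>2 / (2 * R\<^sup>2))) *
       (iexp (phase k \<xi> x) * A \<xi> (x $ k)) * cnj (iexp (phase k \<eta> x) * A \<eta> (x $ k)))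
     = (LINT x|lborel. (\<Prod>i\<in>UNIV. h i ((x::real^'n) $ i)))"
  proof (intro Bochner_Integration.integral_cong refl)
    fix x :: "real^'n"
    have 1: "complex_of_real (exp (- (norm x)\<^sup>2 / (2 * R\<^sup>2))) = complex_of_real (exp (- (x $ k)\<^sup>2 / (2 * R\<^sup>2))) *
        (\<Prod>i\<in>UNIV - {k}. complex_of_real (exp (- (x $ i)\<^sup>2 / (2 * R\<^sup>2))))"
      unfolding norm_power2_vec
      by (simp add: sum_negf[symmetric] sum_divide_distrib exp_sum prod.remove[of UNIV k] del: of_real_exp sum_negf)
    have 2: "iexp (phase k \<xi> x) * cnj (iexp (phase k \<eta> x)) = (\<Prod>i\<in>UNIV - {k}. iexp ((\<xi> $ i - \<eta> $ i) * x $ i))"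
      by (simp add: phase_def exp_sum[symmetric] exp_cnj exp_add[symmetric] sum_subtractf
         sum_distrib_left[symmetric] algebra_simps)
    have 3: "(\<Prod>i\<in>UNIV. h i (x $ i)) = h k (x $ k) * (\<Prod>i\<in>UNIV - {k}. h i (x $ i))"
      by (simp add: prod.remove)
    have 4: "(\<Prod>i\<in>UNIV - {k}. h i (x $ i)) = (\<Prod>i\<in>UNIV - {k}. iexp ((\<xi> $ i - \<eta> $ i) * x $ i)) *
        (\<Prod>i\<in>UNIV - {k}. complex_of_real (exp (- (x $ i)\<^sup>2 / (2 * R\<^sup>2))))"
      unfolding prod.distrib[symmetric] by (intro prod.cong) (auto simp: h_def)
    show "complex_of_real (exp (- (norm x)\<^sup>2 / (2 * R\<^sup>2))) *
       (iexp (phase k \<xi> x) * A \<xi> (x $ k)) * cnj (iexp (phase k \<eta> x) * A \<eta> (x $ k)) = (\<Prod>i\<in>UNIV. h i (x $ i))"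
      unfolding 3 4 2[symmetric] 1 by (simp add: h_def mult_ac)
  qed
  also have "\<dots> = (\<Prod>i\<in>UNIV. integral\<^sup>L lborel (h i))"
    by (rule integral_prod_coords[OF int])
  also have "norm \<dots> = norm (integral\<^sup>L lborel (h k)) * (\<Prod>i\<in>UNIV - {k}. norm (integral\<^sup>L lborel (h i)))"
    by (simp add: prod.remove[of UNIV k] norm_mult prod_norm)
  also have "(\<Prod>i\<in>UNIV - {k}. norm (integral\<^sup>L lborel (h i))) = (\<Prod>i\<in>UNIV - {k}. R * sqrt (2 * pi) * exp (- (R * (\<xi> $ i - \<eta> $ i))\<^sup>2 / 2))"
  proof (intro prod.cong refl)
    fix i assume "i \<in> UNIV - {k}"
    then have "integral\<^sup>L lborel (h i) = complex_of_real (R * sqrt (2 * pi) * exp (- (R * (\<xi> $ i - \<eta> $ i))\<^sup>2 / 2))"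
      using gauss_fourier[OF \<open>R > 0\<close>, of "\<xi> $ i - \<eta> $ i"] by (simp add: h_def[abs_def] del: of_real_mult of_real_exp)
    also have "norm \<dots> = R * sqrt (2 * pi) * exp (- (R * (\<xi> $ i - \<eta> $ i))\<^sup>2 / 2)"
      using \<open>R > 0\<close> by (subst norm_of_real) simp
    finally show "norm (integral\<^sup>L lborel (h i)) = R * sqrt (2 * pi) * exp (- (R * (\<xi> $ i - \<eta> $ i))\<^sup>2 / 2)" .
  qed
  also have "norm (integral\<^sup>L lborel (h k)) \<le> (LINT t|lborel. exp (- t\<^sup>2 / (2 * R\<^sup>2)) * (C\<^sup>2 * exp (- c * (norm \<xi>)\<^sup>2) * exp (- c * (\<eta> $ k)\<^sup>2)))"
    by (rule norm_lebesgue_integral_le[OF ik]) (use bk in auto)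
  also have "\<dots> = R * sqrt (2 * pi) * (C\<^sup>2 * exp (- c * (norm \<xi>)\<^sup>2) * exp (- c * (\<eta> $ k)\<^sup>2))"
    using integral_gauss_real(2)[OF \<open>R > 0\<close>] by simp
  finally show ?thesis
    using \<open>R > 0\<close> by (simp add: prod.remove[of UNIV k] mult_ac mult_right_mono prod_nonneg)
qed

text \<open>A substitute for Plancherel's theorem in the variables other than \<open>x\<^sub>k\<close>: after inserting a
  Gaussian of width \<open>R\<close>, the square expands into a double integral whose kernel has
  bounded integral in one frequency variable (Schur's test).\<close>

lemma wave_L2:
  fixes A :: "real^'n::finite \<Rightarrow> real \<Rightarrow> complex"
  assumes A: "amplitude A"
  obtains K where "K \<ge> 0" "\<And>R. R \<ge> 1 \<Longrightarrow> set_integrable lborel (ball 0 R) (\<lambda>x. (norm (wave k A x))\<^sup>2)"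
    "\<And>R. R \<ge> 1 \<Longrightarrow> (LINT x:ball 0 R|lborel. (norm (wave k A x))\<^sup>2) \<le> K * R"
proof -
  obtain C c where C: "C \<ge> 0" "c > 0" "\<And>\<xi> t. norm (A \<xi> t) \<le> C * exp (- c * (norm \<xi>)\<^sup>2)"
    using amplitudeE[OF A] by blast
  obtain B where B: "B \<ge> 0" "\<And>x. norm (wave k A x) \<le> B" using wave_bounded[OF A] by blast
  note [measurable] = amplitude_measurable[OF A] borel_measurable_wave[OF A]
  define G where "G = (LINT t|lborel. exp (- c * (t::real)\<^sup>2))"
  have iG: "integrable lborel (\<lambda>t::real. exp (- c * t\<^sup>2))"
    using integrable_gauss[OF C(2), where 'a = real] by simp
  \<comment> \<open>The integral over \<eta> of the kernel apart from its constants: the dummy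
    component contributes \<open>G\<close>, every other one 2 pi.\<close>
  define P where "P = (\<Prod>i\<in>(UNIV::'n set). if i = k then G else 2 * pi)"
  define K0 where "K0 = sqrt (2 * pi) * C\<^sup>2 * P * (LINT \<xi>|lborel. exp (- c * (norm (\<xi>::real^'n))\<^sup>2))"
  have G0: "G \<ge> 0" unfolding G_def by (intro Bochner_Integration.integral_nonneg) auto
  have P0: "P \<ge> 0" unfolding P_def using G0 by (intro prod_nonneg) auto
  have K0: "K0 \<ge> 0" unfolding K0_def using P0 by (auto intro!: mult_nonneg_nonneg Bochner_Integration.integral_nonneg)
  have sq_int: "set_integrable lborel (ball 0 R) (\<lambda>x. (norm (wave k A x))\<^sup>2)" for R
    unfolding set_integrable_def
  proof (rule Bochner_Integration.integrable_bound)
    show "integrable lborel (\<lambda>x::real^'n. indicator (ball 0 R) x * B\<^sup>2)"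
      by (intro integrable_mult_left) (auto intro!: integrable_real_indicator emeasure_bounded_finite)
    show "AE x in lborel. norm (indicator (ball 0 R) x *\<^sub>R (norm (wave k A x))\<^sup>2) \<le> norm (indicator (ball 0 R) x * B\<^sup>2)"
      using B by (intro AE_I2) (auto simp: indicator_def intro!: power_mono)
    show "(\<lambda>x. indicat_real (ball 0 R) x *\<^sub>R (cmod (wave k A x))\<^sup>2) \<in> borel_measurable lborel"
      by (intro borel_measurable_scaleR borel_measurable_indicator) auto
  qed
  have main: "(LINT x:ball 0 R|lborel. (norm (wave k A x))\<^sup>2) \<le> (exp (1 / 2) * K0) * R" if "R \<ge> 1" for R
  proof -
    have R: "R > 0" using that by simp
    define w where "w x = exp (- (norm x)\<^sup>2 / (2 * R\<^sup>2))" for x :: "real^'n"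
    have wm [measurable]: "w \<in> borel_measurable borel" unfolding w_def[abs_def] by measurable
    have wi: "integrable lborel w"
      using integrable_gauss[of "1 / (2 * R\<^sup>2)", where 'a = "real^'n"] R by (simp add: w_def[abs_def])
    have w0: "w x \<ge> 0" for x by (simp add: w_def)
    let ?e = "\<lambda>\<xi> x. iexp (phase k \<xi> x) * A \<xi> (x $ k)"
    have wpsi: "integrable lborel (\<lambda>x. w x * (norm (wave k A x))\<^sup>2)"
    proof (rule Bochner_Integration.integrable_bound)
      show "integrable lborel (\<lambda>x. w x * B\<^sup>2)" using wi by simp
      show "AE x in lborel. norm (w x * (norm (wave k A x))\<^sup>2) \<le> norm (w x * B\<^sup>2)"
        using B w0 by (intro AE_I2) (auto simp: abs_mult intro!: mult_left_mono power_mono)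
    qed measurable
    have iv: "integrable lborel (\<lambda>x. complex_of_real (w x) * cnj (wave k A x))"
    proof (rule Bochner_Integration.integrable_bound)
      show "integrable lborel (\<lambda>x. w x * B)" using wi by simp
      show "AE x in lborel. norm (complex_of_real (w x) * cnj (wave k A x)) \<le> norm (w x * B)"
        using B w0 by (intro AE_I2) (auto simp: norm_mult abs_mult intro!: mult_left_mono)
    qed measurable
    define J where "J \<xi> \<eta> = C\<^sup>2 * exp (- c * (norm \<xi>)\<^sup>2) * (R * sqrt (2 * pi)) *
        (\<Prod>i\<in>UNIV. if i = k then exp (- c * (\<eta> $ i)\<^sup>2) else R * sqrt (2 * pi) * exp (- (R * (\<xi> $ i - \<eta> $ i))\<^sup>2 / 2))"
        for \<xi> \<eta> :: "real^'n"
    have J: "integrable lborel (J \<xi>)" "(LINT \<eta>|lborel. J \<xi> \<eta>) = R * (sqrt (2 * pi) * C\<^sup>2 * P * exp (- c * (norm \<xi>)\<^sup>2))" for \<xi>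
    proof -
      let ?g = "\<lambda>i t. if i = k then exp (- c * t\<^sup>2) else R * sqrt (2 * pi) * exp (- (R * (\<xi> $ i - t))\<^sup>2 / 2)"
      have gi: "integrable lborel (?g i)" for i
        using iG integral_gauss_shift(1)[OF R, of "\<xi> $ i"] by (cases "i = k") simp_all
      have gI: "integral\<^sup>L lborel (?g i) = (if i = k then G else 2 * pi)" for i
        using integral_gauss_shift(2)[OF R, of "\<xi> $ i"] by (cases "i = k") (simp_all add: G_def)
      show "integrable lborel (J \<xi>)"
        unfolding J_def[abs_def] by (intro integrable_mult_right integrable_prod_coords[OF gi])
      show "(LINT \<eta>|lborel. J \<xi> \<eta>) = R * (sqrt (2 * pi) * C\<^sup>2 * P * exp (- c * (norm \<xi>)\<^sup>2))"
        unfolding J_def integral_mult_right_zero integral_prod_coords[OF gi] gI P_def[symmetric] by simp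
    qed
    have inner: "norm (LINT x|lborel. complex_of_real (w x) * cnj (wave k A x) * ?e \<xi> x)
        \<le> R * (sqrt (2 * pi) * C\<^sup>2 * P * exp (- c * (norm \<xi>)\<^sup>2))" for \<xi>
    proof -
      have ig: "integrable lborel (\<lambda>x. complex_of_real (w x) * cnj (?e \<xi> x))"
      proof (rule Bochner_Integration.integrable_bound)
        show "integrable lborel (\<lambda>x. w x * (C * exp (- c * (norm \<xi>)\<^sup>2)))" using wi by simp
        show "AE x in lborel. norm (complex_of_real (w x) * cnj (?e \<xi> x)) \<le> norm (w x * (C * exp (- c * (norm \<xi>)\<^sup>2)))"
          using C w0 by (intro AE_I2) (auto simp: norm_mult abs_mult intro!: mult_left_mono)
      qed measurable
      have "(LINT x|lborel. complex_of_real (w x) * cnj (wave k A x) * ?e \<xi> x) =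
          (LINT x|lborel. cnj ((complex_of_real (w x) * cnj (?e \<xi> x)) * wave k A x))"
        by (intro Bochner_Integration.integral_cong) auto
      also have "\<dots> = cnj (LINT x|lborel. (complex_of_real (w x) * cnj (?e \<xi> x)) * wave k A x)"
        by (rule Bochner_Integration.integral_cnj)
      also have "norm \<dots> = norm (LINT x|lborel. (complex_of_real (w x) * cnj (?e \<xi> x)) * wave k A x)"
        by (rule complex_mod_cnj)
      also have "(LINT x|lborel. (complex_of_real (w x) * cnj (?e \<xi> x)) * wave k A x) =
          (LINT \<eta>|lborel. LINT x|lborel. (complex_of_real (w x) * cnj (?e \<xi> x)) * ?e \<eta> x)"
        by (rule integral_mult_wave[OF A ig])
      also have "norm \<dots> \<le> (LINT \<eta>|lborel. J \<xi> \<eta>)"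
      proof (rule norm_lebesgue_integral_le[OF J(1)])
        fix \<eta>
        have "(LINT x|lborel. (complex_of_real (w x) * cnj (?e \<xi> x)) * ?e \<eta> x)
           = (LINT x|lborel. cnj (complex_of_real (w x) * ?e \<xi> x * cnj (?e \<eta> x)))"
          by (intro Bochner_Integration.integral_cong) auto
        also have "norm \<dots> = norm (LINT x|lborel. complex_of_real (w x) * ?e \<xi> x * cnj (?e \<eta> x))"
          unfolding Bochner_Integration.integral_cnj by simp
        also have "\<dots> \<le> J \<xi> \<eta>"
          unfolding w_def J_def by (rule gauss_mult_wave_pair[OF A R C])
        finally show "norm (LINT x|lborel. (complex_of_real (w x) * cnj (?e \<xi> x)) * ?e \<eta> x) \<le> J \<xi> \<eta>" .
      qed
      finally show ?thesis unfolding J(2) .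
    qed
    \<comment> \<open>The square is the wave times its conjugate. One factor is expanded over \<xi>
      here; the conjugate one was expanded over \<eta> in \<open>inner\<close>.\<close>
    have "complex_of_real (LINT x|lborel. w x * (norm (wave k A x))\<^sup>2) =
        (LINT x|lborel. (complex_of_real (w x) * cnj (wave k A x)) * wave k A x)"
      unfolding integral_complex_of_real[symmetric]
      by (intro Bochner_Integration.integral_cong refl) (simp add: complex_norm_square mult_ac del: of_real_power)
    also have "\<dots> = (LINT \<xi>|lborel. LINT x|lborel. (complex_of_real (w x) * cnj (wave k A x)) * ?e \<xi> x)"
      by (rule integral_mult_wave[OF A iv])
    also have "norm \<dots> \<le> (LINT \<xi>|lborel. R * (sqrt (2 * pi) * C\<^sup>2 * P * exp (- c * (norm (\<xi>::real^'n))\<^sup>2)))"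
      by (rule norm_lebesgue_integral_le[OF _ inner]) (intro integrable_mult_right integrable_gauss C)
    also have "\<dots> = R * K0" by (simp add: K0_def)
    finally have w_le: "(LINT x|lborel. w x * (norm (wave k A x))\<^sup>2) \<le> R * K0" by simp
    have "(LINT x:ball 0 R|lborel. (norm (wave k A x))\<^sup>2) \<le> (LINT x|lborel. exp (1 / 2) * (w x * (norm (wave k A x))\<^sup>2))"
      unfolding set_lebesgue_integral_def
    proof (rule integral_mono)
      show "integrable lborel (\<lambda>x. indicat_real (ball 0 R) x *\<^sub>R (norm (wave k A x))\<^sup>2)"
        using sq_int[of R] unfolding set_integrable_def .
      show "integrable lborel (\<lambda>x. exp (1 / 2) * (w x * (norm (wave k A x))\<^sup>2))" using wpsi by simp
      fix x :: "real^'n"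
      show "indicat_real (ball 0 R) x *\<^sub>R (norm (wave k A x))\<^sup>2 \<le> exp (1 / 2) * (w x * (norm (wave k A x))\<^sup>2)"
      proof (cases "norm x < R")
        case True
        then have "(norm x)\<^sup>2 \<le> R\<^sup>2" by (intro power_mono) auto
        \<comment> \<open>On B(0, R) the Gaussian weight is at least exp (-1/2), the origin of the
          constant exp (1/2).\<close>
        then have "1 \<le> exp (1 / 2) * w x"
          using R by (simp add: w_def exp_add[symmetric] field_simps)
        then have "1 * (norm (wave k A x))\<^sup>2 \<le> (exp (1 / 2) * w x) * (norm (wave k A x))\<^sup>2"
          by (intro mult_right_mono) auto
        with True show ?thesis by (simp add: mult.assoc)
      qed (simp add: w0)
    qed
    also have "\<dots> \<le> exp (1 / 2) * (R * K0)"
      using w_le by simp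
    finally show ?thesis by (simp add: mult_ac)
  qed
  show ?thesis
    by (rule that[of "exp (1 / 2) * K0"]) (use K0 sq_int main in auto)
qed

subsection \<open>Cutoffs\<close>

definition qform :: "'n::finite \<Rightarrow> real^'n \<Rightarrow> real" where
  "qform k \<xi> = (\<Sum>i\<in>UNIV - {k}. (\<xi> $ i)\<^sup>2)"

text \<open>Each coordinate has its own profile: differentiating a product cutoff replaces one
  profile by its derivative, and the commutator terms are again of this form.\<close>

definition cutoff :: "('n::finite \<Rightarrow> real \<Rightarrow> complex) \<Rightarrow> real \<Rightarrow> real^'n \<Rightarrow> complex" where
  "cutoff b N x = (\<Prod>j\<in>UNIV. b j (x $ j / N))"

definition cutoff_profile :: "(real \<Rightarrow> complex) \<Rightarrow> bool" where
  "cutoff_profile b \<longleftrightarrow> continuous_on UNIV b \<and> (\<forall>t. \<bar>t\<bar> \<ge> 1 \<longrightarrow> b t = 0)"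

lemma cutoff_profile_bump:
  "cutoff_profile bump" "cutoff_profile (vd bump)" "cutoff_profile (vd (vd bump))"
  unfolding cutoff_profile_def
  by (auto intro!: smooth_continuous smooth_vd(1) smooth_bump bump_outside vd_eq_0_outside[where r = 1])

lemma cutoff_continuous:
  assumes "\<And>j. cutoff_profile (b j)" "N \<noteq> 0"
  shows "continuous_on S (cutoff b N)"
proof -
  have "continuous_on S (\<lambda>x. b j (x $ j / N))" for j
    by (rule continuous_on_compose2[of UNIV "b j"])
       (use assms in \<open>auto simp: cutoff_profile_def intro!: continuous_intros\<close>)
  then show ?thesis unfolding cutoff_def[abs_def] by (intro continuous_on_prod) auto
qed

lemma cutoff_bounded:
  fixes b :: "'n::finite \<Rightarrow> real \<Rightarrow> complex"
  assumes "\<And>j. cutoff_profile (b j)"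
  shows "\<exists>M\<ge>0. \<forall>N x. norm (cutoff b N x) \<le> M"
proof -
  have "\<exists>K. \<forall>t. norm (b j t) \<le> K" for j
    using bounded_of_compact_support[of "b j" 1] assms[of j] unfolding cutoff_profile_def by metis
  then obtain K where K: "\<And>j t. norm (b j t) \<le> K j" by metis
  have "K j \<ge> 0" for j using order_trans[OF norm_ge_zero K[of j 0]] .
  moreover have "norm (cutoff b N x) \<le> (\<Prod>j\<in>UNIV. K j)" for N x
    unfolding cutoff_def prod_norm[symmetric] by (intro prod_mono) (auto simp: K)
  ultimately show ?thesis by (intro exI[of _ "\<Prod>j\<in>UNIV. K j"]) (simp add: prod_nonneg)
qed

lemma cutoff_outside:
  fixes b :: "'n::finite \<Rightarrow> real \<Rightarrow> complex"
  assumes "\<And>j. cutoff_profile (b j)" "N > 0" "norm x \<ge> real CARD('n) * N"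
  shows "cutoff b N x = 0"
proof -
  have "\<exists>l. \<bar>x $ l\<bar> \<ge> N"
  proof (rule ccontr)
    assume "\<not> (\<exists>l. \<bar>x $ l\<bar> \<ge> N)"
    then have "\<bar>x $ l\<bar> < N" for l by (auto simp: not_le)
    then have "(\<Sum>l\<in>UNIV. \<bar>x $ l\<bar>) < (\<Sum>l\<in>(UNIV::'n set). N)" by (intro sum_strict_mono) auto
    with norm_le_l1_cart[of x] assms(3) show False by simp
  qed
  then obtain l where "\<bar>x $ l\<bar> \<ge> N" ..
  then have "\<bar>x $ l / N\<bar> \<ge> 1" using assms(2) by (simp add: abs_divide)
  then have "b l (x $ l / N) = 0" using assms(1)[of l] by (simp add: cutoff_profile_def)
  then show ?thesis unfolding cutoff_def by (intro prod_zero) auto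
qed

lemma cutoff_tendsto:
  assumes "\<And>j. cutoff_profile (b j)"
  shows "(\<lambda>N. cutoff b (real (Suc N)) x) \<longlonglongrightarrow> (\<Prod>j\<in>UNIV. b j 0)"
  unfolding cutoff_def
proof (intro tendsto_prod)
  fix j
  have "(\<lambda>N. x $ j * (1 / real (Suc N))) \<longlonglongrightarrow> x $ j * 0"
    by (intro tendsto_intros LIMSEQ_Suc[OF lim_1_over_n])
  then have *: "(\<lambda>N. x $ j / real (Suc N)) \<longlonglongrightarrow> 0" by simp
  have "isCont (b j) 0"
    using assms[of j] by (simp add: cutoff_profile_def continuous_on_eq_continuous_at)
  from isCont_tendsto_compose[OF this *] show "(\<lambda>N. b j (x $ j / real (Suc N))) \<longlonglongrightarrow> b j 0" .
qed

text \<open>The problem after normalisation: Borel representatives of u and f, with f zero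
  everywhere below the hyperplane, and the weighted square integrability of f turned into absolute
  integrability against every exponential, the form in which its Fourier integral at complex
  frequencies converges.\<close>

locale helmholtz =
  fixes u f :: "real^'n::finite \<Rightarrow> complex" and lam :: real and k :: 'n
  assumes lam_pos: "lam > 0"
    and u_borel [measurable]: "u \<in> borel_measurable borel"
    and f_borel [measurable]: "f \<in> borel_measurable borel"
    and u_square: "\<And>R. set_integrable lborel (ball 0 R) (\<lambda>x. (norm (u x))\<^sup>2)"
    and u_lim: "((\<lambda>R. (1 / R) * (LINT x:ball 0 R|lborel. (norm (u x))\<^sup>2)) \<longlongrightarrow> 0) at_top"
    and f_int: "\<And>\<gamma>. integrable lborel (\<lambda>x. norm (f x) * exp (\<gamma> * norm x))"
    and f_lower: "\<And>x. x $ k < 0 \<Longrightarrow> f x = 0"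
    and weak: "\<And>\<phi>. test_fun \<phi> \<Longrightarrow>
      (LINT x | lborel. u x * complex_of_real
          (- (\<Sum>i\<in>UNIV. iter_pderiv [i, i] \<phi> x) - lam * \<phi> x))
        = (LINT x | lborel. f x * complex_of_real (\<phi> x))"
begin

lemma u_loc: "set_integrable lborel (ball 0 R) u"
  by (rule set_integrable_ball_of_norm_square[OF u_borel u_square])

lemma f_integrable: "integrable lborel f"
  using f_int[of 0] by (simp add: integrable_norm_iff)

lemma f_loc: "set_integrable lborel (ball 0 R) f"
  unfolding set_integrable_def by (rule integrable_mult_indicator[OF _ f_integrable]) simp

lemma u_cutoff_integrable:
  assumes "\<And>j. cutoff_profile (b j)" "N > 0"
  shows "integrable lborel (\<lambda>x. u x * cutoff b N x)"
  by (rule integrable_mult_continuous_compact_support[OF u_borel u_loc cutoff_continuous cutoff_outside])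
     (use assms in auto)

text \<open>The sequence \<open>e\<close> is the mean square on the balls of radius C (n+1) plus
  1/(n+1). The added term makes it strictly positive, so that its root can be divided by when it
  serves as a weight in Young's inequality.\<close>

lemma u_mean_square:
  assumes C: "C \<ge> 1"
  obtains e where "\<And>n. e n > 0" "(\<lambda>n. sqrt (e n)) \<longlonglongrightarrow> 0"
    "\<And>n. (LINT x:ball 0 (C * real (Suc n))|lborel. (norm (u x))\<^sup>2) \<le> C * real (Suc n) * e n"
proof -
  let ?U = "\<lambda>R. LINT x:ball 0 R|lborel. (norm (u x))\<^sup>2"
  define R where "R n = C * real (Suc n)" for n
  have R: "R n > 0" for n using C by (simp add: R_def)
  define e where "e n = (1 / R n) * ?U (R n) + 1 / real (Suc n)" for n
  have U: "?U R \<ge> 0" for R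
    unfolding set_lebesgue_integral_def by (intro Bochner_Integration.integral_nonneg) auto
  have e: "e n > 0" for n
    using U[of "R n"] R[of n] unfolding e_def by (intro add_nonneg_pos mult_nonneg_nonneg) auto
  have "filterlim R at_top sequentially"
    unfolding R_def using C
    by (intro filterlim_tendsto_pos_mult_at_top[OF tendsto_const]
        filterlim_compose[OF filterlim_real_sequentially filterlim_Suc]) auto
  from filterlim_compose[OF u_lim this]
  have "e \<longlonglongrightarrow> 0 + 0" unfolding e_def
    by (intro tendsto_add LIMSEQ_Suc[OF lim_1_over_n])
  then have e_lim: "(\<lambda>n. sqrt (e n)) \<longlonglongrightarrow> 0" using tendsto_real_sqrt by fastforce
  have "?U (R n) \<le> R n * e n" for n using R[of n] by (simp add: e_def distrib_left)
  then show ?thesis using that[OF e e_lim] by (simp add: R_def)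
qed

text \<open>Young's inequality with weight s = sqrt (e N) in place of Cauchy-Schwarz: the part with
  |u|^2 / s is at most R e / s = R s and the part with s times the squared wave at most K R s. After
  division by N this is a constant times s, which tends to 0.\<close>

lemma boundary_term_tendsto_0:
  assumes b: "\<And>j. cutoff_profile (b j)" and A: "amplitude A"
  shows "(\<lambda>N. (LINT x|lborel. u x * cutoff b (real (Suc N)) x * wave k A x) / real (Suc N)) \<longlonglongrightarrow> 0"
proof -
  from cutoff_bounded[of b, OF b] obtain M where M: "M \<ge> 0" "\<And>N x. norm (cutoff b N x) \<le> M" by auto
  obtain K where K: "K \<ge> 0"
    "\<And>R. R \<ge> 1 \<Longrightarrow> set_integrable lborel (ball 0 R) (\<lambda>x. (norm (wave k A x))\<^sup>2)"
    "\<And>R. R \<ge> 1 \<Longrightarrow> (LINT x:ball 0 R|lborel. (norm (wave k A x))\<^sup>2) \<le> K * R"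
    using wave_L2[OF A, where k = k] by blast
  \<comment> \<open>The cutoff at scale N lives in a cube contained in the ball of radius m
    N.\<close>
  define m where "m = real CARD('n)"
  have m1: "m \<ge> 1" unfolding m_def by (simp add: Suc_leI)
  define R where "R N = m * real (Suc N)" for N
  have R1: "R N \<ge> 1" for N using mult_mono[OF m1, of 1 "real (Suc N)"] m1 by (simp add: R_def)
  obtain e where e0: "\<And>N. e N > 0" and e_lim: "(\<lambda>N. sqrt (e N)) \<longlonglongrightarrow> 0"
    and Ue: "\<And>N. (LINT x:ball 0 (R N)|lborel. (norm (u x))\<^sup>2) \<le> R N * e N"
    using u_mean_square[OF m1] unfolding R_def by blast
  have bd: "norm ((LINT x|lborel. u x * cutoff b (real (Suc N)) x * wave k A x) / real (Suc N))
      \<le> M * m * (1 + K) * sqrt (e N)" for N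
  proof -
    define s where "s = sqrt (e N)"
    have s0: "s > 0" and s2: "s * s = e N" using e0[of N] by (auto simp: s_def)
    let ?G = "\<lambda>x. M * ((1 / s) * (indicator (ball 0 (R N)) x *\<^sub>R (norm (u x))\<^sup>2) +
         s * (indicator (ball 0 (R N)) x *\<^sub>R (norm (wave k A x))\<^sup>2))"
    have i1: "integrable lborel (\<lambda>x. indicator (ball 0 (R N)) x *\<^sub>R (norm (u x))\<^sup>2)"
      using u_square[of "R N"] unfolding set_integrable_def .
    have i2: "integrable lborel (\<lambda>x. indicator (ball 0 (R N)) x *\<^sub>R (norm (wave k A x))\<^sup>2)"
      using K(2)[OF R1[of N]] unfolding set_integrable_def .
    have "norm (LINT x|lborel. u x * cutoff b (real (Suc N)) x * wave k A x) \<le> (LINT x|lborel. ?G x)"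
    proof (rule norm_lebesgue_integral_le)
      show "integrable lborel ?G" using i1 i2 by simp
      fix x :: "real^'n"
      show "norm (u x * cutoff b (real (Suc N)) x * wave k A x) \<le> ?G x"
      proof (cases "norm x < R N")
        case True
        let ?p = "norm (u x)" and ?q = "norm (wave k A x)"
        have "2 * (?p * ?q) \<le> (1 / s) * ?p\<^sup>2 + s * ?q\<^sup>2"
        proof -
          have "0 \<le> (1 / s) * (?p - s * ?q)\<^sup>2" using s0 by simp
          also have "\<dots> = (1 / s) * ?p\<^sup>2 + s * ?q\<^sup>2 - 2 * (?p * ?q)"
            using s0 by (simp add: power2_eq_square field_simps)
          finally show ?thesis by simp
        qed
        moreover have "?p * ?q \<ge> 0" by simp
        ultimately have "?p * ?q \<le> (1 / s) * ?p\<^sup>2 + s * ?q\<^sup>2" by linarith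
        then have "M * (?p * ?q) \<le> M * ((1 / s) * ?p\<^sup>2 + s * ?q\<^sup>2)" using M(1) by (rule mult_left_mono)
        moreover have "norm (u x * cutoff b (real (Suc N)) x * wave k A x) \<le> M * (?p * ?q)"
          using mult_right_mono[OF M(2)[of "real (Suc N)" x], of "?p * ?q"] by (simp add: norm_mult mult_ac)
        ultimately show ?thesis using True by simp
      next
        case False
        then have "cutoff b (real (Suc N)) x = 0"
          using cutoff_outside[of b "real (Suc N)" x, OF b] by (simp add: R_def m_def)
        with False show ?thesis by simp
      qed
    qed
    also have "(LINT x|lborel. ?G x) = M * ((1 / s) * (LINT x:ball 0 (R N)|lborel. (norm (u x))\<^sup>2) +
         s * (LINT x:ball 0 (R N)|lborel. (norm (wave k A x))\<^sup>2))"
      using i1 i2 unfolding set_lebesgue_integral_def by simp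
    also have "\<dots> \<le> M * ((1 / s) * (R N * e N) + s * (K * R N))"
      by (intro mult_left_mono add_mono K(3) R1 M Ue) (use s0 in auto)
    also have "\<dots> = M * (1 + K) * R N * s"
      unfolding s2[symmetric] using s0 by (simp add: field_simps)
    also have "\<dots> = (M * m * (1 + K) * s) * real (Suc N)" by (simp add: R_def)
    finally show ?thesis by (simp add: s_def norm_divide pos_divide_le_eq del: of_nat_Suc)
  qed
  have "(\<lambda>N. M * m * (1 + K) * sqrt (e N)) \<longlonglongrightarrow> M * m * (1 + K) * 0"
    by (intro tendsto_intros e_lim)
  then show ?thesis
    by (intro Lim_null_comparison[OF always_eventually[OF allI[OF bd]]]) simp
qed

end

subsection \<open>Duality with plane waves\<close>

lemma vd_bump_scaled:
  assumes "N > 0"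
  shows "smooth (\<lambda>t. bump (t / N))"
    and "vd (\<lambda>t. bump (t / N)) = (\<lambda>t. vd bump (t / N) / N)"
    and "vd (vd (\<lambda>t. bump (t / N))) = (\<lambda>t. vd (vd bump) (t / N) / N\<^sup>2)"
proof -
  have eq: "(\<lambda>t. bump (t / N)) = (\<lambda>t. bump (1 / N * t + 0))" by simp
  have s2: "smooth (\<lambda>t. vd bump (1 / N * t + 0))"
    by (intro smooth_affine smooth_vd(1) smooth_bump)
  show "smooth (\<lambda>t. bump (t / N))"
    unfolding eq by (intro smooth_affine smooth_bump)
  show v1: "vd (\<lambda>t. bump (t / N)) = (\<lambda>t. vd bump (t / N) / N)"
    unfolding eq vd_affine[OF smooth_bump] by (simp add: fun_eq_iff)
  have "(\<lambda>t. vd bump (t / N) / N) = (\<lambda>t. complex_of_real (1 / N) * vd bump (1 / N * t + 0))"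
    by (simp add: fun_eq_iff)
  then have "vd (vd (\<lambda>t. bump (t / N))) = vd (\<lambda>t. complex_of_real (1 / N) * vd bump (1 / N * t + 0))"
    unfolding v1 by simp
  also have "\<dots> = (\<lambda>t. complex_of_real (1 / N) * (complex_of_real (1 / N) * vd (vd bump) (1 / N * t + 0)))"
    unfolding vd_mult[OF smooth_const s2] vd_affine[OF smooth_vd(1)[OF smooth_bump]]
    using vd_eqI[of "\<lambda>_. complex_of_real (1 / N)" "\<lambda>_. 0"] by (simp add: fun_eq_iff)
  also have "\<dots> = (\<lambda>t. vd (vd bump) (t / N) / N\<^sup>2)"
    by (simp add: fun_eq_iff power2_eq_square)
  finally show "vd (vd (\<lambda>t. bump (t / N))) = (\<lambda>t. vd (vd bump) (t / N) / N\<^sup>2)" .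
qed

lemma vd_vd_mult:
  assumes "smooth f" "smooth g"
  shows "vd (vd (\<lambda>t. f t * g t)) = (\<lambda>t. f t * vd (vd g) t + 2 * vd f t * vd g t + vd (vd f) t * g t)"
proof -
  have "smooth (\<lambda>t. f t * vd g t)" "smooth (\<lambda>t. vd f t * g t)"
    using assms by (auto intro!: smooth_mult smooth_vd(1))
  then have "vd (\<lambda>t. f t * vd g t + vd f t * g t) =
      (\<lambda>t. (f t * vd (vd g) t + vd f t * vd g t) + (vd f t * vd g t + vd (vd f) t * g t))"
    using assms by (simp add: vd_add vd_mult smooth_vd(1))
  then show ?thesis unfolding vd_mult[OF assms] by (simp add: fun_eq_iff)
qed

abbreviation cutoff_at :: "(real \<Rightarrow> complex) \<Rightarrow> 'n::finite \<Rightarrow> real \<Rightarrow> real^'n \<Rightarrow> complex" where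
  "cutoff_at b i \<equiv> cutoff (\<lambda>j. if j = i then b else bump)"

text \<open>The Leibniz rule, sorted by powers of 1/N. Where no derivative falls on the cutoff, the
  tangential factors contribute -|\<xi>'|^2 and the equation for H contributes |\<xi>'|^2 -
  \<lambda>; with the added \<lambda> they cancel and only h survives.\<close>

lemma laplace_prod_cutoff_wave:
  fixes \<xi> x :: "real^'n::finite" and k :: 'n and N lam :: real and H H1 h :: "real \<Rightarrow> complex"
    and g :: "'n \<Rightarrow> real \<Rightarrow> complex"
  assumes H: "\<And>t. (H has_vector_derivative H1 t) (at t)"
    "\<And>t. (H1 has_vector_derivative complex_of_real (qform k \<xi> - lam) * H t + h t) (at t)" "smooth h"
    and N: "N > 0"
    and g_def: "g = (\<lambda>j t. bump (t / N) * (if j = k then H t else exp (\<i> * complex_of_real (\<xi> $ j) * complex_of_real t)))"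
  shows "smooth (g j)"
    and "(\<Prod>j\<in>UNIV. g j (x $ j)) = cutoff (\<lambda>_. bump) N x * (iexp (phase k \<xi> x) * H (x $ k))"
    and "laplace_prod g x + lam * (\<Prod>j\<in>UNIV. g j (x $ j)) =
       (\<Sum>i\<in>UNIV. cutoff_at (vd (vd bump)) i N x / N\<^sup>2 * (iexp (phase k \<xi> x) * H (x $ k)))
     + (\<Sum>i\<in>UNIV - {k}. cutoff_at (vd bump) i N x / N * (iexp (phase k \<xi> x) * (2 * \<i> * (\<xi> $ i) * H (x $ k))))
     + cutoff_at (vd bump) k N x / N * (iexp (phase k \<xi> x) * (2 * H1 (x $ k)))
     + cutoff (\<lambda>_. bump) N x * (iexp (phase k \<xi> x) * h (x $ k))"
proof -
  define G where "G j = (if j = k then H else (\<lambda>t. exp (\<i> * complex_of_real (\<xi> $ j) * complex_of_real t)))" for j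
  have g: "g j = (\<lambda>t. bump (t / N) * G j t)" for j by (auto simp: g_def G_def)
  have smooth_H: "smooth H" by (rule smooth_of_second_derivative[OF H])
  have smooth_G: "smooth (G j)" for j by (simp add: G_def smooth_H smooth_exp)
  show "smooth (g j)" for j
    unfolding g by (intro smooth_mult vd_bump_scaled(1) N smooth_G)
  let ?B = "\<lambda>i. \<Prod>j\<in>UNIV - {i}. bump (x $ j / N)"
  have e: "(\<Prod>j\<in>UNIV - {k}. G j (x $ j)) = iexp (phase k \<xi> x)"
    by (simp add: G_def phase_def exp_sum sum_distrib_left mult.assoc)
  then have GP: "(\<Prod>j\<in>UNIV. G j (x $ j)) = iexp (phase k \<xi> x) * H (x $ k)"
    by (simp add: prod.remove[of UNIV k] G_def)
  show P: "(\<Prod>j\<in>UNIV. g j (x $ j)) = cutoff (\<lambda>_. bump) N x * (iexp (phase k \<xi> x) * H (x $ k))"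
    unfolding g prod.distrib GP cutoff_def ..
  have cut: "cutoff_at b i N x = b (x $ i / N) * ?B i" for b i
    unfolding cutoff_def by (subst prod.remove[of UNIV i]) (auto intro!: prod.cong arg_cong2[where f = times])
  have cut0: "cutoff (\<lambda>_. bump) N x = bump (x $ i / N) * ?B i" for i
    unfolding cutoff_def by (subst prod.remove[of UNIV i]) auto
  have vdG: "vd (G i) = (\<lambda>t. \<i> * (\<xi> $ i) * G i t)" "vd (vd (G i)) = (\<lambda>t. - complex_of_real ((\<xi> $ i)\<^sup>2) * G i t)" if "i \<noteq> k" for i
  proof -
    show v: "vd (G i) = (\<lambda>t. \<i> * (\<xi> $ i) * G i t)" using that by (simp add: G_def vd_exp)
    have "vd (\<lambda>t. \<i> * (\<xi> $ i) * G i t) = (\<lambda>t. \<i> * (\<xi> $ i) * vd (G i) t)"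
      by (rule vd_eqI) (intro has_vector_derivative_mult_right smooth_vd(2) smooth_G)
    then show "vd (vd (G i)) = (\<lambda>t. - complex_of_real ((\<xi> $ i)\<^sup>2) * G i t)"
    proof -
      have "\<i> * a * (\<i> * a * z) = - (a * a) * z" for a z :: complex
        by (simp add: complex_eq_iff algebra_simps)
      then show "vd (\<lambda>t. \<i> * (\<xi> $ i) * G i t) = (\<lambda>t. \<i> * (\<xi> $ i) * vd (G i) t) \<Longrightarrow>
          vd (vd (G i)) = (\<lambda>t. - complex_of_real ((\<xi> $ i)\<^sup>2) * G i t)"
        by (simp add: v power2_eq_square)
    qed
  qed
  have vdH: "vd (G k) = H1" "vd (vd (G k)) = (\<lambda>t. complex_of_real (qform k \<xi> - lam) * H t + h t)"
  proof -
    show "vd (G k) = H1" using vd_eqI[OF H(1)] by (simp add: G_def)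
    then show "vd (vd (G k)) = (\<lambda>t. complex_of_real (qform k \<xi> - lam) * H t + h t)"
      using vd_eqI[OF H(2)] by simp
  qed
  define E where "E = iexp (phase k \<xi> x)"
  define X where "X = cutoff (\<lambda>_. bump) N x"
  define C2 where "C2 i = cutoff_at (vd (vd bump)) i N x / N\<^sup>2" for i
  define C1 where "C1 i = cutoff_at (vd bump) i N x / N" for i
  have tm: "vd (vd (g i)) (x $ i) * (\<Prod>j\<in>UNIV - {i}. g j (x $ j)) =
      (C2 i * G i (x $ i) + 2 * C1 i * vd (G i) (x $ i) + X * vd (vd (G i)) (x $ i)) * (\<Prod>j\<in>UNIV - {i}. G j (x $ j))" for i
    unfolding g vd_vd_mult[OF vd_bump_scaled(1)[OF N] smooth_G] vd_bump_scaled(3)[OF N]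
    unfolding vd_bump_scaled(2)[OF N] prod.distrib
      C1_def C2_def X_def cut cut0[of i]
    by (simp add: algebra_simps)
  have GP': "G i (x $ i) * (\<Prod>j\<in>UNIV - {i}. G j (x $ j)) = E * H (x $ k)" for i
    unfolding E_def GP[symmetric] by (simp add: prod.remove[of UNIV i])
  have ti: "vd (vd (g i)) (x $ i) * (\<Prod>j\<in>UNIV - {i}. g j (x $ j)) =
      C2 i * (E * H (x $ k)) + C1 i * (E * (2 * \<i> * (\<xi> $ i) * H (x $ k))) - X * complex_of_real ((\<xi> $ i)\<^sup>2) * (E * H (x $ k))" if "i \<noteq> k" for i
  proof -
    have "vd (vd (g i)) (x $ i) * (\<Prod>j\<in>UNIV - {i}. g j (x $ j)) =
      (C2 i + 2 * C1 i * (\<i> * (\<xi> $ i)) - X * complex_of_real ((\<xi> $ i)\<^sup>2)) * (G i (x $ i) * (\<Prod>j\<in>UNIV - {i}. G j (x $ j)))"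
      unfolding tm vdG(2)[OF that] unfolding vdG(1)[OF that] by (simp add: algebra_simps)
    then show ?thesis unfolding GP' by (simp add: algebra_simps)
  qed
  have tk: "vd (vd (g k)) (x $ k) * (\<Prod>j\<in>UNIV - {k}. g j (x $ j)) =
      C2 k * (E * H (x $ k)) + C1 k * (E * (2 * H1 (x $ k))) +
      X * complex_of_real (qform k \<xi> - lam) * (E * H (x $ k)) + X * (E * h (x $ k))"
    unfolding tm vdH(2) unfolding vdH(1) e E_def[symmetric] by (simp add: G_def algebra_simps)
  have "laplace_prod g x = vd (vd (g k)) (x $ k) * (\<Prod>j\<in>UNIV - {k}. g j (x $ j)) +
      (\<Sum>i\<in>UNIV - {k}. vd (vd (g i)) (x $ i) * (\<Prod>j\<in>UNIV - {i}. g j (x $ j)))"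
    unfolding laplace_prod_def by (simp add: sum.remove[of UNIV k])
  also have "(\<Sum>i\<in>UNIV - {k}. vd (vd (g i)) (x $ i) * (\<Prod>j\<in>UNIV - {i}. g j (x $ j))) =
     (\<Sum>i\<in>UNIV - {k}. C2 i * (E * H (x $ k)) + C1 i * (E * (2 * \<i> * (\<xi> $ i) * H (x $ k))) - X * complex_of_real ((\<xi> $ i)\<^sup>2) * (E * H (x $ k)))"
    by (intro sum.cong refl ti) auto
  also have "\<dots> = (\<Sum>i\<in>UNIV - {k}. C2 i * (E * H (x $ k))) + (\<Sum>i\<in>UNIV - {k}. C1 i * (E * (2 * \<i> * (\<xi> $ i) * H (x $ k))))
     - X * complex_of_real (qform k \<xi>) * (E * H (x $ k))"
    unfolding qform_def of_real_sum sum_distrib_left sum_distrib_right sum_subtractf sum.distrib ..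
  finally have L: "laplace_prod g x = (C2 k * (E * H (x $ k)) + (\<Sum>i\<in>UNIV - {k}. C2 i * (E * H (x $ k)))) +
      (\<Sum>i\<in>UNIV - {k}. C1 i * (E * (2 * \<i> * (\<xi> $ i) * H (x $ k)))) +
      C1 k * (E * (2 * H1 (x $ k))) + X * (E * h (x $ k)) - lam * (X * (E * H (x $ k)))"
    unfolding tk by (simp add: algebra_simps)
  have "C2 k * (E * H (x $ k)) + (\<Sum>i\<in>UNIV - {k}. C2 i * (E * H (x $ k))) = (\<Sum>i\<in>UNIV. C2 i * (E * H (x $ k)))"
    by (simp add: sum.remove[of UNIV k])
  with L P show "laplace_prod g x + lam * (\<Prod>j\<in>UNIV. g j (x $ j)) =
       (\<Sum>i\<in>UNIV. cutoff_at (vd (vd bump)) i N x / N\<^sup>2 * (iexp (phase k \<xi> x) * H (x $ k)))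
     + (\<Sum>i\<in>UNIV - {k}. cutoff_at (vd bump) i N x / N * (iexp (phase k \<xi> x) * (2 * \<i> * (\<xi> $ i) * H (x $ k))))
     + cutoff_at (vd bump) k N x / N * (iexp (phase k \<xi> x) * (2 * H1 (x $ k)))
     + cutoff (\<lambda>_. bump) N x * (iexp (phase k \<xi> x) * h (x $ k))"
    unfolding E_def[symmetric] X_def[symmetric] C1_def[symmetric] C2_def[symmetric] by simp
qed

lemma amplitude_mult_const: "amplitude A \<Longrightarrow> amplitude (\<lambda>\<xi> t. c * A \<xi> t)"
proof -
  assume A: "amplitude A"
  obtain C d where C: "C \<ge> 0" "d > 0" "\<And>\<xi> t. norm (A \<xi> t) \<le> C * exp (- d * (norm \<xi>)\<^sup>2)"
    using amplitudeE[OF A] by blast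
  note [measurable] = amplitude_measurable[OF A]
  have "norm (c * A \<xi> t) \<le> (norm c * C) * exp (- d * (norm \<xi>)\<^sup>2)" for \<xi> t
    using mult_left_mono[OF C(3)[of \<xi> t] norm_ge_zero[of c]] by (simp add: norm_mult mult.assoc)
  moreover have "(\<lambda>(\<xi>, t). c * A \<xi> t) \<in> borel_measurable (borel \<Otimes>\<^sub>M borel)" by measurable
  ultimately show ?thesis unfolding amplitude_def using C(2) by blast
qed

context helmholtz
begin

text \<open>A superposition is not of product form, so the equation is tested at each fixed \<xi>
  and the resulting scalar identity is then integrated over \<xi>. With the cutoff in place u is
  integrable, and \<open>integral_mult_wave\<close> turns each term into an integral against a
  wave.\<close>

lemma wave_identity:
  fixes A A1 B :: "real^'n \<Rightarrow> real \<Rightarrow> complex" and N :: real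
  assumes ode: "\<And>\<xi> t. (A \<xi> has_vector_derivative A1 \<xi> t) (at t)"
    "\<And>\<xi> t. (A1 \<xi> has_vector_derivative complex_of_real (qform k \<xi> - lam) * A \<xi> t + B \<xi> t) (at t)"
    "\<And>\<xi>. smooth (B \<xi>)"
    and amp: "amplitude A" "amplitude A1" "amplitude B" "\<And>i. amplitude (\<lambda>\<xi> t. complex_of_real (\<xi> $ i) * A \<xi> t)"
    and N: "N > 0"
  shows "(\<Sum>i\<in>UNIV. (LINT x|lborel. u x * cutoff_at (vd (vd bump)) i N x * wave k A x) / N\<^sup>2)
    + (\<Sum>i\<in>UNIV - {k}. (LINT x|lborel. u x * cutoff_at (vd bump) i N x * wave k (\<lambda>\<xi> t. 2 * \<i> * (complex_of_real (\<xi> $ i) * A \<xi> t)) x) / N)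
    + (LINT x|lborel. u x * cutoff_at (vd bump) k N x * wave k (\<lambda>\<xi> t. 2 * A1 \<xi> t) x) / N
    + (LINT x|lborel. u x * cutoff (\<lambda>_. bump) N x * wave k B x)
    = - (LINT x|lborel. f x * cutoff (\<lambda>_. bump) N x * wave k A x)"
proof -
  let ?e = "\<lambda>\<xi> x. iexp (phase k \<xi> x)"
  let ?c2 = "\<lambda>i. cutoff_at (vd (vd bump)) i N"
  let ?c1 = "\<lambda>i. cutoff_at (vd bump) i N"
  let ?c0 = "cutoff (\<lambda>_. bump) N"
  let ?Ai = "\<lambda>i \<xi> t. 2 * \<i> * (complex_of_real (\<xi> $ i) * A \<xi> t)"
  let ?A1 = "\<lambda>\<xi> t. 2 * A1 \<xi> t"
  have ui: "integrable lborel (\<lambda>x. u x * ?c2 i x)" "integrable lborel (\<lambda>x. u x * ?c1 i x)"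
    "integrable lborel (\<lambda>x. u x * ?c0 x)" for i
    by (intro u_cutoff_integrable N; simp add: cutoff_profile_bump)+
  have fi: "integrable lborel (\<lambda>x. f x * ?c0 x)"
    by (rule integrable_mult_continuous_compact_support[OF f_borel f_loc cutoff_continuous cutoff_outside])
       (use N cutoff_profile_bump in auto)
  have amp': "amplitude (?Ai i)" "amplitude ?A1" for i
    by (intro amplitude_mult_const amp)+
  note I = integral_mult_wave[where k = k] integrable_mult_wave'[where k = k] integrable_mult_wave_integrand[where k = k]
  have pt: "(\<Sum>i\<in>UNIV. (LINT x|lborel. u x * ?c2 i x * (?e \<xi> x * A \<xi> (x $ k))) / N\<^sup>2)
    + (\<Sum>i\<in>UNIV - {k}. (LINT x|lborel. u x * ?c1 i x * (?e \<xi> x * ?Ai i \<xi> (x $ k))) / N)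
    + (LINT x|lborel. u x * ?c1 k x * (?e \<xi> x * ?A1 \<xi> (x $ k))) / N
    + (LINT x|lborel. u x * ?c0 x * (?e \<xi> x * B \<xi> (x $ k)))
    = - (LINT x|lborel. f x * ?c0 x * (?e \<xi> x * A \<xi> (x $ k)))" for \<xi>
  proof -
    define g where "g = (\<lambda>j t. bump (t / N) * (if j = k then A \<xi> t else exp (\<i> * complex_of_real (\<xi> $ j) * complex_of_real t)))"
    note L = laplace_prod_cutoff_wave(2,3)[OF ode(1,2,3)[of \<xi>] N g_def]
    have sg: "smooth (g j)" for j
      by (rule laplace_prod_cutoff_wave(1)[OF ode(1,2,3)[of \<xi>] N g_def])
    have g0: "g j t = 0" if "\<bar>t\<bar> \<ge> N" for j t
      using that N bump_outside[of "t / N"] by (simp add: g_def abs_divide)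
    have "(LINT x|lborel. u x * (laplace_prod g x + lam * (\<Prod>j\<in>UNIV. g j (x $ j))))
     = - (LINT x|lborel. f x * (\<Prod>j\<in>UNIV. g j (x $ j)))"
      by (rule helmholtz_prod[OF u_borel u_loc f_borel f_loc weak sg g0 N])
    also have "(LINT x|lborel. f x * (\<Prod>j\<in>UNIV. g j (x $ j))) = (LINT x|lborel. f x * ?c0 x * (?e \<xi> x * A \<xi> (x $ k)))"
      unfolding L(1) by (simp add: mult.assoc)
    also have "(LINT x|lborel. u x * (laplace_prod g x + lam * (\<Prod>j\<in>UNIV. g j (x $ j)))) =
      (LINT x|lborel. (\<Sum>i\<in>UNIV. u x * ?c2 i x * (?e \<xi> x * A \<xi> (x $ k)) / N\<^sup>2)
      + (\<Sum>i\<in>UNIV - {k}. u x * ?c1 i x * (?e \<xi> x * ?Ai i \<xi> (x $ k)) / N)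
      + u x * ?c1 k x * (?e \<xi> x * ?A1 \<xi> (x $ k)) / N
      + u x * ?c0 x * (?e \<xi> x * B \<xi> (x $ k)))"
      unfolding L(2) distrib_left sum_distrib_left
      by (intro Bochner_Integration.integral_cong refl arg_cong2[where f = "(+)"] sum.cong) (simp_all add: mult_ac)
    also have "\<dots> = (\<Sum>i\<in>UNIV. (LINT x|lborel. u x * ?c2 i x * (?e \<xi> x * A \<xi> (x $ k))) / N\<^sup>2)
      + (\<Sum>i\<in>UNIV - {k}. (LINT x|lborel. u x * ?c1 i x * (?e \<xi> x * ?Ai i \<xi> (x $ k))) / N)
      + (LINT x|lborel. u x * ?c1 k x * (?e \<xi> x * ?A1 \<xi> (x $ k))) / N
      + (LINT x|lborel. u x * ?c0 x * (?e \<xi> x * B \<xi> (x $ k)))"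
      using I(3)[OF amp(1) ui(1)] I(3)[OF amp'(1) ui(2)] I(3)[OF amp'(2) ui(2)] I(3)[OF amp(3) ui(3)]
      by (simp only: Bochner_Integration.integral_add Bochner_Integration.integral_sum Bochner_Integration.integral_divide_zero
          Bochner_Integration.integrable_add Bochner_Integration.integrable_sum Bochner_Integration.integrable_divide_zero simp_thms)
    finally show ?thesis .
  qed
  have i2: "integrable lborel (\<lambda>\<xi>. (LINT x|lborel. u x * ?c2 i x * (?e \<xi> x * A \<xi> (x $ k))) / N\<^sup>2)"
    and i1: "integrable lborel (\<lambda>\<xi>. (LINT x|lborel. u x * ?c1 i x * (?e \<xi> x * ?Ai i \<xi> (x $ k))) / N)"
    and i1k: "integrable lborel (\<lambda>\<xi>. (LINT x|lborel. u x * ?c1 i x * (?e \<xi> x * ?A1 \<xi> (x $ k))) / N)"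
    and i0: "integrable lborel (\<lambda>\<xi>. LINT x|lborel. u x * ?c0 x * (?e \<xi> x * B \<xi> (x $ k)))" for i
    using I(2)[OF amp(1) ui(1)] I(2)[OF amp'(1) ui(2)] I(2)[OF amp'(2) ui(2)] I(2)[OF amp(3) ui(3)] by auto
  have "(LINT \<xi>|lborel. (\<Sum>i\<in>UNIV. (LINT x|lborel. u x * ?c2 i x * (?e \<xi> x * A \<xi> (x $ k))) / N\<^sup>2)
    + (\<Sum>i\<in>UNIV - {k}. (LINT x|lborel. u x * ?c1 i x * (?e \<xi> x * ?Ai i \<xi> (x $ k))) / N)
    + (LINT x|lborel. u x * ?c1 k x * (?e \<xi> x * ?A1 \<xi> (x $ k))) / N
    + (LINT x|lborel. u x * ?c0 x * (?e \<xi> x * B \<xi> (x $ k))))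
    = - (LINT \<xi>|lborel. LINT x|lborel. f x * ?c0 x * (?e \<xi> x * A \<xi> (x $ k)))"
    unfolding pt by simp
  moreover have "(LINT \<xi>|lborel. (\<Sum>i\<in>UNIV. (LINT x|lborel. u x * ?c2 i x * (?e \<xi> x * A \<xi> (x $ k))) / N\<^sup>2)
    + (\<Sum>i\<in>UNIV - {k}. (LINT x|lborel. u x * ?c1 i x * (?e \<xi> x * ?Ai i \<xi> (x $ k))) / N)
    + (LINT x|lborel. u x * ?c1 k x * (?e \<xi> x * ?A1 \<xi> (x $ k))) / N
    + (LINT x|lborel. u x * ?c0 x * (?e \<xi> x * B \<xi> (x $ k)))) =
    (\<Sum>i\<in>UNIV. (LINT \<xi>|lborel. LINT x|lborel. u x * ?c2 i x * (?e \<xi> x * A \<xi> (x $ k))) / N\<^sup>2)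
    + (\<Sum>i\<in>UNIV - {k}. (LINT \<xi>|lborel. LINT x|lborel. u x * ?c1 i x * (?e \<xi> x * ?Ai i \<xi> (x $ k))) / N)
    + (LINT \<xi>|lborel. LINT x|lborel. u x * ?c1 k x * (?e \<xi> x * ?A1 \<xi> (x $ k))) / N
    + (LINT \<xi>|lborel. LINT x|lborel. u x * ?c0 x * (?e \<xi> x * B \<xi> (x $ k)))"
    using i2 i1 i1k i0
    by (simp only: Bochner_Integration.integral_add Bochner_Integration.integral_sum Bochner_Integration.integral_divide_zero
          Bochner_Integration.integrable_add Bochner_Integration.integrable_sum simp_thms)
  ultimately show ?thesis
    unfolding I(1)[OF amp(1) ui(1)] I(1)[OF amp'(1) ui(2)] I(1)[OF amp'(2) ui(2)] I(1)[OF amp(3) ui(3)] I(1)[OF amp(1) fi]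
    by simp
qed

text \<open>Every term with a differentiated cutoff falls under
  \<open>boundary_term_tendsto_0\<close>, the second-order ones with a factor 1/N to spare; the
  other two converge by domination. The hypothesis \<open>int\<close> provides the majorant for the
  term with B, since the bounds on an amplitude give no decay in x.\<close>

lemma wave_duality:
  fixes A A1 B :: "real^'n \<Rightarrow> real \<Rightarrow> complex"
  assumes ode: "\<And>\<xi> t. (A \<xi> has_vector_derivative A1 \<xi> t) (at t)"
    "\<And>\<xi> t. (A1 \<xi> has_vector_derivative complex_of_real (qform k \<xi> - lam) * A \<xi> t + B \<xi> t) (at t)"
    "\<And>\<xi>. smooth (B \<xi>)"
    and amp: "amplitude A" "amplitude A1" "amplitude B" "\<And>i. amplitude (\<lambda>\<xi> t. complex_of_real (\<xi> $ i) * A \<xi> t)"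
    and int: "integrable lborel (\<lambda>x. u x * wave k B x)"
  shows "(LINT x|lborel. u x * wave k B x) =
     - (LINT \<xi>|lborel. LINT x|lborel. f x * (iexp (phase k \<xi> x) * A \<xi> (x $ k)))"
proof -
  let ?c0 = "\<lambda>N. cutoff (\<lambda>_. bump) (real (Suc N)) :: real^'n \<Rightarrow> complex"
  let ?T2 = "\<lambda>i N. (LINT x|lborel. u x * cutoff_at (vd (vd bump)) i (real (Suc N)) x * wave k A x) / real (Suc N)"
  let ?T1 = "\<lambda>i N. (LINT x|lborel. u x * cutoff_at (vd bump) i (real (Suc N)) x * wave k (\<lambda>\<xi> t. 2 * \<i> * (complex_of_real (\<xi> $ i) * A \<xi> t)) x) / real (Suc N)"
  let ?T0 = "\<lambda>N. (LINT x|lborel. u x * cutoff_at (vd bump) k (real (Suc N)) x * wave k (\<lambda>\<xi> t. 2 * A1 \<xi> t) x) / real (Suc N)"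
  let ?Su = "\<lambda>N. LINT x|lborel. u x * ?c0 N x * wave k B x"
  let ?Sf = "\<lambda>N. LINT x|lborel. f x * ?c0 N x * wave k A x"
  have "\<exists>M\<ge>0. \<forall>N x. norm (cutoff (\<lambda>_::'n. bump) N x) \<le> M"
    by (rule cutoff_bounded) (rule cutoff_profile_bump)
  then obtain M where M: "M \<ge> 0" "\<And>N x. norm (cutoff (\<lambda>_::'n. bump) N x) \<le> M" by auto
  have cm: "?c0 N \<in> borel_measurable borel" for N
    by (intro borel_measurable_continuous_onI cutoff_continuous) (auto simp: cutoff_profile_bump)
  have c1: "(\<lambda>N. ?c0 N x) \<longlonglongrightarrow> 1" for x
    using cutoff_tendsto[of "\<lambda>_::'n. bump" x] by (simp add: cutoff_profile_bump bump_0)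
  have dct: "(\<lambda>N. LINT x|lborel. v x * ?c0 N x * w x) \<longlonglongrightarrow> (LINT x|lborel. v x * w x)"
    if vw: "integrable lborel (\<lambda>x. v x * w x)" and [measurable]: "v \<in> borel_measurable borel" "w \<in> borel_measurable borel"
    for v w :: "real^'n \<Rightarrow> complex"
  proof (rule integral_dominated_convergence)
    show "integrable lborel (\<lambda>x. M * norm (v x * w x))" using vw by (intro integrable_mult_right integrable_norm)
    show "AE x in lborel. (\<lambda>N. v x * ?c0 N x * w x) \<longlonglongrightarrow> v x * w x"
    proof (rule AE_I2)
      fix x
      have "(\<lambda>N. v x * ?c0 N x * w x) \<longlonglongrightarrow> v x * 1 * w x" by (intro tendsto_intros c1)
      then show "(\<lambda>N. v x * ?c0 N x * w x) \<longlonglongrightarrow> v x * w x" by simp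
    qed
    show "AE x in lborel. norm (v x * ?c0 N x * w x) \<le> M * norm (v x * w x)" for N
      using mult_right_mono[OF M(2), of "norm (v _ * w _)"] by (intro AE_I2) (simp add: norm_mult mult_ac)
    show "(\<lambda>x. v x * ?c0 N x * w x) \<in> borel_measurable lborel" for N
      using cm[of N] by measurable
  qed measurable
  have Su: "?Su \<longlonglongrightarrow> (LINT x|lborel. u x * wave k B x)"
    by (intro dct int u_borel borel_measurable_wave amp)
  have Sf: "?Sf \<longlonglongrightarrow> (LINT x|lborel. f x * wave k A x)"
    by (intro dct integrable_mult_wave f_integrable f_borel borel_measurable_wave amp)
  have T2: "?T2 i \<longlonglongrightarrow> 0" for i
    by (rule boundary_term_tendsto_0[OF _ amp(1)]) (simp add: cutoff_profile_bump)
  have T1: "?T1 i \<longlonglongrightarrow> 0" for i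
    by (rule boundary_term_tendsto_0[OF _ amplitude_mult_const[OF amp(4)]]) (simp add: cutoff_profile_bump)
  have T0: "?T0 \<longlonglongrightarrow> 0"
    by (rule boundary_term_tendsto_0[OF _ amplitude_mult_const[OF amp(2)]]) (simp add: cutoff_profile_bump)
  have eq: "- ?Sf N - (\<Sum>i\<in>UNIV. ?T2 i N * complex_of_real (1 / real (Suc N))) - (\<Sum>i\<in>UNIV - {k}. ?T1 i N) - ?T0 N = ?Su N" for N
  proof -
    have "(\<Sum>i\<in>UNIV. ?T2 i N * complex_of_real (1 / real (Suc N))) =
      (\<Sum>i\<in>UNIV. (LINT x|lborel. u x * cutoff_at (vd (vd bump)) i (real (Suc N)) x * wave k A x) / (real (Suc N))\<^sup>2)"
      by (intro sum.cong refl) (simp add: power2_eq_square del: of_nat_Suc)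
    then show ?thesis
      using wave_identity[OF ode amp, of "real (Suc N)"] by (simp add: algebra_simps del: of_nat_Suc)
  qed
  have "(\<lambda>N. complex_of_real (1 / real (Suc N))) \<longlonglongrightarrow> complex_of_real 0"
    by (intro tendsto_of_real LIMSEQ_Suc[OF lim_1_over_n])
  then have "(\<lambda>N. - ?Sf N - (\<Sum>i\<in>UNIV. ?T2 i N * complex_of_real (1 / real (Suc N))) - (\<Sum>i\<in>UNIV - {k}. ?T1 i N) - ?T0 N)
     \<longlonglongrightarrow> - (LINT x|lborel. f x * wave k A x) - (\<Sum>i\<in>(UNIV::'n set). 0 * complex_of_real 0) - (\<Sum>i\<in>UNIV - {k}. 0) - 0"
    by (intro tendsto_diff tendsto_minus tendsto_sum tendsto_mult T2 T1 T0 Sf)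
  then have "?Su \<longlonglongrightarrow> - (LINT x|lborel. f x * wave k A x)" unfolding eq by simp
  with Su have "(LINT x|lborel. u x * wave k B x) = - (LINT x|lborel. f x * wave k A x)"
    by (rule LIMSEQ_unique)
  then show ?thesis using integral_mult_wave[OF amp(1) f_integrable, of k] by simp
qed

end

subsection \<open>Vanishing of the Fourier transform on the complex sphere\<close>

text \<open>Differentiation under the integral sign by dominated convergence along sequences. A
  majorant of the derivative on each disc is enough, because a convergent sequence eventually stays
  within distance 1 of its limit.\<close>

lemma holomorphic_on_integral:
  fixes g g' :: "'a \<Rightarrow> complex \<Rightarrow> complex"
  assumes d: "\<And>x z. (g x has_field_derivative g' x z) (at z)"
    and int: "\<And>z. integrable M (\<lambda>x. g x z)"
    and m: "\<And>z. (\<lambda>x. g' x z) \<in> borel_measurable M"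
    and W: "\<And>r. \<exists>w. integrable M w \<and> (\<forall>x z. norm z \<le> r \<longrightarrow> norm (g' x z) \<le> w x)"
  shows "(\<lambda>z. LINT x|M. g x z) holomorphic_on UNIV"
proof -
  have "((\<lambda>z. LINT x|M. g x z) has_field_derivative (LINT x|M. g' x z)) (at z)" for z
    unfolding has_field_derivative_iff tendsto_at_iff_sequentially
  proof (intro allI impI)
    fix X :: "nat \<Rightarrow> complex" assume X: "\<forall>i. X i \<in> UNIV - {z}" "X \<longlonglongrightarrow> z"
    obtain w where w: "integrable M w" "\<And>x y. norm y \<le> norm z + 1 \<Longrightarrow> norm (g' x y) \<le> w x"
      using W[of "norm z + 1"] by blast
    have "eventually (\<lambda>n. dist (X n) z < 1) sequentially"
      using tendstoD[OF X(2), of 1] by simp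
    then obtain n0 where n0: "\<And>n. n \<ge> n0 \<Longrightarrow> dist (X n) z < 1"
      by (auto simp: eventually_sequentially)
    \<comment> \<open>The mean value inequality on the convex ball of radius 1 bounds the difference
      quotients by the same majorant as the derivative.\<close>
    have quot: "norm ((g x (X n) - g x z) / (X n - z)) \<le> w x" if "n \<ge> n0" for n x
    proof -
      have "norm (g x (X n) - g x z) \<le> w x * norm (X n - z)"
      proof (rule field_differentiable_bound[where S = "ball z 1"])
        show "norm (g' x y) \<le> w x" if "y \<in> ball z 1" for y
          by (rule w(2)) (use that norm_triangle_ineq2[of y z] in \<open>auto simp: dist_norm norm_minus_commute\<close>)
        show "(g x has_field_derivative g' x y) (at y within ball z 1)" for y
          using d by (rule DERIV_subset) simp
      qed (use n0[OF that] in \<open>auto simp: dist_commute\<close>)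
      then show ?thesis using X(1) by (auto simp: norm_divide divide_le_eq)
    qed
    have lim: "(\<lambda>n. LINT x|M. (g x (X (n + n0)) - g x z) / (X (n + n0) - z)) \<longlonglongrightarrow> (LINT x|M. g' x z)"
    proof (rule integral_dominated_convergence[OF m _ w(1)])
      show "(\<lambda>x. (g x (X (n + n0)) - g x z) / (X (n + n0) - z)) \<in> borel_measurable M" for n
        using borel_measurable_integrable[OF int] by measurable
      show "AE x in M. (\<lambda>n. (g x (X (n + n0)) - g x z) / (X (n + n0) - z)) \<longlonglongrightarrow> g' x z"
      proof (rule AE_I2)
        fix x
        have "((\<lambda>y. (g x y - g x z) / (y - z)) \<circ> X) \<longlonglongrightarrow> g' x z"
          using d[of x z] X unfolding has_field_derivative_iff tendsto_at_iff_sequentially by blast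
        from LIMSEQ_ignore_initial_segment[OF this, of n0]
        show "(\<lambda>n. (g x (X (n + n0)) - g x z) / (X (n + n0) - z)) \<longlonglongrightarrow> g' x z"
          by (simp add: o_def)
      qed
      show "AE x in M. norm ((g x (X (n + n0)) - g x z) / (X (n + n0) - z)) \<le> w x" for n
        by (intro AE_I2 quot) simp
    qed
    have eq: "(LINT x|M. (g x (X (n + n0)) - g x z) / (X (n + n0) - z)) =
        ((LINT x|M. g x (X (n + n0))) - (LINT x|M. g x z)) / (X (n + n0) - z)" for n
      by (simp only: Bochner_Integration.integral_divide_zero Bochner_Integration.integral_diff int)
    have "(\<lambda>n. ((\<lambda>y. ((LINT x|M. g x y) - (LINT x|M. g x z)) / (y - z)) \<circ> X) (n + n0)) \<longlonglongrightarrow> (LINT x|M. g' x z)"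
      using lim unfolding eq o_def .
    then show "((\<lambda>y. ((LINT x|M. g x y) - (LINT x|M. g x z)) / (y - z)) \<circ> X) \<longlonglongrightarrow> (LINT x|M. g' x z)"
      by (rule LIMSEQ_offset)
  qed
  then show ?thesis
    by (auto simp: holomorphic_on_def field_differentiable_def intro: has_field_derivative_at_within)
qed

lemma AE_zero_imp_zero_on_open:
  fixes F :: "'a::euclidean_space \<Rightarrow> complex"
  assumes U: "open U" and F: "continuous_on U F" and ae: "AE x in lborel. x \<in> U \<longrightarrow> F x = 0" and "x \<in> U"
  shows "F x = 0"
proof (rule ccontr)
  assume "F x \<noteq> 0"
  let ?V = "U \<inter> F -` (- {0})"
  have V: "open ?V" by (rule continuous_open_preimage[OF F U]) auto
  have "AE x in lborel. x \<notin> ?V" using ae by eventually_elim auto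
  then have "?V \<in> null_sets lborel"
    using V by (subst (asm) AE_iff_null_sets[symmetric]) auto
  then have "negligible ?V"
    unfolding negligible_iff_null_sets by (rule null_sets_completionI)
  with open_not_negligible[OF V] \<open>F x \<noteq> 0\<close> \<open>x \<in> U\<close> show False by blast
qed

text \<open>Half of the Gaussian absorbs the linear factor. Such factors come from \<xi>_i in the
  gradient of the phase and from sqrt | |\<xi>'|^2 - \<lambda> | in the derivative of H.\<close>

lemma amplitude_of_linear_bound:
  fixes A :: "real^'n::finite \<Rightarrow> real \<Rightarrow> complex"
  assumes m: "(\<lambda>(\<xi>, t). A \<xi> t) \<in> borel_measurable (borel \<Otimes>\<^sub>M borel)"
    and c: "c > 0" and C: "C \<ge> 0"
    and b: "\<And>\<xi> t. norm (A \<xi> t) \<le> C * (1 + norm \<xi>) * exp (- c * (norm \<xi>)\<^sup>2)"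
  shows "amplitude A"
proof -
  let ?D = "C * exp (1 / (2 * c))"
  have "norm (A \<xi> t) \<le> ?D * exp (- (c / 2) * (norm \<xi>)\<^sup>2)" for \<xi> t
  proof -
    have "exp (- (c / 2) * (norm \<xi>)\<^sup>2) \<le> exp (1 / (2 * c)) * exp (- norm \<xi>)"
      using exp_square_le[of "c / 2" "norm \<xi>" 1] c by simp
    then have "(1 + norm \<xi>) * exp (- (c / 2) * (norm \<xi>)\<^sup>2) \<le> exp (norm \<xi>) * (exp (1 / (2 * c)) * exp (- norm \<xi>))"
      by (intro mult_mono exp_ge_add_one_self) auto
    then have *: "(1 + norm \<xi>) * exp (- (c / 2) * (norm \<xi>)\<^sup>2) \<le> exp (1 / (2 * c))"
      by (simp add: exp_minus field_simps)
    have "exp (- c * (norm \<xi>)\<^sup>2) = exp (- (c / 2) * (norm \<xi>)\<^sup>2) * exp (- (c / 2) * (norm \<xi>)\<^sup>2)"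
      by (simp add: exp_add[symmetric])
    then have "norm (A \<xi> t) \<le> C * ((1 + norm \<xi>) * exp (- (c / 2) * (norm \<xi>)\<^sup>2)) * exp (- (c / 2) * (norm \<xi>)\<^sup>2)"
      using b[of \<xi> t] by (simp add: mult.assoc)
    also have "\<dots> \<le> C * exp (1 / (2 * c)) * exp (- (c / 2) * (norm \<xi>)\<^sup>2)"
      by (intro mult_right_mono mult_left_mono * C) auto
    finally show ?thesis .
  qed
  with m c show ?thesis unfolding amplitude_def by (intro conjI exI[of _ ?D] exI[of _ "c / 2"]) auto
qed

lemma amplitude_mult_coord:
  fixes A :: "real^'n::finite \<Rightarrow> real \<Rightarrow> complex"
  assumes A: "amplitude A"
  shows "amplitude (\<lambda>\<xi> t. complex_of_real (\<xi> $ i) * A \<xi> t)"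
proof -
  obtain C c where C: "C \<ge> 0" "c > 0" "\<And>\<xi> t. norm (A \<xi> t) \<le> C * exp (- c * (norm \<xi>)\<^sup>2)"
    using amplitudeE[OF A] by blast
  note [measurable] = amplitude_measurable[OF A]
  show ?thesis
  proof (rule amplitude_of_linear_bound[OF _ C(2,1)])
    fix \<xi> :: "real^'n" and t
    have "\<bar>\<xi> $ i\<bar> * norm (A \<xi> t) \<le> (1 + norm \<xi>) * (C * exp (- c * (norm \<xi>)\<^sup>2))"
      using component_le_norm_cart[of \<xi> i] by (intro mult_mono C) auto
    then show "norm (complex_of_real (\<xi> $ i) * A \<xi> t) \<le> C * (1 + norm \<xi>) * exp (- c * (norm \<xi>)\<^sup>2)"
      by (simp add: norm_mult mult_ac)
  qed measurable
qed

lemma qform_continuous: "continuous_on S (qform k)"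
  unfolding qform_def[abs_def] by (intro continuous_intros)

lemma borel_measurable_qform [measurable (raw)]:
  assumes [measurable]: "f \<in> borel_measurable M"
  shows "(\<lambda>p. qform k (f p)) \<in> borel_measurable M"
  unfolding qform_def by measurable

lemma qform_nonneg: "qform k \<xi> \<ge> 0"
  unfolding qform_def by (intro sum_nonneg) auto

lemma qform_scale: "qform k (c *\<^sub>R \<xi>) = c\<^sup>2 * qform k \<xi>"
  by (simp add: qform_def power_mult_distrib sum_distrib_left)

lemma phase_scale: "phase k (c *\<^sub>R \<xi>) x = c * phase k \<xi> x"
  by (simp add: phase_def sum_distrib_left mult.assoc)

lemma qform_le_norm: "qform k \<xi> \<le> (norm \<xi>)\<^sup>2"
  unfolding qform_def norm_power2_vec by (intro sum_mono2) auto

lemma phase_le: "\<bar>phase k \<xi> x\<bar> \<le> (\<Sum>i\<in>UNIV. \<bar>\<xi> $ i\<bar>) * norm x"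
proof -
  have "\<bar>phase k \<xi> x\<bar> \<le> (\<Sum>i\<in>UNIV - {k}. \<bar>\<xi> $ i\<bar> * \<bar>x $ i\<bar>)"
    unfolding phase_def by (rule order_trans[OF sum_abs]) (simp add: abs_mult)
  also have "\<dots> \<le> (\<Sum>i\<in>UNIV. \<bar>\<xi> $ i\<bar> * \<bar>x $ i\<bar>)" by (intro sum_mono2) auto
  also have "\<dots> \<le> (\<Sum>i\<in>UNIV. \<bar>\<xi> $ i\<bar> * norm x)"
    by (intro sum_mono mult_left_mono component_le_norm_cart) auto
  finally show ?thesis by (simp add: sum_distrib_right)
qed

section \<open>From the real sphere to evanescent frequencies\<close>

context helmholtz
begin

text \<open>The Fourier integral of f on the hemisphere given by one sign of the root; the arc along
  which it is continued analytically stays in that hemisphere. For |\<xi>'|^2 > \<lambda> the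
  library value sqrt (-y) = - sqrt y keeps the exponent imaginary and the function bounded.\<close>

definition F_sphere :: "real^'n \<Rightarrow> complex" where
  "F_sphere \<xi> = (LINT x|lborel. f x * (iexp (phase k \<xi> x) * iexp (- sqrt (lam - qform k \<xi>) * x $ k)))"

lemma F_sphere_measurable [measurable]: "F_sphere \<in> borel_measurable borel"
  unfolding F_sphere_def[abs_def] by measurable

lemma F_sphere_bounded: "norm (F_sphere \<xi>) \<le> (LINT x|lborel. norm (f x))"
  unfolding F_sphere_def
  by (rule norm_lebesgue_integral_le) (auto simp: f_integrable norm_mult)

lemma F_sphere_continuous: "continuous_on {\<xi>. qform k \<xi> < lam} F_sphere"
proof -
  have "isCont F_sphere \<xi>" for \<xi>
    unfolding continuous_at_sequentially
  proof (intro allI impI)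
    fix X assume X: "X \<longlonglongrightarrow> \<xi>"
    show "(F_sphere \<circ> X) \<longlonglongrightarrow> F_sphere \<xi>"
      unfolding F_sphere_def o_def
    proof (rule integral_dominated_convergence[where w = "\<lambda>x. norm (f x)"])
      show "AE x in lborel. (\<lambda>n. f x * (iexp (phase k (X n) x) * iexp (- sqrt (lam - qform k (X n)) * x $ k)))
          \<longlonglongrightarrow> f x * (iexp (phase k \<xi> x) * iexp (- sqrt (lam - qform k \<xi>) * x $ k))"
        unfolding phase_def qform_def
        by (intro AE_I2 tendsto_intros X)
    qed (use f_integrable in \<open>auto simp: norm_mult\<close>)
  qed
  then show ?thesis by (simp add: continuous_at_imp_continuous_on)
qed

text \<open>With B = 0 the duality says that the density integrates to zero against
  \<open>F_sphere\<close>. The density is the conjugate of \<open>F_sphere\<close> times a Gaussian,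
  cut off at |\<xi>'|^2 < \<lambda>, so a nonnegative integrand has integral zero; continuity
  upgrades almost everywhere to everywhere.\<close>

lemma F_sphere_eq_0:
  assumes "qform k \<xi> < lam"
  shows "F_sphere \<xi> = 0"
proof -
  define a where "a \<xi> = (if qform k \<xi> < lam then cnj (F_sphere \<xi>) * exp (- (norm \<xi>)\<^sup>2) else 0)" for \<xi>
  define A where "A \<xi> t = a \<xi> * iexp (- sqrt (lam - qform k \<xi>) * t)" for \<xi> t
  define A1 where "A1 \<xi> t = (- \<i> * sqrt (lam - qform k \<xi>)) * A \<xi> t" for \<xi> t
  define D where "D = (LINT x|lborel. norm (f x))"
  have D0: "D \<ge> 0" unfolding D_def by (intro Bochner_Integration.integral_nonneg) simp
  have [measurable]: "a \<in> borel_measurable borel" unfolding a_def[abs_def] by measurable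
  have am: "(\<lambda>(\<xi>, t). A \<xi> t) \<in> borel_measurable (borel \<Otimes>\<^sub>M borel)"
    and am1: "(\<lambda>(\<xi>, t). A1 \<xi> t) \<in> borel_measurable (borel \<Otimes>\<^sub>M borel)"
    unfolding A1_def A_def by measurable
  have a_le: "norm (a \<xi>) \<le> D * exp (- 1 * (norm \<xi>)\<^sup>2)" for \<xi>
    using F_sphere_bounded[of \<xi>] D0 by (auto simp: a_def D_def norm_mult)
  have A_le: "norm (A \<xi> t) \<le> D * exp (- 1 * (norm \<xi>)\<^sup>2)" for \<xi> t
    using a_le[of \<xi>] by (simp add: A_def norm_mult)
  have amp: "amplitude A" unfolding amplitude_def using am A_le zero_less_one by blast
  have A1_le: "norm (A1 \<xi> t) \<le> (sqrt lam * D) * exp (- 1 * (norm \<xi>)\<^sup>2)" for \<xi> t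
  proof (cases "qform k \<xi> < lam")
    case True
    then have "sqrt (lam - qform k \<xi>) * norm (A \<xi> t) \<le> sqrt lam * (D * exp (- 1 * (norm \<xi>)\<^sup>2))"
      using qform_nonneg[of k \<xi>] by (intro mult_mono A_le) auto
    with True show ?thesis by (simp add: A1_def norm_mult mult.assoc)
  qed (use D0 lam_pos in \<open>simp add: A1_def A_def a_def\<close>)
  have amp1: "amplitude A1" unfolding amplitude_def using am1 A1_le zero_less_one by blast
  have dA: "(A \<xi> has_vector_derivative A1 \<xi> t) (at t)" for \<xi> t
  proof -
    have "((\<lambda>t. iexp (- sqrt (lam - qform k \<xi>) * t)) has_vector_derivative
        (- \<i> * sqrt (lam - qform k \<xi>)) * iexp (- sqrt (lam - qform k \<xi>) * t)) (at t)"
      by (rule has_vector_derivative_real_field[of "\<lambda>z. exp (\<i> * (complex_of_real (- sqrt (lam - qform k \<xi>)) * z))", simplified of_real_mult[symmetric]])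
         (auto intro!: derivative_eq_intros)
    from has_vector_derivative_mult_right[OF this, of "a \<xi>"] show ?thesis
      by (simp add: A_def[abs_def] A1_def mult_ac)
  qed
  have dA1: "(A1 \<xi> has_vector_derivative complex_of_real (qform k \<xi> - lam) * A \<xi> t + 0) (at t)" for \<xi> t
  proof -
    have eq: "(- \<i> * sqrt (lam - qform k \<xi>)) * A1 \<xi> t = complex_of_real (qform k \<xi> - lam) * A \<xi> t"
    proof (cases "qform k \<xi> < lam")
      case True
      then have e1: "complex_of_real (sqrt (lam - qform k \<xi>)) * complex_of_real (sqrt (lam - qform k \<xi>)) = complex_of_real (lam - qform k \<xi>)"
        unfolding of_real_mult[symmetric] by simp
      have "(- \<i> * sqrt (lam - qform k \<xi>)) * A1 \<xi> t = - (complex_of_real (sqrt (lam - qform k \<xi>)) * complex_of_real (sqrt (lam - qform k \<xi>))) * A \<xi> t"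
        by (simp add: A1_def complex_eq_iff algebra_simps)
      then show ?thesis unfolding e1 by (simp add: algebra_simps)
    qed (simp add: A1_def A_def a_def)
    have A1: "A1 \<xi> = (\<lambda>t. (- \<i> * sqrt (lam - qform k \<xi>)) * A \<xi> t)" by (simp add: A1_def fun_eq_iff)
    show ?thesis
      using has_vector_derivative_mult_right[OF dA, of "- \<i> * sqrt (lam - qform k \<xi>)" \<xi> t, unfolded eq, folded A1]
      by simp
  qed
  have amp0: "amplitude (\<lambda>_ _. 0)" by (rule amplitude_of_linear_bound[of _ 1 0]) auto
  have "(LINT x|lborel. u x * wave k (\<lambda>_ _. 0) x) =
     - (LINT \<xi>|lborel. LINT x|lborel. f x * (iexp (phase k \<xi> x) * A \<xi> (x $ k)))"
    by (rule wave_duality[OF dA dA1 smooth_const amp amp1 amp0 amplitude_mult_coord[OF amp]]) (simp add: wave_def)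
  then have "(LINT \<xi>|lborel. LINT x|lborel. f x * (iexp (phase k \<xi> x) * A \<xi> (x $ k))) = 0"
    by (simp add: wave_def)
  moreover have "(LINT x|lborel. f x * (iexp (phase k \<xi> x) * A \<xi> (x $ k))) =
      complex_of_real (if qform k \<xi> < lam then (norm (F_sphere \<xi>))\<^sup>2 * exp (- (norm \<xi>)\<^sup>2) else 0)" for \<xi>
  proof -
    have "(LINT x|lborel. f x * (iexp (phase k \<xi> x) * A \<xi> (x $ k))) =
      (LINT x|lborel. a \<xi> * (f x * (iexp (phase k \<xi> x) * iexp (- sqrt (lam - qform k \<xi>) * x $ k))))"
      by (intro Bochner_Integration.integral_cong refl) (simp add: A_def mult_ac)
    also have "\<dots> = a \<xi> * F_sphere \<xi>"
      unfolding F_sphere_def by (rule integral_mult_right_zero)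
    finally show ?thesis
      by (simp add: a_def complex_norm_square mult_ac del: of_real_power)
  qed
  ultimately have "complex_of_real (LINT \<xi>|lborel. (if qform k \<xi> < lam then (norm (F_sphere \<xi>))\<^sup>2 * exp (- (norm \<xi>)\<^sup>2) else 0)) = 0"
    by (simp only: integral_complex_of_real)
  moreover have "integrable lborel (\<lambda>\<xi>. if qform k \<xi> < lam then (norm (F_sphere \<xi>))\<^sup>2 * exp (- (norm \<xi>)\<^sup>2) else 0)"
  proof (rule Bochner_Integration.integrable_bound)
    show "integrable lborel (\<lambda>\<xi>::real^'n. D\<^sup>2 * exp (- 1 * (norm \<xi>)\<^sup>2))"
      by (intro integrable_mult_right integrable_gauss) simp
    show "AE \<xi> in lborel. norm (if qform k \<xi> < lam then (norm (F_sphere \<xi>))\<^sup>2 * exp (- (norm \<xi>)\<^sup>2) else 0)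
       \<le> norm (D\<^sup>2 * exp (- 1 * (norm \<xi>)\<^sup>2))"
      using power_mono[OF F_sphere_bounded norm_ge_zero, of _ 2] by (intro AE_I2) (auto simp: D_def)
  qed measurable
  ultimately have "AE \<xi> in lborel. (if qform k \<xi> < lam then (norm (F_sphere \<xi>))\<^sup>2 * exp (- (norm \<xi>)\<^sup>2) else 0) = 0"
    by (subst integral_nonneg_eq_0_iff_AE[symmetric]) auto
  then have "AE \<xi> in lborel. \<xi> \<in> {\<xi>. qform k \<xi> < lam} \<longrightarrow> F_sphere \<xi> = 0"
    by eventually_elim (auto split: if_splits)
  moreover have "open {\<xi>. qform k \<xi> < lam}"
    using qform_continuous by (intro open_Collect_less continuous_intros)
  ultimately show ?thesis
    using AE_zero_imp_zero_on_open[OF _ F_sphere_continuous] assms by blast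
qed

text \<open>The sphere \<open>\<zeta> \<sqdot> \<zeta> = \<lambda>\<close> is followed into the complex domain along
  \<open>\<theta> \<mapsto> \<surd>\<lambda> (cos \<theta> \<omega>, sin \<theta>)\<close>: the values \<open>\<theta> \<in> ]0, \<pi>[\<close> are real directions,
  imaginary \<open>\<theta>\<close> gives the evanescent ones.\<close>

lemma F_evanescent_eq_0:
  assumes "qform k \<xi> > lam"
  shows "(LINT x|lborel. f x * (iexp (phase k \<xi> x) * complex_of_real (exp (- sqrt (qform k \<xi> - lam) * x $ k)))) = 0"
proof -
  define q where "q = qform k \<xi>"
  \<comment> \<open>One constant that serves both bounds, of \<open>p x\<close> and of
    \<open>x $ k\<close>, by L |x|.\<close>
  define L where "L = (\<Sum>i\<in>UNIV. \<bar>\<xi> $ i\<bar>) / sqrt q + 1"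
  define p where "p x = phase k \<xi> x / sqrt q" for x
  define r where "r = sqrt lam"
  have q0: "q > 0" "q > lam" using assms lam_pos by (auto simp: q_def)
  have r0: "r > 0" "r * r = lam" using lam_pos by (auto simp: r_def)
  have L1: "L \<ge> 1" using q0 by (simp add: L_def sum_nonneg)
  have p_le: "\<bar>p x\<bar> \<le> L * norm x" for x
  proof -
    have "\<bar>p x\<bar> \<le> ((\<Sum>i\<in>UNIV. \<bar>\<xi> $ i\<bar>) * norm x) / sqrt q"
      using divide_right_mono[OF phase_le[of k \<xi> x], of "sqrt q"] q0 by (simp add: p_def abs_divide)
    also have "\<dots> \<le> L * norm x" by (simp add: L_def distrib_right)
    finally show ?thesis .
  qed
  have k_le: "\<bar>x $ k\<bar> \<le> L * norm x" for x
    using component_le_norm_cart[of x k] mult_right_mono[OF L1, of "norm x"] by simp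
  have [measurable]: "p \<in> borel_measurable borel" unfolding p_def[abs_def] by measurable
  \<comment> \<open>The exponent of the plane wave at the point \<theta> of the complex curve;
    \<open>p x\<close> is the product of x' with the unit vector \<xi>'/|\<xi>'|, and r = sqrt
    \<lambda>.\<close>
  define w where "w x \<theta> = \<i> * r * (cos \<theta> * p x - sin \<theta> * (x $ k))" for x and \<theta> :: complex
  define w' where "w' x \<theta> = \<i> * r * (- sin \<theta> * p x - cos \<theta> * (x $ k))" for x and \<theta> :: complex
  have cs: "norm (cos \<theta>) \<le> exp \<rho>" "norm (sin \<theta>) \<le> exp \<rho>" if "norm \<theta> \<le> \<rho>" for \<theta> :: complex and \<rho>
  proof -
    have "norm (\<i> * \<theta>) \<le> \<rho>" "norm (- (\<i> * \<theta>)) \<le> \<rho>" using that by (auto simp: norm_mult)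
    then have e: "norm (exp (\<i> * \<theta>)) \<le> exp \<rho>" "norm (exp (- (\<i> * \<theta>))) \<le> exp \<rho>"
      by (intro order_trans[OF norm_exp]; simp)+
    have "norm (exp (\<i> * \<theta>) + exp (- (\<i> * \<theta>))) \<le> exp \<rho> + exp \<rho>"
      by (rule order_trans[OF norm_triangle_ineq add_mono[OF e]])
    then show "norm (cos \<theta>) \<le> exp \<rho>" unfolding cos_exp_eq by (simp add: norm_divide)
    have "norm (exp (\<i> * \<theta>) - exp (- (\<i> * \<theta>))) \<le> exp \<rho> + exp \<rho>"
      by (rule order_trans[OF norm_triangle_ineq4 add_mono[OF e]])
    then show "norm (sin \<theta>) \<le> exp \<rho>" unfolding sin_exp_eq by (simp add: norm_divide norm_mult)
  qed
  have lin: "norm (\<i> * r * (z1 * p x - z2 * (x $ k))) \<le> 2 * r * exp \<rho> * L * norm x"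
    if "norm z1 \<le> exp \<rho>" "norm z2 \<le> exp \<rho>" for z1 z2 :: complex and x \<rho>
  proof -
    have "norm (z1 * p x - z2 * (x $ k)) \<le> norm z1 * \<bar>p x\<bar> + norm z2 * \<bar>x $ k\<bar>"
      by (rule order_trans[OF norm_triangle_ineq4]) (simp add: norm_mult)
    also have "\<dots> \<le> exp \<rho> * (L * norm x) + exp \<rho> * (L * norm x)"
      by (intro add_mono mult_mono that p_le k_le) auto
    finally show ?thesis
      using r0(1) by (simp add: norm_mult) (simp add: mult_left_mono mult_ac flip: mult_2)
  qed
  have w_le: "norm (w x \<theta>) \<le> 2 * r * exp \<rho> * L * norm x" and w'_le: "norm (w' x \<theta>) \<le> 2 * r * exp \<rho> * L * norm x"
    if "norm \<theta> \<le> \<rho>" for x \<theta> \<rho>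
    unfolding w_def w'_def by (rule lin; use cs[OF that] in simp)+
  have w_exp: "norm (exp (w x \<theta>)) \<le> exp (2 * r * exp \<rho> * L * norm x)" if "norm \<theta> \<le> \<rho>" for x \<theta> \<rho>
    by (rule order_trans[OF norm_exp]) (use w_le[OF that] in simp)
  define G where "G \<theta> = (LINT x|lborel. f x * exp (w x \<theta>))" for \<theta>
  have wm [measurable]: "(\<lambda>x. w x \<theta>) \<in> borel_measurable borel" "(\<lambda>x. w' x \<theta>) \<in> borel_measurable borel" for \<theta>
    unfolding w_def w'_def by measurable
  have "G holomorphic_on UNIV"
    unfolding G_def[abs_def]
  proof (rule holomorphic_on_integral)
    show "((\<lambda>\<theta>. f x * exp (w x \<theta>)) has_field_derivative f x * (w' x \<theta> * exp (w x \<theta>))) (at \<theta>)" for x \<theta>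
      unfolding w_def w'_def by (auto intro!: derivative_eq_intros simp: algebra_simps)
    show "integrable lborel (\<lambda>x. f x * exp (w x \<theta>))" for \<theta>
    proof (rule Bochner_Integration.integrable_bound[OF f_int])
      show "AE x in lborel. norm (f x * exp (w x \<theta>)) \<le> norm (norm (f x) * exp (2 * r * exp (norm \<theta>) * L * norm x))"
        using w_exp[of \<theta> "norm \<theta>"] by (intro AE_I2) (simp add: norm_mult mult_left_mono)
    qed measurable
    show "(\<lambda>x. f x * (w' x \<theta> * exp (w x \<theta>))) \<in> borel_measurable lborel" for \<theta> by measurable
    fix \<rho> :: real
    \<comment> \<open>The factor \<open>w'\<close> is absorbed by y <= exp y, which doubles the
      exponential rate; \<open>f_int\<close> is available at every rate.\<close>
    define c where "c = 2 * r * exp \<rho> * L"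
    have b: "norm (f x * (w' x \<theta> * exp (w x \<theta>))) \<le> norm (f x) * exp ((c + c) * norm x)" if "norm \<theta> \<le> \<rho>" for x \<theta>
    proof -
      have "norm (w' x \<theta>) \<le> exp (c * norm x)"
        using w'_le[OF that, of x] exp_ge_add_one_self[of "c * norm x"] unfolding c_def by linarith
      then have "norm (w' x \<theta>) * norm (exp (w x \<theta>)) \<le> exp (c * norm x) * exp (c * norm x)"
        using w_exp[OF that, of x] by (intro mult_mono) (auto simp: c_def)
      then have "norm (f x) * (norm (w' x \<theta>) * norm (exp (w x \<theta>))) \<le> norm (f x) * (exp (c * norm x) * exp (c * norm x))"
        by (rule mult_left_mono) simp
      then show ?thesis
        by (simp only: norm_mult exp_add distrib_right)
    qed
    show "\<exists>W. integrable lborel W \<and> (\<forall>x \<theta>. norm \<theta> \<le> \<rho> \<longrightarrow> norm (f x * (w' x \<theta> * exp (w x \<theta>))) \<le> W x)"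
      by (rule exI[of _ "\<lambda>x. norm (f x) * exp ((c + c) * norm x)"]) (use b f_int in auto)
  qed
  moreover have zero: "G \<theta> = 0" if \<theta>: "\<theta> \<in> complex_of_real ` {0<..<pi}" for \<theta>
  proof -
    obtain t where t: "\<theta> = complex_of_real t" "0 < t" "t < pi" using \<theta> by auto
    \<comment> \<open>The real frequency belonging to the angle t. Since sin t > 0 on the open
      interval, the root of \<lambda> - |\<eta>'|^2 is r sin t without a sign ambiguity, so G is
      \<open>F_sphere\<close> there.\<close>
    define \<eta> where "\<eta> = (r * cos t / sqrt q) *\<^sub>R \<xi>"
    have s0: "sin t > 0" using t sin_gt_zero by blast
    have qe: "qform k \<eta> = lam * (cos t)\<^sup>2"
      using q0 r0 by (simp add: \<eta>_def qform_scale q_def[symmetric] power_divide power_mult_distrib power2_eq_square[of r])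
    have "lam - qform k \<eta> = lam * (sin t)\<^sup>2"
      unfolding qe sin_squared_eq by (simp add: algebra_simps)
    then have sq: "sqrt (lam - qform k \<eta>) = r * sin t"
      using s0 by (simp add: real_sqrt_mult r_def)
    have "lam * (sin t)\<^sup>2 > 0" using s0 lam_pos by simp
    then have "qform k \<eta> < lam" using \<open>lam - qform k \<eta> = lam * (sin t)\<^sup>2\<close> by linarith
    then have "F_sphere \<eta> = 0" by (rule F_sphere_eq_0)
    moreover have "iexp (phase k \<eta> x) * iexp (- sqrt (lam - qform k \<eta>) * x $ k) = exp (w x \<theta>)" for x
      unfolding sq exp_add[symmetric] w_def t(1)
      by (rule arg_cong[where f = exp])
         (simp add: \<eta>_def phase_scale p_def cos_of_real sin_of_real algebra_simps)
    ultimately show ?thesis by (simp add: F_sphere_def G_def)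
  qed
  \<comment> \<open>The identity theorem needs an accumulation point of the zeros; 1 is just some
    point of the open interval from 0 to pi.\<close>
  moreover have "(complex_of_real 1) islimpt (complex_of_real ` {0<..<pi})"
  proof -
    have "(1::real) islimpt {0<..<pi}"
      using pi_gt3 by (intro interior_limit_point) (simp add: interior_open)
    then show ?thesis unfolding islimpt_sequential
    proof (elim exE conjE)
      fix X :: "nat \<Rightarrow> real" assume "\<forall>n. X n \<in> {0<..<pi} - {1}" "X \<longlonglongrightarrow> 1"
      then show "\<exists>f. (\<forall>n. f n \<in> complex_of_real ` {0<..<pi} - {complex_of_real 1}) \<and> f \<longlonglongrightarrow> complex_of_real 1"
        using tendsto_of_real[of X 1 sequentially, where 'a = complex]
        by (intro exI[of _ "\<lambda>n. complex_of_real (X n)"]) auto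
    qed
  qed
  ultimately have G0: "G \<theta> = 0" for \<theta>
    using analytic_continuation[of G UNIV "complex_of_real ` {0<..<pi}" "complex_of_real 1" \<theta>] by auto
  \<comment> \<open>The tangential frequency is \<xi>' when r cos \<theta> = |\<xi>'|, so cos
    \<theta> has to be X > 1. Hence \<theta> is imaginary of modulus arcosh X = ln (X + S).\<close>
  define X where "X = sqrt q / r"
  define S where "S = sqrt (X\<^sup>2 - 1)"
  have X2: "X\<^sup>2 = q / lam" using q0 r0 by (simp add: X_def power_divide power2_eq_square[of r])
  have X1: "X\<^sup>2 - 1 > 0" "X > 0" using X2 q0 lam_pos r0 by (auto simp: X_def)
  have S2: "S * S = X\<^sup>2 - 1" "S > 0" using X1 by (auto simp: S_def)
  have XS: "(X + S) * (X - S) = 1" using S2 by (simp add: algebra_simps power2_eq_square)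
  define y where "y = ln (X + S)"
  have ey: "exp y = X + S" using X1 S2 by (simp add: y_def)
  have ey': "exp (- y) = X - S" using XS X1 S2 by (simp add: exp_minus ey field_simps)
  \<comment> \<open>The sign of the imaginary part decides between growth and decay: here sin
    \<theta> = -i S, which gives the exponent - r S \<open>x $ k\<close>.\<close>
  let ?\<theta> = "- \<i> * complex_of_real y"
  have "\<i> * ?\<theta> = complex_of_real y" "- (\<i> * ?\<theta>) = complex_of_real (- y)" by simp_all
  then have e: "exp (\<i> * ?\<theta>) = complex_of_real (X + S)" "exp (- (\<i> * ?\<theta>)) = complex_of_real (X - S)"
    using ey ey' by (simp_all only: exp_of_real)
  have c: "cos ?\<theta> = complex_of_real X"
    unfolding cos_exp_eq e by simp
  have s: "sin ?\<theta> = - \<i> * complex_of_real S"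
    unfolding sin_exp_eq e by (simp add: complex_eq_iff)
  have rS: "r * S = sqrt (q - lam)"
  proof -
    have "r * S = sqrt (lam * (X\<^sup>2 - 1))" by (simp add: r_def S_def real_sqrt_mult)
    also have "lam * (X\<^sup>2 - 1) = q - lam" unfolding X2 using lam_pos by (simp add: field_simps)
    finally show ?thesis .
  qed
  have "w x ?\<theta> = \<i> * complex_of_real (phase k \<xi> x) + complex_of_real (- sqrt (qform k \<xi> - lam) * x $ k)" for x
  proof -
    have "w x ?\<theta> = \<i> * complex_of_real (r * X * p x) + complex_of_real (- (r * S) * x $ k)"
      unfolding w_def c s by (simp add: algebra_simps complex_eq_iff)
    also have "r * X * p x = phase k \<xi> x" using r0 q0 by (simp add: X_def p_def)
    finally show ?thesis unfolding rS q_def .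
  qed
  then have "exp (w x ?\<theta>) = iexp (phase k \<xi> x) * complex_of_real (exp (- sqrt (qform k \<xi> - lam) * x $ k))" for x
    by (simp only: exp_add exp_of_real)
  with G0[of ?\<theta>] show ?thesis by (simp add: G_def)
qed

end

subsection \<open>Solutions supported in the half-space\<close>

lemma primitive_has_vector_derivative:
  fixes g :: "real \<Rightarrow> complex"
  assumes cont: "continuous_on UNIV g" and int: "integrable lborel g"
  shows "((\<lambda>t. LINT s|lborel. (if s < t then g s else 0)) has_vector_derivative g t) (at t)"
    and "((\<lambda>t. LINT s|lborel. (if s < t then 0 else g s)) has_vector_derivative - g t) (at t)"
proof -
  let ?P = "\<lambda>t. LINT s|lborel. (if s < t then g s else 0)"
  have ind: "(if s < t then g s else 0) = indicator {..<t} s *\<^sub>R g s" for s t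
    by (simp add: indicator_def)
  have i1: "integrable lborel (\<lambda>s. if s < t then g s else 0)" for t
    unfolding ind by (rule integrable_mult_indicator[OF _ int]) simp
  let ?c = "t - 1"
  have eq: "?P x = ?P ?c + integral {?c..x} g" if "x \<in> {?c<..<t + 1}" for x
  proof -
    have si: "set_integrable lborel {?c..<x} g"
      unfolding set_integrable_def by (rule integrable_mult_indicator[OF _ int]) simp
    have "?P x = (LINT s|lborel. (if s < ?c then g s else 0) + indicator {?c..<x} s *\<^sub>R g s)"
      by (intro Bochner_Integration.integral_cong refl) (use that in \<open>auto simp: indicator_def\<close>)
    also have "\<dots> = ?P ?c + (LINT s:{?c..<x}|lborel. g s)"
      unfolding set_lebesgue_integral_def
      by (intro Bochner_Integration.integral_add i1) (use si in \<open>simp add: set_integrable_def\<close>)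
    also have "(LINT s:{?c..<x}|lborel. g s) = integral {?c..<x} g"
      by (rule set_borel_integral_eq_integral(2)[OF si])
    also have "\<dots> = integral {?c..x} g"
      by (rule integral_subset_negligible) (auto intro: negligible_subset[of "{x}"])
    finally show ?thesis .
  qed
  have "((\<lambda>x. integral {?c..x} g) has_vector_derivative g t) (at t within {?c..t + 1})"
    by (rule integral_has_vector_derivative) (auto intro: continuous_on_subset[OF cont])
  then have "((\<lambda>x. integral {?c..x} g) has_vector_derivative g t) (at t within {?c<..<t + 1})"
    by (rule has_vector_derivative_within_subset) auto
  then have "((\<lambda>x. integral {?c..x} g) has_vector_derivative g t) (at t)"
    by (subst (asm) has_vector_derivative_within_open) auto
  then have "((\<lambda>x. ?P ?c + integral {?c..x} g) has_vector_derivative 0 + g t) (at t)"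
    by (intro has_vector_derivative_add has_vector_derivative_const)
  then have "((\<lambda>x. ?P ?c + integral {?c..x} g) has_vector_derivative g t) (at t)" by simp
  then show P: "(?P has_vector_derivative g t) (at t)"
    by (rule has_vector_derivative_transform_within_open[of _ _ _ "{?c<..<t + 1}"]) (auto simp: eq)
  have "(LINT s|lborel. (if s < x then 0 else g s)) = integral\<^sup>L lborel g - ?P x" for x
  proof -
    have "(LINT s|lborel. (if s < x then 0 else g s)) = (LINT s|lborel. g s - (if s < x then g s else 0))"
      by (intro Bochner_Integration.integral_cong refl) auto
    also have "\<dots> = integral\<^sup>L lborel g - ?P x" by (rule Bochner_Integration.integral_diff[OF int i1])
    finally show ?thesis .
  qed
  moreover have "((\<lambda>x. integral\<^sup>L lborel g - ?P x) has_vector_derivative 0 - g t) (at t)"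
    by (intro has_vector_derivative_diff has_vector_derivative_const P)
  ultimately show "((\<lambda>t. LINT s|lborel. (if s < t then 0 else g s)) has_vector_derivative - g t) (at t)"
    by simp
qed

lemma integrable_of_bounded_support:
  fixes g :: "real \<Rightarrow> complex"
  assumes "continuous_on UNIV g" "\<And>t. \<bar>t\<bar> \<ge> T \<Longrightarrow> g t = 0"
  shows "integrable lborel g"
proof -
  have "set_integrable lborel {-T..T} g"
    by (rule borel_integrable_atLeastAtMost') (rule continuous_on_subset[OF assms(1)], simp)
  then have "integrable lborel (\<lambda>t. indicator {-T..T} t *\<^sub>R g t)" by (simp add: set_integrable_def)
  also have "(\<lambda>t. indicator {-T..T} t *\<^sub>R g t) = g"
    using assms(2) by (force simp: fun_eq_iff indicator_def)
  finally show ?thesis .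
qed

text \<open>The two Duhamel integrals for a first-order equation with source \<sigma>:
  \<open>conv_past\<close> solves y' = \<mu> y + \<sigma> and vanishes before the source,
  \<open>conv_future\<close> below solves y' = \<mu> y - \<sigma> and vanishes after it.\<close>

definition conv_past :: "(real \<Rightarrow> complex) \<Rightarrow> complex \<Rightarrow> real \<Rightarrow> complex" where
  "conv_past \<sigma> \<mu> t = (LINT s|lborel. (if s < t then exp (\<mu> * of_real (t - s)) * \<sigma> s else 0))"

definition conv_future :: "(real \<Rightarrow> complex) \<Rightarrow> complex \<Rightarrow> real \<Rightarrow> complex" where
  "conv_future \<sigma> \<mu> t = (LINT s|lborel. (if s < t then 0 else exp (\<mu> * of_real (t - s)) * \<sigma> s))"

lemma
  shows conv_past_eq: "conv_past \<sigma> \<mu> t = exp (\<mu> * of_real t) * (LINT s|lborel. (if s < t then exp (- \<mu> * of_real s) * \<sigma> s else 0))"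
    and conv_future_eq: "conv_future \<sigma> \<mu> t = exp (\<mu> * of_real t) * (LINT s|lborel. (if s < t then 0 else exp (- \<mu> * of_real s) * \<sigma> s))"
  unfolding conv_past_def conv_future_def integral_mult_right_zero[symmetric]
  by (intro Bochner_Integration.integral_cong refl; simp add: exp_add[symmetric] algebra_simps flip: mult.assoc)+

context
  fixes \<sigma> :: "real \<Rightarrow> complex" and T :: real
  assumes cont: "continuous_on UNIV \<sigma>" and supp: "\<And>t. \<bar>t\<bar> \<ge> T \<Longrightarrow> \<sigma> t = 0"
begin

lemma conv_derivatives:
  shows "(conv_past \<sigma> \<mu> has_vector_derivative \<mu> * conv_past \<sigma> \<mu> t + \<sigma> t) (at t)"
    and "(conv_future \<sigma> \<mu> has_vector_derivative \<mu> * conv_future \<sigma> \<mu> t - \<sigma> t) (at t)"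
proof -
  let ?g = "\<lambda>s. exp (- \<mu> * of_real s) * \<sigma> s"
  have c: "continuous_on UNIV ?g" by (intro continuous_intros cont)
  have i: "integrable lborel ?g" by (rule integrable_of_bounded_support[where T = T, OF c]) (simp add: supp)
  have e: "((\<lambda>t. exp (\<mu> * of_real t)) has_vector_derivative \<mu> * exp (\<mu> * of_real t)) (at t)"
    using smooth_vd(2)[OF smooth_exp, of \<mu> t] unfolding vd_exp .
  have ee: "exp (\<mu> * of_real t) * ?g t = \<sigma> t"
    by (simp add: exp_minus)
  have "((\<lambda>t. exp (\<mu> * of_real t) * (LINT s|lborel. (if s < t then ?g s else 0))) has_vector_derivative
      exp (\<mu> * of_real t) * ?g t + \<mu> * exp (\<mu> * of_real t) * (LINT s|lborel. (if s < t then ?g s else 0))) (at t)"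
    by (intro has_vector_derivative_mult e primitive_has_vector_derivative(1)[OF c i])
  then show "(conv_past \<sigma> \<mu> has_vector_derivative \<mu> * conv_past \<sigma> \<mu> t + \<sigma> t) (at t)"
    unfolding ee conv_past_eq[abs_def] by (simp add: add.commute mult.assoc)
  have "((\<lambda>t. exp (\<mu> * of_real t) * (LINT s|lborel. (if s < t then 0 else ?g s))) has_vector_derivative
      exp (\<mu> * of_real t) * - ?g t + \<mu> * exp (\<mu> * of_real t) * (LINT s|lborel. (if s < t then 0 else ?g s))) (at t)"
    by (intro has_vector_derivative_mult e primitive_has_vector_derivative(2)[OF c i])
  then show "(conv_future \<sigma> \<mu> has_vector_derivative \<mu> * conv_future \<sigma> \<mu> t - \<sigma> t) (at t)"
    unfolding mult_minus_right ee conv_future_eq[abs_def] by (simp add: mult.assoc)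
qed

text \<open>On the side seen by each kernel the exponential has modulus at most 1, so the bound does
  not depend on \<mu>. This is the uniformity in the frequency required of amplitudes.\<close>

lemma conv_bounds:
  shows "Re \<mu> \<le> 0 \<Longrightarrow> norm (conv_past \<sigma> \<mu> t) \<le> (LINT s|lborel. norm (\<sigma> s))"
    and "Re \<mu> \<ge> 0 \<Longrightarrow> norm (conv_future \<sigma> \<mu> t) \<le> (LINT s|lborel. norm (\<sigma> s))"
proof -
  have i: "integrable lborel (\<lambda>s. norm (\<sigma> s))"
    by (intro integrable_norm integrable_of_bounded_support[where T = T, OF cont supp])
  show "norm (conv_past \<sigma> \<mu> t) \<le> (LINT s|lborel. norm (\<sigma> s))" if "Re \<mu> \<le> 0"
    unfolding conv_past_def
    by (rule norm_lebesgue_integral_le[OF i])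
       (use that in \<open>auto simp: norm_mult mult_nonpos_nonneg intro!: mult_left_le_one_le\<close>)
  show "norm (conv_future \<sigma> \<mu> t) \<le> (LINT s|lborel. norm (\<sigma> s))" if "Re \<mu> \<ge> 0"
    unfolding conv_future_def
    by (rule norm_lebesgue_integral_le[OF i])
       (use that in \<open>auto simp: norm_mult mult_nonneg_nonpos intro!: mult_left_le_one_le\<close>)
qed

lemma conv_measurable:
  assumes [measurable]: "m \<in> borel_measurable M" "h \<in> borel_measurable M"
  shows "(\<lambda>p. conv_past \<sigma> (m p) (h p)) \<in> borel_measurable M"
    and "(\<lambda>p. conv_future \<sigma> (m p) (h p)) \<in> borel_measurable M"
proof -
  have [measurable]: "\<sigma> \<in> borel_measurable borel" by (rule borel_measurable_continuous_onI[OF cont])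
  show "(\<lambda>p. conv_past \<sigma> (m p) (h p)) \<in> borel_measurable M"
    "(\<lambda>p. conv_future \<sigma> (m p) (h p)) \<in> borel_measurable M"
    unfolding conv_past_def conv_future_def by measurable
qed

end

text \<open>The solution \<open>H\<close> of \<open>H'' + (\<lambda> - |\<xi>'|\<^sup>2) H = \<sigma>'\<close> which vanishes to the right of the support of
  \<open>\<sigma>\<close> at propagating frequencies and is the decaying one at evanescent frequencies. Having
  \<open>\<sigma>'\<close> rather than \<open>\<sigma>\<close> on the right-hand side keeps it bounded uniformly in \<open>\<xi>\<close>, also near
  \<open>|\<xi>'|\<^sup>2 = \<lambda>\<close>.\<close>

definition halfsol :: "(real \<Rightarrow> complex) \<Rightarrow> real \<Rightarrow> real \<Rightarrow> complex" where
  "halfsol \<sigma> d t = (if d \<le> 0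
     then (- 1 / 2) * (conv_future \<sigma> (\<i> * sqrt (- d)) t + conv_future \<sigma> (- \<i> * sqrt (- d)) t)
     else (conv_past \<sigma> (- of_real (sqrt d)) t - conv_future \<sigma> (of_real (sqrt d)) t) / 2)"

text \<open>The derivative of \<open>halfsol\<close>. The isolated \<sigma> is the sum of the two
  halves that the one-sided integrals contribute through their moving endpoint.\<close>

definition halfsol' :: "(real \<Rightarrow> complex) \<Rightarrow> real \<Rightarrow> real \<Rightarrow> complex" where
  "halfsol' \<sigma> d t = \<sigma> t + (if d \<le> 0
     then - (\<i> * sqrt (- d)) * (conv_future \<sigma> (\<i> * sqrt (- d)) t - conv_future \<sigma> (- \<i> * sqrt (- d)) t) / 2
     else - of_real (sqrt d) * (conv_past \<sigma> (- of_real (sqrt d)) t + conv_future \<sigma> (of_real (sqrt d)) t) / 2)"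

context
  fixes \<sigma> :: "real \<Rightarrow> complex" and T :: real
  assumes smooth: "smooth \<sigma>" and supp: "\<And>t. \<bar>t\<bar> \<ge> T \<Longrightarrow> \<sigma> t = 0"
begin

lemma smooth_cont: "continuous_on UNIV \<sigma>" by (rule smooth_continuous[OF smooth])

lemma halfsol_derivative: "(halfsol \<sigma> d has_vector_derivative halfsol' \<sigma> d t) (at t)"
proof (cases "d \<le> 0")
  case True
  let ?m = "\<i> * complex_of_real (sqrt (- d))"
  have "((\<lambda>t. (- 1 / 2) * (conv_future \<sigma> ?m t + conv_future \<sigma> (- ?m) t)) has_vector_derivative
     (- 1 / 2) * ((?m * conv_future \<sigma> ?m t - \<sigma> t) + (- ?m * conv_future \<sigma> (- ?m) t - \<sigma> t))) (at t)"
    by (intro has_vector_derivative_mult_right has_vector_derivative_add conv_derivatives(2)[OF smooth_cont supp])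
  moreover have "halfsol \<sigma> d = (\<lambda>t. (- 1 / 2) * (conv_future \<sigma> ?m t + conv_future \<sigma> (- ?m) t))"
    using True by (simp add: halfsol_def fun_eq_iff)
  moreover have "halfsol' \<sigma> d t = (- 1 / 2) * ((?m * conv_future \<sigma> ?m t - \<sigma> t) + (- ?m * conv_future \<sigma> (- ?m) t - \<sigma> t))"
    using True by (simp add: halfsol'_def field_simps)
  ultimately show ?thesis by (simp only:)
next
  case False
  let ?m = "complex_of_real (sqrt d)"
  have "((\<lambda>t. (1 / 2) * (conv_past \<sigma> (- ?m) t - conv_future \<sigma> ?m t)) has_vector_derivative
     (1 / 2) * ((- ?m * conv_past \<sigma> (- ?m) t + \<sigma> t) - (?m * conv_future \<sigma> ?m t - \<sigma> t))) (at t)"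
    by (intro has_vector_derivative_mult_right has_vector_derivative_diff conv_derivatives[OF smooth_cont supp])
  moreover have "halfsol \<sigma> d = (\<lambda>t. (1 / 2) * (conv_past \<sigma> (- ?m) t - conv_future \<sigma> ?m t))"
    using False by (simp add: halfsol_def fun_eq_iff)
  moreover have "halfsol' \<sigma> d t = (1 / 2) * ((- ?m * conv_past \<sigma> (- ?m) t + \<sigma> t) - (?m * conv_future \<sigma> ?m t - \<sigma> t))"
    using False by (simp add: halfsol'_def field_simps)
  ultimately show ?thesis by (simp only:)
qed

text \<open>On the second differentiation the endpoint contributions of the two integrals cancel, so
  the source is the derivative of the isolated \<sigma>, and the squared exponent yields d.\<close>

lemma halfsol'_derivative: "(halfsol' \<sigma> d has_vector_derivative of_real d * halfsol \<sigma> d t + vd \<sigma> t) (at t)"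
proof (cases "d \<le> 0")
  case True
  let ?m = "\<i> * complex_of_real (sqrt (- d))"
  have m2: "?m * ?m = of_real d"
  proof -
    have "?m * ?m = - complex_of_real (sqrt (- d) * sqrt (- d))" by (simp add: complex_eq_iff)
    then show ?thesis using True by simp
  qed
  have "((\<lambda>t. \<sigma> t + (- ?m / 2) * (conv_future \<sigma> ?m t - conv_future \<sigma> (- ?m) t)) has_vector_derivative
     vd \<sigma> t + (- ?m / 2) * ((?m * conv_future \<sigma> ?m t - \<sigma> t) - (- ?m * conv_future \<sigma> (- ?m) t - \<sigma> t))) (at t)"
    by (intro has_vector_derivative_mult_right has_vector_derivative_add has_vector_derivative_diff
        conv_derivatives(2)[OF smooth_cont supp] smooth_vd(2)[OF smooth])
  moreover have "halfsol' \<sigma> d = (\<lambda>t. \<sigma> t + (- ?m / 2) * (conv_future \<sigma> ?m t - conv_future \<sigma> (- ?m) t))"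
    using True by (simp add: halfsol'_def fun_eq_iff)
  moreover have "of_real d * halfsol \<sigma> d t + vd \<sigma> t =
     vd \<sigma> t + (- ?m / 2) * ((?m * conv_future \<sigma> ?m t - \<sigma> t) - (- ?m * conv_future \<sigma> (- ?m) t - \<sigma> t))"
  proof -
    have "(- ?m / 2) * ((?m * conv_future \<sigma> ?m t - \<sigma> t) - (- ?m * conv_future \<sigma> (- ?m) t - \<sigma> t)) =
       - (?m * ?m) * (conv_future \<sigma> ?m t + conv_future \<sigma> (- ?m) t) / 2"
      by (simp add: field_simps)
    then show ?thesis unfolding m2 using True by (simp add: halfsol_def)
  qed
  ultimately show ?thesis by (simp only:)
next
  case False
  let ?m = "complex_of_real (sqrt d)"
  have m2: "?m * ?m = of_real d" using False by (simp flip: of_real_mult)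
  have "((\<lambda>t. \<sigma> t + (- ?m / 2) * (conv_past \<sigma> (- ?m) t + conv_future \<sigma> ?m t)) has_vector_derivative
     vd \<sigma> t + (- ?m / 2) * ((- ?m * conv_past \<sigma> (- ?m) t + \<sigma> t) + (?m * conv_future \<sigma> ?m t - \<sigma> t))) (at t)"
    by (intro has_vector_derivative_mult_right has_vector_derivative_add
        conv_derivatives[OF smooth_cont supp] smooth_vd(2)[OF smooth])
  moreover have "halfsol' \<sigma> d = (\<lambda>t. \<sigma> t + (- ?m / 2) * (conv_past \<sigma> (- ?m) t + conv_future \<sigma> ?m t))"
    using False by (simp add: halfsol'_def fun_eq_iff)
  moreover have "of_real d * halfsol \<sigma> d t + vd \<sigma> t =
     vd \<sigma> t + (- ?m / 2) * ((- ?m * conv_past \<sigma> (- ?m) t + \<sigma> t) + (?m * conv_future \<sigma> ?m t - \<sigma> t))"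
  proof -
    have "(- ?m / 2) * ((- ?m * conv_past \<sigma> (- ?m) t + \<sigma> t) + (?m * conv_future \<sigma> ?m t - \<sigma> t)) =
       (?m * ?m) * (conv_past \<sigma> (- ?m) t - conv_future \<sigma> ?m t) / 2"
      by (simp add: field_simps)
    then show ?thesis unfolding m2 using False by (simp add: halfsol_def)
  qed
  ultimately show ?thesis by (simp only:)
qed

lemma halfsol_bound: "norm (halfsol \<sigma> d t) \<le> (LINT s|lborel. norm (\<sigma> s))"
proof (cases "d \<le> 0")
  case True
  let ?m = "\<i> * complex_of_real (sqrt (- d))"
  have "norm (conv_future \<sigma> ?m t + conv_future \<sigma> (- ?m) t) \<le> (LINT s|lborel. norm (\<sigma> s)) + (LINT s|lborel. norm (\<sigma> s))"
    by (rule order_trans[OF norm_triangle_ineq add_mono[OF conv_bounds(2)[OF smooth_cont supp] conv_bounds(2)[OF smooth_cont supp]]]) auto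
  then show ?thesis using True by (simp add: halfsol_def norm_divide norm_minus_commute)
next
  case False
  let ?m = "complex_of_real (sqrt d)"
  have "norm (conv_past \<sigma> (- ?m) t - conv_future \<sigma> ?m t) \<le> (LINT s|lborel. norm (\<sigma> s)) + (LINT s|lborel. norm (\<sigma> s))"
    using False
    by (intro order_trans[OF norm_triangle_ineq4 add_mono[OF conv_bounds(1)[OF smooth_cont supp] conv_bounds(2)[OF smooth_cont supp]]]) auto
  then show ?thesis using False by (simp add: halfsol_def norm_divide)
qed

lemma halfsol'_bound: "norm (halfsol' \<sigma> d t) \<le> norm (\<sigma> t) + sqrt \<bar>d\<bar> * (LINT s|lborel. norm (\<sigma> s))"
proof -
  let ?S = "LINT s|lborel. norm (\<sigma> s)"
  show ?thesis
  proof (cases "d \<le> 0")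
    case True
    let ?m = "\<i> * complex_of_real (sqrt (- d))"
    have "norm (conv_future \<sigma> ?m t - conv_future \<sigma> (- ?m) t) \<le> ?S + ?S"
      by (rule order_trans[OF norm_triangle_ineq4 add_mono[OF conv_bounds(2)[OF smooth_cont supp] conv_bounds(2)[OF smooth_cont supp]]]) auto
    then have "norm ((- ?m / 2) * (conv_future \<sigma> ?m t - conv_future \<sigma> (- ?m) t)) \<le> (sqrt \<bar>d\<bar> / 2) * (?S + ?S)"
      unfolding norm_mult using True by (intro mult_mono) (auto simp: norm_divide norm_mult)
    then show ?thesis using True norm_triangle_ineq[of "\<sigma> t" "(- ?m / 2) * (conv_future \<sigma> ?m t - conv_future \<sigma> (- ?m) t)"]
      by (simp add: halfsol'_def)
  next
    case False
    let ?m = "complex_of_real (sqrt d)"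
    have "norm (conv_past \<sigma> (- ?m) t + conv_future \<sigma> ?m t) \<le> ?S + ?S"
      using False
      by (intro order_trans[OF norm_triangle_ineq add_mono[OF conv_bounds(1)[OF smooth_cont supp] conv_bounds(2)[OF smooth_cont supp]]]) auto
    then have "norm ((- ?m / 2) * (conv_past \<sigma> (- ?m) t + conv_future \<sigma> ?m t)) \<le> (sqrt \<bar>d\<bar> / 2) * (?S + ?S)"
      unfolding norm_mult using False by (intro mult_mono) (auto simp: norm_divide)
    then show ?thesis using False norm_triangle_ineq[of "\<sigma> t" "(- ?m / 2) * (conv_past \<sigma> (- ?m) t + conv_future \<sigma> ?m t)"]
      by (simp add: halfsol'_def)
  qed
qed

text \<open>Right of the source the future integrals are empty and the past one has seen all of
  \<sigma>. What remains is a pure decaying exponential with a coefficient independent of t,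
  precisely what \<open>F_evanescent_eq_0\<close> annihilates.\<close>

lemma halfsol_right:
  assumes neg: "\<And>s. s \<ge> 0 \<Longrightarrow> \<sigma> s = 0" and "t \<ge> 0"
  shows "halfsol \<sigma> d t = (if d \<le> 0 then 0
     else of_real (exp (- sqrt d * t)) * ((LINT s|lborel. of_real (exp (sqrt d * s)) * \<sigma> s) / 2))"
proof -
  have f: "conv_future \<sigma> \<mu> t = 0" for \<mu>
  proof -
    have "(LINT s|lborel. (if s < t then 0 else exp (\<mu> * of_real (t - s)) * \<sigma> s)) = (LINT s|(lborel::real measure). 0)"
      by (intro Bochner_Integration.integral_cong refl) (use neg \<open>t \<ge> 0\<close> in auto)
    then show ?thesis by (simp add: conv_future_def)
  qed
  have p: "conv_past \<sigma> (- of_real (sqrt d)) t = of_real (exp (- sqrt d * t)) * (LINT s|lborel. of_real (exp (sqrt d * s)) * \<sigma> s)"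
  proof -
    have "(LINT s|lborel. (if s < t then exp (- (- complex_of_real (sqrt d)) * of_real s) * \<sigma> s else 0)) = (LINT s|lborel. of_real (exp (sqrt d * s)) * \<sigma> s)"
      by (intro Bochner_Integration.integral_cong refl) (use neg \<open>t \<ge> 0\<close> in \<open>auto simp: exp_of_real of_real_mult[symmetric] simp del: of_real_mult\<close>)
    moreover have "- complex_of_real (sqrt d) * of_real t = complex_of_real (- sqrt d * t)" by simp
    ultimately show ?thesis unfolding conv_past_eq by (simp only: exp_of_real)
  qed
  show ?thesis by (simp add: halfsol_def f p)
qed

end

context helmholtz
begin

text \<open>Duality with A = a times \<open>halfsol\<close> and B = a times the derivative of
  \<sigma>. The pairing with f vanishes for each \<xi> separately, so the density a remains free;
  that freedom is used to localise in x'.\<close>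

lemma strip_identity:
  fixes a :: "real^'n \<Rightarrow> complex"
  assumes \<sigma>: "smooth \<sigma>" "\<And>t. \<bar>t\<bar> \<ge> T \<Longrightarrow> \<sigma> t = 0" "T > 0" "\<And>t. t \<ge> 0 \<Longrightarrow> \<sigma> t = 0"
    and am [measurable]: "a \<in> borel_measurable borel"
    and a: "\<And>\<xi>. norm (a \<xi>) \<le> C * exp (- c * (norm \<xi>)\<^sup>2)" and "c > 0"
    and int: "integrable lborel (\<lambda>x. u x * ((LINT \<xi>|lborel. iexp (phase k \<xi> x) * a \<xi>) * vd \<sigma> (x $ k)))"
  shows "(LINT x|lborel. u x * ((LINT \<xi>|lborel. iexp (phase k \<xi> x) * a \<xi>) * vd \<sigma> (x $ k))) = 0"
proof -
  have cont: "continuous_on UNIV \<sigma>" "continuous_on UNIV (vd \<sigma>)"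
    by (intro smooth_continuous smooth_vd(1) \<sigma>(1))+
  obtain S1 where S1: "S1 \<ge> 0" "\<And>t. norm (\<sigma> t) \<le> S1"
    using bounded_of_compact_support[OF cont(1) \<sigma>(2)] by metis
  obtain S2 where S2: "S2 \<ge> 0" "\<And>t. norm (vd \<sigma> t) \<le> S2"
    using bounded_of_compact_support[OF cont(2) vd_eq_0_outside[OF \<sigma>(1,2) _ \<sigma>(3)]] by metis
  define S where "S = (LINT s|lborel. norm (\<sigma> s))"
  have S0: "S \<ge> 0" unfolding S_def by (intro Bochner_Integration.integral_nonneg) simp
  have C0: "C \<ge> 0" using order_trans[OF norm_ge_zero a[of 0]] by simp
  have [measurable]: "\<sigma> \<in> borel_measurable borel" "vd \<sigma> \<in> borel_measurable borel"
    by (intro borel_measurable_continuous_onI cont)+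
  note [measurable (raw)] = conv_measurable[OF cont(1) \<sigma>(2)]
  define A where "A \<xi> t = a \<xi> * halfsol \<sigma> (qform k \<xi> - lam) t" for \<xi> t
  define A1 where "A1 \<xi> t = a \<xi> * halfsol' \<sigma> (qform k \<xi> - lam) t" for \<xi> t
  define B where "B \<xi> t = a \<xi> * vd \<sigma> t" for \<xi> t
  have mA: "(\<lambda>(\<xi>, t). A \<xi> t) \<in> borel_measurable (borel \<Otimes>\<^sub>M borel)"
    unfolding A_def halfsol_def by measurable
  have mA1: "(\<lambda>(\<xi>, t). A1 \<xi> t) \<in> borel_measurable (borel \<Otimes>\<^sub>M borel)"
    unfolding A1_def halfsol'_def by measurable
  have mB: "(\<lambda>(\<xi>, t). B \<xi> t) \<in> borel_measurable (borel \<Otimes>\<^sub>M borel)"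
    unfolding B_def by measurable
  have "norm (A \<xi> t) \<le> (C * S) * exp (- c * (norm \<xi>)\<^sup>2)" for \<xi> t
  proof -
    have "norm (A \<xi> t) \<le> (C * exp (- c * (norm \<xi>)\<^sup>2)) * S"
      unfolding A_def norm_mult S_def using C0 by (intro mult_mono a halfsol_bound[OF \<sigma>(1,2)]) auto
    then show ?thesis by (simp add: mult_ac)
  qed
  with mA \<open>c > 0\<close> have ampA: "amplitude A" unfolding amplitude_def by blast
  have "norm (B \<xi> t) \<le> (C * S2) * exp (- c * (norm \<xi>)\<^sup>2)" for \<xi> t
  proof -
    have "norm (B \<xi> t) \<le> (C * exp (- c * (norm \<xi>)\<^sup>2)) * S2"
      unfolding B_def norm_mult using C0 by (intro mult_mono a S2) auto
    then show ?thesis by (simp add: mult_ac)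
  qed
  with mB \<open>c > 0\<close> have ampB: "amplitude B" unfolding amplitude_def by blast
  \<comment> \<open>From sqrt | |\<xi>'|^2 - \<lambda> | <= |\<xi>| + sqrt \<lambda> <= (1 + sqrt
    \<lambda>) (1 + |\<xi>|), combined with the bound of \<open>halfsol'\<close>.\<close>
  define D where "D = S1 + (1 + sqrt lam) * S"
  have D0: "D \<ge> 0" using S0 S1(1) lam_pos by (simp add: D_def)
  have ampA1: "amplitude A1"
  proof (rule amplitude_of_linear_bound[OF mA1 \<open>c > 0\<close>])
    show "0 \<le> C * D" using C0 D0 by simp
    fix \<xi> :: "real^'n" and t
    have "\<bar>qform k \<xi> - lam\<bar> \<le> (norm \<xi>)\<^sup>2 + lam"
      using qform_le_norm[of k \<xi>] qform_nonneg[of k \<xi>] lam_pos by simp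
    also have "\<dots> \<le> (norm \<xi> + sqrt lam)\<^sup>2" using lam_pos by (simp add: power2_sum)
    finally have "sqrt \<bar>qform k \<xi> - lam\<bar> \<le> norm \<xi> + sqrt lam"
      using lam_pos by (intro real_le_lsqrt) auto
    also have "\<dots> \<le> (1 + sqrt lam) * (1 + norm \<xi>)" using lam_pos by (simp add: algebra_simps)
    finally have "sqrt \<bar>qform k \<xi> - lam\<bar> * S \<le> (1 + sqrt lam) * (1 + norm \<xi>) * S"
      using S0 by (rule mult_right_mono)
    moreover have "norm (\<sigma> t) \<le> S1 * (1 + norm \<xi>)"
      using S1(2)[of t] mult_left_mono[OF _ S1(1), of 1 "1 + norm \<xi>"] by simp
    moreover have "norm (halfsol' \<sigma> (qform k \<xi> - lam) t) \<le> norm (\<sigma> t) + sqrt \<bar>qform k \<xi> - lam\<bar> * S"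
      unfolding S_def by (rule halfsol'_bound[OF \<sigma>(1,2)])
    ultimately have "norm (halfsol' \<sigma> (qform k \<xi> - lam) t) \<le> D * (1 + norm \<xi>)"
      by (simp add: D_def algebra_simps)
    then have "norm (A1 \<xi> t) \<le> (C * exp (- c * (norm \<xi>)\<^sup>2)) * (D * (1 + norm \<xi>))"
      unfolding A1_def norm_mult using C0 by (intro mult_mono a) auto
    then show "norm (A1 \<xi> t) \<le> C * D * (1 + norm \<xi>) * exp (- c * (norm \<xi>)\<^sup>2)"
      by (simp add: mult_ac)
  qed
  have wB: "wave k B x = (LINT \<xi>|lborel. iexp (phase k \<xi> x) * a \<xi>) * vd \<sigma> (x $ k)" for x
    unfolding wave_def B_def integral_mult_left_zero[symmetric]
    by (intro Bochner_Integration.integral_cong refl) (simp add: mult.assoc)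
  have hr: "halfsol \<sigma> d t = (if d \<le> 0 then 0
     else of_real (exp (- sqrt d * t)) * ((LINT s|lborel. of_real (exp (sqrt d * s)) * \<sigma> s) / 2))" if "t \<ge> 0" for d t
    by (rule halfsol_right[OF \<sigma>(1,2,4) that])
  have zero: "(LINT x|lborel. f x * (iexp (phase k \<xi> x) * A \<xi> (x $ k))) = 0" for \<xi>
  proof (cases "qform k \<xi> \<le> lam")
    case True
    have "f x * (iexp (phase k \<xi> x) * A \<xi> (x $ k)) = 0" for x
      using f_lower[of x] hr[of "x $ k" "qform k \<xi> - lam"] True
      by (cases "x $ k < 0") (auto simp: A_def)
    then show ?thesis by (simp only: Bochner_Integration.integral_zero)
  next
    case False
    define d where "d = qform k \<xi> - lam"
    define J where "J = a \<xi> * ((LINT s|lborel. of_real (exp (sqrt d * s)) * \<sigma> s) / 2)"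
    have "f x * (iexp (phase k \<xi> x) * A \<xi> (x $ k)) =
        J * (f x * (iexp (phase k \<xi> x) * complex_of_real (exp (- sqrt d * x $ k))))" for x
      using f_lower[of x] hr[of "x $ k" d] False
      by (cases "x $ k < 0") (auto simp: A_def J_def d_def)
    then show ?thesis
      using F_evanescent_eq_0[of \<xi>] False by (simp only: integral_mult_right_zero d_def not_le mult_zero_right)
  qed
  have "(LINT x|lborel. u x * wave k B x) = - (LINT \<xi>|lborel. LINT x|lborel. f x * (iexp (phase k \<xi> x) * A \<xi> (x $ k)))"
  proof (rule wave_duality[OF _ _ _ ampA ampA1 ampB amplitude_mult_coord[OF ampA]])
    show "(A \<xi> has_vector_derivative A1 \<xi> t) (at t)" for \<xi> t
      unfolding A_def[abs_def] A1_def by (intro has_vector_derivative_mult_right halfsol_derivative[OF \<sigma>(1,2)])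
    show "(A1 \<xi> has_vector_derivative complex_of_real (qform k \<xi> - lam) * A \<xi> t + B \<xi> t) (at t)" for \<xi> t
    proof -
      have "(A1 \<xi> has_vector_derivative a \<xi> * (of_real (qform k \<xi> - lam) * halfsol \<sigma> (qform k \<xi> - lam) t + vd \<sigma> t)) (at t)"
        unfolding A1_def[abs_def] by (intro has_vector_derivative_mult_right halfsol'_derivative[OF \<sigma>(1,2)])
      then show ?thesis by (simp add: A_def B_def algebra_simps)
    qed
    show "smooth (B \<xi>)" for \<xi>
      unfolding B_def[abs_def] by (intro smooth_mult smooth_const smooth_vd(1) \<sigma>(1))
    show "integrable lborel (\<lambda>x. u x * wave k B x)" unfolding wB by (rule int)
  qed
  then show ?thesis unfolding wB zero by simp
qed

end

subsection \<open>Gaussian approximation of boxes\<close>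

text \<open>The indicator of [c, d] convolved with a centred Gaussian of standard deviation
  \<epsilon>. Unlike the indicator itself it has a frequency density with Gaussian decay, and for
  \<epsilon> <= 1 it decays in x fast enough to be integrated against u.\<close>

definition gbox :: "real \<Rightarrow> real \<Rightarrow> real \<Rightarrow> real \<Rightarrow> real" where
  "gbox \<epsilon> c d x = (LINT z|lborel. std_normal_density z * (if c \<le> x - \<epsilon> * z \<and> x - \<epsilon> * z \<le> d then 1 else 0))"

text \<open>The density that reproduces \<open>gbox\<close> as a superposition of exponentials: the
  transform of the interval, damped by the transform of the Gaussian, with the constant 1/(2 pi) of
  Fourier inversion.\<close>

definition gfreq :: "real \<Rightarrow> real \<Rightarrow> real \<Rightarrow> real \<Rightarrow> complex" where
  "gfreq \<epsilon> c d s = (1 / (2 * pi)) * exp (- (\<epsilon> * s)\<^sup>2 / 2) * (LINT y|lborel. iexp (- s * y) * indicator {c..d} y)"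

lemma gfreq_measurable [measurable]: "gfreq \<epsilon> c d \<in> borel_measurable borel"
  unfolding gfreq_def[abs_def] by measurable

lemma gfreq_bound: "norm (gfreq \<epsilon> c d s) \<le> \<bar>d - c\<bar> * exp (- (\<epsilon> * s)\<^sup>2 / 2)"
proof -
  have ii: "integrable lborel (\<lambda>y. indicator {c..d} y :: real)"
    by (intro integrable_real_indicator) (auto simp: emeasure_lborel_Icc_eq)
  have "norm (LINT y|lborel. iexp (- s * y) * indicator {c..d} y) \<le> (LINT y|lborel. indicator {c..d} y)"
    by (rule norm_lebesgue_integral_le[OF ii]) (auto simp: norm_mult indicator_def)
  also have "\<dots> \<le> \<bar>d - c\<bar>" by simp
  finally have *: "norm (LINT y|lborel. iexp (- s * y) * indicator {c..d} y) \<le> \<bar>d - c\<bar>" .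
  have "1 / (2 * pi) \<le> 1" using pi_gt3 by simp
  then have "1 / (2 * pi) * (exp (- (\<epsilon> * s)\<^sup>2 / 2) * norm (LINT y|lborel. iexp (- s * y) * indicator {c..d} y))
      \<le> 1 * (exp (- (\<epsilon> * s)\<^sup>2 / 2) * \<bar>d - c\<bar>)"
    by (intro mult_mono *) auto
  then show ?thesis
    unfolding gfreq_def norm_mult by (simp add: norm_divide mult_ac)
qed

lemma integrable_gauss_scaled:
  assumes "\<epsilon> > 0"
  shows "integrable lborel (\<lambda>s::real. exp (- (\<epsilon> * s)\<^sup>2 / 2))"
proof -
  have "integrable lborel (\<lambda>s::real. exp (- (\<epsilon>\<^sup>2 / 2) * (norm s)\<^sup>2))"
    by (rule integrable_gauss) (use assms in simp)
  then show ?thesis by (simp add: power_mult_distrib)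
qed

lemma integrable_gfreq:
  assumes "\<epsilon> > 0"
  shows "integrable lborel (\<lambda>s. iexp (s * x) * gfreq \<epsilon> c d s)"
proof (rule Bochner_Integration.integrable_bound)
  show "integrable lborel (\<lambda>s. \<bar>d - c\<bar> * exp (- (\<epsilon> * s)\<^sup>2 / 2))"
    by (intro integrable_mult_right integrable_gauss_scaled assms)
  show "AE s in lborel. norm (iexp (s * x) * gfreq \<epsilon> c d s) \<le> norm (\<bar>d - c\<bar> * exp (- (\<epsilon> * s)\<^sup>2 / 2))"
    using gfreq_bound[of \<epsilon> c d] by (intro AE_I2) (simp add: norm_mult)
qed measurable

text \<open>No inversion theorem is invoked: after Fubini the frequency integral is the explicit
  transform of a Gaussian and yields the normal density of width \<epsilon> around x.\<close>

lemma gfreq_fourier: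
  assumes "\<epsilon> > 0"
  shows "(LINT s|lborel. iexp (s * x) * gfreq \<epsilon> c d s) = complex_of_real (gbox \<epsilon> c d x)"
proof -
  let ?F = "\<lambda>s y. iexp ((x - y) * s) * complex_of_real (exp (- (\<epsilon> * s)\<^sup>2 / 2) / (2 * pi)) * indicator {c..d} y"
  have m: "(\<lambda>(s, y). ?F s y) \<in> borel_measurable (borel \<Otimes>\<^sub>M borel)" by measurable
  have g: "integrable lborel (\<lambda>s. exp (- (\<epsilon> * s)\<^sup>2 / 2) / (2 * pi))"
    using integrable_gauss_scaled[OF assms] by simp
  have h: "integrable lborel (\<lambda>y. indicator {c..d} y :: real)" by (intro integrable_real_indicator) (auto simp: emeasure_lborel_Icc_eq)
  have le: "norm (?F s y) \<le> exp (- (\<epsilon> * s)\<^sup>2 / 2) / (2 * pi) * indicator {c..d} y" for s y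
    by (simp add: norm_mult norm_divide indicator_def)
  have "(LINT s|lborel. iexp (s * x) * gfreq \<epsilon> c d s) = (LINT s|lborel. LINT y|lborel. ?F s y)"
  proof (intro Bochner_Integration.integral_cong refl)
    fix s
    have "iexp (s * x) * gfreq \<epsilon> c d s =
       (LINT y|lborel. (iexp (s * x) * ((1 / (2 * pi)) * exp (- (\<epsilon> * s)\<^sup>2 / 2))) * (iexp (- s * y) * indicator {c..d} y))"
      unfolding gfreq_def integral_mult_right_zero by (simp add: mult.assoc)
    also have "\<dots> = (LINT y|lborel. ?F s y)"
    proof (intro Bochner_Integration.integral_cong refl)
      fix y
      have "iexp (s * x) * iexp (- s * y) = iexp ((x - y) * s)"
        by (simp add: exp_add[symmetric] algebra_simps)
      then show "(iexp (s * x) * ((1 / (2 * pi)) * exp (- (\<epsilon> * s)\<^sup>2 / 2))) * (iexp (- s * y) * indicator {c..d} y) = ?F s y"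
        by (simp add: mult_ac del: of_real_mult)
    qed
    finally show "iexp (s * x) * gfreq \<epsilon> c d s = (LINT y|lborel. ?F s y)" .
  qed
  also have "\<dots> = (LINT y|lborel. LINT s|lborel. ?F s y)"
    by (rule fubini_bound(1)[OF m g h le])
  also have "\<dots> = (LINT y|lborel. complex_of_real (1 / (\<epsilon> * sqrt (2 * pi)) * exp (- ((x - y) / \<epsilon>)\<^sup>2 / 2) * indicator {c..d} y))"
  proof (intro Bochner_Integration.integral_cong refl)
    fix y
    have "(LINT s|lborel. ?F s y) = (LINT s|lborel. (indicator {c..d} y / (2 * pi)) * (iexp ((x - y) * s) * complex_of_real (exp (- s\<^sup>2 / (2 * (1 / \<epsilon>)\<^sup>2)))))"
      by (intro Bochner_Integration.integral_cong refl)
         (cases "y \<in> {c..d}"; simp add: power_mult_distrib power_divide mult_ac)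
    also have "\<dots> = (indicator {c..d} y / (2 * pi)) * complex_of_real (1 / \<epsilon> * sqrt (2 * pi) * exp (- (1 / \<epsilon> * (x - y))\<^sup>2 / 2))"
      unfolding integral_mult_right_zero by (subst gauss_fourier) (use assms in auto)
    also have "\<dots> = complex_of_real (indicator {c..d} y / (2 * pi) * (1 / \<epsilon> * sqrt (2 * pi) * exp (- (1 / \<epsilon> * (x - y))\<^sup>2 / 2)))"
      by (cases "y \<in> {c..d}") simp_all
    also have "indicator {c..d} y / (2 * pi) * (1 / \<epsilon> * sqrt (2 * pi) * exp (- (1 / \<epsilon> * (x - y))\<^sup>2 / 2)) =
       (sqrt (2 * pi) / (2 * pi)) * (1 / \<epsilon> * exp (- ((x - y) / \<epsilon>)\<^sup>2 / 2) * indicator {c..d} y)"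
      by (simp add: mult_ac)
    also have "sqrt (2 * pi) / (2 * pi) = 1 / sqrt (2 * pi)"
      using real_sqrt_pow2[of "2 * pi"] by (simp add: field_simps power2_eq_square)
    also have "1 / sqrt (2 * pi) * (1 / \<epsilon> * exp (- ((x - y) / \<epsilon>)\<^sup>2 / 2) * indicator {c..d} y) =
       1 / (\<epsilon> * sqrt (2 * pi)) * exp (- ((x - y) / \<epsilon>)\<^sup>2 / 2) * indicator {c..d} y"
      by simp
    finally show "(LINT s|lborel. ?F s y) = complex_of_real (1 / (\<epsilon> * sqrt (2 * pi)) * exp (- ((x - y) / \<epsilon>)\<^sup>2 / 2) * indicator {c..d} y)" .
  qed
  also have "\<dots> = complex_of_real (LINT y|lborel. 1 / (\<epsilon> * sqrt (2 * pi)) * exp (- ((x - y) / \<epsilon>)\<^sup>2 / 2) * indicator {c..d} y)"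
    by (rule integral_complex_of_real)
  \<comment> \<open>The substitution y = x - \<epsilon> z brings the density back to the standard
    normal one of \<open>gbox_def\<close>.\<close>
  also have "(LINT y|lborel. 1 / (\<epsilon> * sqrt (2 * pi)) * exp (- ((x - y) / \<epsilon>)\<^sup>2 / 2) * indicator {c..d} y) =
     \<bar>- \<epsilon>\<bar> *\<^sub>R (LINT z|lborel. 1 / (\<epsilon> * sqrt (2 * pi)) * exp (- ((x - (x + - \<epsilon> * z)) / \<epsilon>)\<^sup>2 / 2) * indicator {c..d} (x + - \<epsilon> * z))"
    by (rule lborel_integral_real_affine) (use assms in simp)
  also have "\<dots> = (LINT z|lborel. \<bar>- \<epsilon>\<bar> * (1 / (\<epsilon> * sqrt (2 * pi)) * exp (- ((x - (x + - \<epsilon> * z)) / \<epsilon>)\<^sup>2 / 2) * indicator {c..d} (x + - \<epsilon> * z)))"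
    by simp
  also have "\<dots> = gbox \<epsilon> c d x"
    unfolding gbox_def
    by (intro Bochner_Integration.integral_cong refl) (use assms in \<open>auto simp: std_normal_density_def indicator_def\<close>)
  finally show ?thesis .
qed

lemma gbox_nonneg: "gbox \<epsilon> c d x \<ge> 0"
  unfolding gbox_def by (intro Bochner_Integration.integral_nonneg) (auto simp: normal_density_nonneg)

lemma gbox_measurable [measurable]: "gbox \<epsilon> c d \<in> borel_measurable borel"
  unfolding gbox_def[abs_def] by measurable

text \<open>A majorant uniform in \<epsilon>, for the limit \<epsilon> to 0. If x - \<epsilon> z
  lies in [c, d] then |x| <= M + |z|, so x^2/16 <= M^2/8 + z^2/8, and exp (z^2/8) is still
  integrable against the normal density.\<close>

lemma gbox_bound:
  obtains K where "K \<ge> 0" "\<And>\<epsilon> x. 0 < \<epsilon> \<Longrightarrow> \<epsilon> \<le> 1 \<Longrightarrow> gbox \<epsilon> c d x \<le> K * exp (- x\<^sup>2 / 16)"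
proof -
  define M where "M = max \<bar>c\<bar> \<bar>d\<bar>"
  define I where "I = (LINT z|lborel. std_normal_density z * exp (z\<^sup>2 / 8))"
  \<comment> \<open>The exponent 3/8 is 1/2 - 1/8.\<close>
  have eq: "std_normal_density z * exp (z\<^sup>2 / 8) = (1 / sqrt (2 * pi)) * exp (- (3 / 8) * (norm z)\<^sup>2)" for z
    by (simp add: std_normal_density_def exp_add[symmetric])
  have i: "integrable lborel (\<lambda>z. std_normal_density z * exp (z\<^sup>2 / 8))"
    unfolding eq by (intro integrable_mult_right integrable_gauss) simp
  have le: "gbox \<epsilon> c d x \<le> exp (M\<^sup>2 / 8) * I * exp (- x\<^sup>2 / 16)" if e: "0 < \<epsilon>" "\<epsilon> \<le> 1" for \<epsilon> x
  proof -
    have "norm (gbox \<epsilon> c d x) \<le> (LINT z|lborel. exp (M\<^sup>2 / 8) * exp (- x\<^sup>2 / 16) * (std_normal_density z * exp (z\<^sup>2 / 8)))"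
      unfolding gbox_def
    proof (rule norm_lebesgue_integral_le)
      show "integrable lborel (\<lambda>z. exp (M\<^sup>2 / 8) * exp (- x\<^sup>2 / 16) * (std_normal_density z * exp (z\<^sup>2 / 8)))"
        using i by (rule integrable_mult_right)
      fix z :: real
      show "norm (std_normal_density z * (if c \<le> x - \<epsilon> * z \<and> x - \<epsilon> * z \<le> d then 1 else 0))
         \<le> exp (M\<^sup>2 / 8) * exp (- x\<^sup>2 / 16) * (std_normal_density z * exp (z\<^sup>2 / 8))"
      proof (cases "c \<le> x - \<epsilon> * z \<and> x - \<epsilon> * z \<le> d")
        case True
        have "\<bar>\<epsilon> * z\<bar> \<le> 1 * \<bar>z\<bar>" unfolding abs_mult using e by (intro mult_right_mono) auto
        moreover have "\<bar>x - \<epsilon> * z\<bar> \<le> M" using True by (auto simp: M_def)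
        ultimately have "\<bar>x\<bar> \<le> M + \<bar>z\<bar>" by linarith
        then have "x\<^sup>2 \<le> (M + \<bar>z\<bar>)\<^sup>2" using power_mono[of "\<bar>x\<bar>" "M + \<bar>z\<bar>" 2] by simp
        also have "\<dots> \<le> 2 * M\<^sup>2 + 2 * z\<^sup>2"
          using zero_le_power2[of "M - \<bar>z\<bar>"] by (simp add: power2_sum power2_diff)
        finally have "0 \<le> M\<^sup>2 / 8 + - x\<^sup>2 / 16 + z\<^sup>2 / 8" by simp
        then have "1 \<le> exp (M\<^sup>2 / 8) * exp (- x\<^sup>2 / 16) * exp (z\<^sup>2 / 8)"
          unfolding exp_add[symmetric] by simp
        from mult_left_mono[OF this normal_density_nonneg[of 0 1 z]] True show ?thesis
          by (simp add: normal_density_nonneg mult_ac)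
      next
        case False
        then have "(if c \<le> x - \<epsilon> * z \<and> x - \<epsilon> * z \<le> d then 1 else 0) = (0::real)" by (rule if_not_P)
        then show ?thesis by (simp only: mult_zero_right norm_zero) (simp add: normal_density_nonneg)
      qed
    qed
    then show ?thesis
      unfolding integral_mult_right_zero I_def[symmetric] by (simp add: mult_ac)
  qed
  have "I \<ge> 0" unfolding I_def by (intro Bochner_Integration.integral_nonneg) (simp add: normal_density_nonneg)
  then show ?thesis by (intro that[of "exp (M\<^sup>2 / 8) * I"] le) auto
qed

text \<open>For x off the endpoints, x - \<epsilon> z eventually lies on the same side of c and d as
  x. At an endpoint the normal mass would split, and such points form a null set.\<close>

lemma gbox_tendsto:
  assumes "x \<noteq> c" "x \<noteq> d"
  shows "(\<lambda>m. gbox (1 / real (Suc m)) c d x) \<longlonglongrightarrow> (if c < x \<and> x < d then 1 else 0)"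
proof -
  have i: "integrable lborel std_normal_density" by (rule integrable_normal_density) simp
  have "(\<lambda>m. gbox (1 / real (Suc m)) c d x) \<longlonglongrightarrow> (LINT z|lborel. std_normal_density z * (if c < x \<and> x < d then 1 else 0))"
    unfolding gbox_def
  proof (rule integral_dominated_convergence[OF _ _ i])
    show "AE z in lborel. (\<lambda>m. std_normal_density z * (if c \<le> x - 1 / real (Suc m) * z \<and> x - 1 / real (Suc m) * z \<le> d then 1 else 0))
        \<longlonglongrightarrow> std_normal_density z * (if c < x \<and> x < d then 1 else 0)"
    proof (rule AE_I2)
      fix z :: real
      have "(\<lambda>m. x - 1 / real (Suc m) * z) \<longlonglongrightarrow> x - 0 * z"
        by (intro tendsto_intros LIMSEQ_Suc[OF lim_1_over_n])
      then have l: "(\<lambda>m. x - 1 / real (Suc m) * z) \<longlonglongrightarrow> x" by simp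
      have "\<forall>\<^sub>F m in sequentially. (c \<le> x - 1 / real (Suc m) * z \<and> x - 1 / real (Suc m) * z \<le> d) = (c < x \<and> x < d)"
      proof -
        consider "x < c" | "x > d" | "c < x" "x < d" using assms by linarith
        then show ?thesis
        proof cases
          case 1 show ?thesis using order_tendstoD(2)[OF l 1] by eventually_elim (use 1 in auto)
        next
          case 2 show ?thesis using order_tendstoD(1)[OF l 2] by eventually_elim (use 2 in auto)
        next
          case 3 show ?thesis using order_tendstoD(1)[OF l 3(1)] order_tendstoD(2)[OF l 3(2)]
            by eventually_elim (use 3 in auto)
        qed
      qed
      then have "\<forall>\<^sub>F m in sequentially. std_normal_density z * (if c \<le> x - 1 / real (Suc m) * z \<and> x - 1 / real (Suc m) * z \<le> d then 1 else 0)
          = std_normal_density z * (if c < x \<and> x < d then 1 else 0)"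
        by eventually_elim (simp only:)
      then show "(\<lambda>m. std_normal_density z * (if c \<le> x - 1 / real (Suc m) * z \<and> x - 1 / real (Suc m) * z \<le> d then 1 else 0))
        \<longlonglongrightarrow> std_normal_density z * (if c < x \<and> x < d then 1 else 0)"
        by (rule tendsto_eventually)
    qed
    show "AE z in lborel. norm (std_normal_density z * (if c \<le> x - 1 / real (Suc m) * z \<and> x - 1 / real (Suc m) * z \<le> d then 1 else 0)) \<le> std_normal_density z" for m
      by (intro AE_I2) (auto simp: normal_density_nonneg)
  qed measurable
  also have "(LINT z|lborel. std_normal_density z * (if c < x \<and> x < d then 1 else 0)) = (if c < x \<and> x < d then 1 else 0)"
    using integral_normal_density[of 1 0] by simp
  finally show ?thesis .
qed

lemma AE_lborel_coord_neq: "AE x in lborel. (x::real^'n) $ i \<noteq> a"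
proof -
  have b: "{x::real^'n. x $ i = a} \<in> sets lborel"
    by (simp add: borel_closed closed_Collect_eq continuous_on_component)
  have "negligible {x::real^'n. x $ i = a}" using negligible_standard_hyperplane[of "axis i 1 :: real^'n" a] by (simp add: inner_axis)
  then have "{x::real^'n. x $ i = a} \<in> null_sets lborel"
    using b by (simp add: negligible_iff_null_sets null_sets_completion_iff)
  then have "AE x in lborel. x \<notin> {x::real^'n. x $ i = a}" by (rule AE_not_in)
  then show ?thesis by eventually_elim simp
qed

section \<open>From Gaussian boxes to exact boxes in the tangential variables\<close>

context helmholtz
begin

text \<open>The mean square condition bounds the mass of |u|^2 on balls by a constant times the
  radius, the case of linear growth in \<open>integrable_mult_exp_norm\<close>.\<close>

lemma u_square_exp: "integrable lborel (\<lambda>x. (norm (u x))\<^sup>2 * exp (- c * norm x))" if "c > 0"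
proof -
  let ?U = "\<lambda>R. LINT x:ball 0 R|lborel. (norm (u x))\<^sup>2"
  have mono: "?U R \<le> ?U R'" if "R \<le> R'" for R R'
    unfolding set_lebesgue_integral_def
    by (rule integral_mono)
       (use u_square that in \<open>auto simp: set_integrable_def indicator_def\<close>)
  have U0: "?U R \<ge> 0" for R
    unfolding set_lebesgue_integral_def by (intro Bochner_Integration.integral_nonneg) auto
  have "\<forall>\<^sub>F R in at_top. (1 / R) * ?U R < 1"
    using u_lim by (rule order_tendstoD) simp
  then obtain R0 where R0: "\<And>R. R \<ge> R0 \<Longrightarrow> (1 / R) * ?U R < 1"
    by (auto simp: eventually_at_top_linorder)
  define C where "C = 1 + ?U (max R0 1)"
  have bd: "?U (real N) \<le> C * real N ^ 1" if "N \<ge> 1" for N :: nat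
  proof (cases "real N \<ge> R0")
    case True
    have "?U (real N) \<le> real N" using R0[OF True] that by (simp add: divide_less_eq)
    also have "\<dots> \<le> C * real N" using mult_right_mono[of 1 C "real N"] U0 by (simp add: C_def)
    finally show ?thesis by simp
  next
    case False
    then have "real N \<le> max R0 1" by simp
    from mono[OF this] have "?U (real N) \<le> C" by (simp add: C_def)
    also have "\<dots> \<le> C * real N" using mult_left_mono[of 1 "real N" C] that U0 by (simp add: C_def)
    finally show ?thesis by simp
  qed
  show ?thesis
    by (rule integrable_mult_exp_norm[where C = C and q = 1])
       (use bd u_square U0 \<open>c > 0\<close> in \<open>auto simp: C_def\<close>)
qed

lemma u_gauss: "integrable lborel (\<lambda>x. norm (u x) * exp (- c * (norm x)\<^sup>2))" if "c > 0"
proof (rule Bochner_Integration.integrable_bound)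
  let ?D = "exp (1\<^sup>2 / (4 * c))"
  show "integrable lborel (\<lambda>x. ?D * ((norm (u x))\<^sup>2 * exp (- 1 * norm x) + exp (- 1 * norm x)))"
    by (intro integrable_mult_right Bochner_Integration.integrable_add u_square_exp integrable_exp_norm) auto
  show "AE x in lborel. norm (norm (u x) * exp (- c * (norm x)\<^sup>2)) \<le> norm (?D * ((norm (u x))\<^sup>2 * exp (- 1 * norm x) + exp (- 1 * norm x)))"
  proof (rule AE_I2)
    fix x
    have "2 * norm (u x) \<le> (norm (u x))\<^sup>2 + 1"
      using zero_le_power2[of "norm (u x) - 1"] by (simp add: power2_eq_square algebra_simps)
    then have "norm (u x) \<le> (norm (u x))\<^sup>2 + 1" using norm_ge_zero[of "u x"] by linarith
    then have "norm (u x) * exp (- c * (norm x)\<^sup>2) \<le> ((norm (u x))\<^sup>2 + 1) * (?D * exp (- 1 * norm x))"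
      by (intro mult_mono exp_square_le that) auto
    then show "norm (norm (u x) * exp (- c * (norm x)\<^sup>2)) \<le> norm (?D * ((norm (u x))\<^sup>2 * exp (- 1 * norm x) + exp (- 1 * norm x)))"
      by (simp add: algebra_simps)
  qed
qed measurable

lemma strip_identity_gbox:
  fixes c d :: "real^'n"
  assumes \<sigma>: "smooth \<sigma>" "\<And>t. \<bar>t\<bar> \<ge> T \<Longrightarrow> \<sigma> t = 0" "T > 0" "\<And>t. t \<ge> 0 \<Longrightarrow> \<sigma> t = 0"
    and e: "0 < \<epsilon>" "\<epsilon> \<le> 1"
    and int: "integrable lborel (\<lambda>x. u x * (complex_of_real (\<Prod>i\<in>UNIV - {k}. gbox \<epsilon> (c $ i) (d $ i) (x $ i)) * vd \<sigma> (x $ k)))"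
  shows "(LINT x|lborel. u x * (complex_of_real (\<Prod>i\<in>UNIV - {k}. gbox \<epsilon> (c $ i) (d $ i) (x $ i)) * vd \<sigma> (x $ k))) = 0"
proof -
  \<comment> \<open>The dummy component receives a probability density, so that integrating over it
    contributes the factor 1 and leaves the product of the \<open>gbox\<close> factors.\<close>
  define \<alpha> where "\<alpha> i s = (if i = k then complex_of_real (std_normal_density s) else gfreq \<epsilon> (c $ i) (d $ i) s)" for i s
  define a where "a \<xi> = (\<Prod>i\<in>UNIV. \<alpha> i (\<xi> $ i))" for \<xi> :: "real^'n"
  have [measurable]: "\<alpha> i \<in> borel_measurable borel" for i
    unfolding \<alpha>_def[abs_def] by (cases "i = k") auto
  have am: "a \<in> borel_measurable borel" unfolding a_def[abs_def] by measurable
  define K where "K i = (if i = k then 1 else \<bar>d $ i - c $ i\<bar>)" for i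
  have \<alpha>_le: "norm (\<alpha> i s) \<le> K i * exp (- (\<epsilon>\<^sup>2 / 2) * s\<^sup>2)" for i s
  proof (cases "i = k")
    case True
    \<comment> \<open>Here \<epsilon> <= 1 lets the dummy factor share the decay rate \<epsilon>^2/2
      of the others, as one Gaussian in |\<xi>| is wanted.\<close>
    have "\<epsilon>\<^sup>2 * s\<^sup>2 \<le> 1 * s\<^sup>2" using e by (intro mult_right_mono) (auto simp: power_le_one)
    then have "exp (- s\<^sup>2 / 2) \<le> exp (- (\<epsilon>\<^sup>2 / 2) * s\<^sup>2)" by simp
    moreover have "1 / sqrt (2 * pi) \<le> 1" using pi_gt3 by simp
    ultimately have "1 / sqrt (2 * pi) * exp (- s\<^sup>2 / 2) \<le> 1 * exp (- (\<epsilon>\<^sup>2 / 2) * s\<^sup>2)"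
      by (intro mult_mono) auto
    with True show ?thesis unfolding \<alpha>_def K_def std_normal_density_def by (simp add: norm_divide)
  next
    case False
    with gfreq_bound[of \<epsilon> "c $ i" "d $ i" s] show ?thesis
      by (simp add: \<alpha>_def K_def power_mult_distrib)
  qed
  have ab: "norm (a \<xi>) \<le> (\<Prod>i\<in>UNIV. K i) * exp (- (\<epsilon>\<^sup>2 / 2) * (norm \<xi>)\<^sup>2)" for \<xi>
  proof -
    have "norm (a \<xi>) \<le> (\<Prod>i\<in>UNIV. K i * exp (- (\<epsilon>\<^sup>2 / 2) * (\<xi> $ i)\<^sup>2))"
      unfolding a_def prod_norm[symmetric] by (intro prod_mono conjI norm_ge_zero \<alpha>_le)
    also have "\<dots> = (\<Prod>i\<in>UNIV. K i) * exp (- (\<epsilon>\<^sup>2 / 2) * (norm \<xi>)\<^sup>2)"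
      unfolding prod.distrib norm_power2_vec sum_distrib_left by (simp add: exp_sum)
    finally show ?thesis .
  qed
  have P: "(LINT \<xi>|lborel. iexp (phase k \<xi> x) * a \<xi>) = complex_of_real (\<Prod>i\<in>UNIV - {k}. gbox \<epsilon> (c $ i) (d $ i) (x $ i))" for x
  proof -
    define h where "h i s = (if i = k then complex_of_real (std_normal_density s) else iexp (s * x $ i) * gfreq \<epsilon> (c $ i) (d $ i) s)" for i s
    have hi: "integrable lborel (h i)" for i
      unfolding h_def[abs_def] using integrable_gfreq[OF e(1)] integrable_normal_density[of 1 0]
      by (cases "i = k") (auto intro!: integrable_of_real)
    have hI: "integral\<^sup>L lborel (h i) = (if i = k then 1 else complex_of_real (gbox \<epsilon> (c $ i) (d $ i) (x $ i)))" for i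
      unfolding h_def[abs_def] using gfreq_fourier[OF e(1)] integral_normal_density[of 1 0]
      by (cases "i = k") simp_all
    have "iexp (phase k \<xi> x) * a \<xi> = (\<Prod>i\<in>UNIV. h i (\<xi> $ i))" for \<xi>
    proof -
      have "iexp (phase k \<xi> x) = (\<Prod>i\<in>UNIV - {k}. iexp (\<xi> $ i * x $ i))"
        by (simp add: phase_def exp_sum sum_distrib_left)
      moreover have "a \<xi> = h k (\<xi> $ k) * (\<Prod>i\<in>UNIV - {k}. \<alpha> i (\<xi> $ i))"
        unfolding a_def by (subst prod.remove[of UNIV k]) (auto simp: \<alpha>_def h_def)
      moreover have "(\<Prod>i\<in>UNIV. h i (\<xi> $ i)) = h k (\<xi> $ k) * (\<Prod>i\<in>UNIV - {k}. iexp (\<xi> $ i * x $ i) * \<alpha> i (\<xi> $ i))"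
        by (subst prod.remove[of UNIV k]) (auto simp: \<alpha>_def h_def intro!: prod.cong)
      ultimately show ?thesis by (simp add: prod.distrib)
    qed
    then have "(LINT \<xi>|lborel. iexp (phase k \<xi> x) * a \<xi>) = (\<Prod>i\<in>UNIV. integral\<^sup>L lborel (h i))"
      by (simp only: integral_prod_coords[OF hi])
    also have "\<dots> = (\<Prod>i\<in>UNIV - {k}. complex_of_real (gbox \<epsilon> (c $ i) (d $ i) (x $ i)))"
      unfolding hI by (subst prod.remove[of UNIV k]) (auto intro!: prod.cong)
    finally show ?thesis by simp
  qed
  show ?thesis
    using strip_identity[OF \<sigma> am ab] int e(1) unfolding P by simp
qed

definition side_indicator :: "real^'n \<Rightarrow> real^'n \<Rightarrow> real^'n \<Rightarrow> real" where
  "side_indicator c d x = (\<Prod>i\<in>UNIV - {k}. if c $ i < x $ i \<and> x $ i < d $ i then 1 else 0)"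

text \<open>The limit \<epsilon> to 0 of the Gaussian version. A multiple of exp (-|x|^2/16)
  majorises the smoothed boxes uniformly and is integrable against u by \<open>u_gauss\<close>;
  points with a coordinate at an endpoint are discarded as a null set.\<close>

lemma strip_identity_box:
  assumes \<sigma>: "smooth \<sigma>" "\<And>t. \<bar>t\<bar> \<ge> T \<Longrightarrow> \<sigma> t = 0" "T > 0" "\<And>t. t \<ge> 0 \<Longrightarrow> \<sigma> t = 0"
  shows "(LINT x|lborel. u x * (complex_of_real (side_indicator c d x) * vd \<sigma> (x $ k))) = 0"
proof -
  let ?G = "\<lambda>\<epsilon> x. complex_of_real (\<Prod>i\<in>UNIV - {k}. gbox \<epsilon> (c $ i) (d $ i) (x $ i)) * vd \<sigma> (x $ k)"
  have cont: "continuous_on UNIV (vd \<sigma>)"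
    by (intro smooth_continuous smooth_vd(1) \<sigma>(1))
  have out: "\<And>t. \<bar>t\<bar> \<ge> T \<Longrightarrow> vd \<sigma> t = 0" by (rule vd_eq_0_outside[OF \<sigma>(1,2) _ \<sigma>(3)])
  have [measurable]: "vd \<sigma> \<in> borel_measurable borel" by (intro borel_measurable_continuous_onI cont)
  obtain S where S: "S \<ge> 0" "\<And>t. norm (vd \<sigma> t) \<le> S"
    using bounded_of_compact_support[OF cont out] by metis
  have "\<exists>K\<ge>0. \<forall>\<epsilon> x. 0 < \<epsilon> \<longrightarrow> \<epsilon> \<le> 1 \<longrightarrow> gbox \<epsilon> (c $ i) (d $ i) x \<le> K * exp (- x\<^sup>2 / 16)" for i
    by (rule gbox_bound[of "c $ i" "d $ i"]) auto
  then obtain K where K: "\<And>i. K i \<ge> 0" "\<And>i \<epsilon> x. 0 < \<epsilon> \<Longrightarrow> \<epsilon> \<le> 1 \<Longrightarrow> gbox \<epsilon> (c $ i) (d $ i) x \<le> K i * exp (- x\<^sup>2 / 16)"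
    by metis
  define D where "D = (\<Prod>i\<in>UNIV - {k}. K i) * (S * exp (T\<^sup>2 / 16))"
  have D0: "D \<ge> 0" unfolding D_def using K(1) S by (intro mult_nonneg_nonneg prod_nonneg) auto
  have G_le: "norm (?G \<epsilon> x) \<le> D * exp (- (1 / 16) * (norm x)\<^sup>2)" if "0 < \<epsilon>" "\<epsilon> \<le> 1" for \<epsilon> x
  proof -
    \<comment> \<open>Compact support is traded for Gaussian decay, at the cost of exp (T^2/16), so
      that all coordinates combine into a function of |x|.\<close>
    have v: "norm (vd \<sigma> t) \<le> S * exp (T\<^sup>2 / 16) * exp (- t\<^sup>2 / 16)" for t
    proof (cases "\<bar>t\<bar> \<ge> T")
      case False
      then have "t\<^sup>2 \<le> T\<^sup>2" using power_mono[of "\<bar>t\<bar>" T 2] by simp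
      then have "1 \<le> exp (T\<^sup>2 / 16) * exp (- t\<^sup>2 / 16)" unfolding exp_add[symmetric] by simp
      from mult_mono[OF S(2)[of t] this] S(1) show ?thesis by (simp add: mult.assoc)
    qed (use out S in simp)
    have "norm (?G \<epsilon> x) \<le> (\<Prod>i\<in>UNIV - {k}. K i * exp (- (x $ i)\<^sup>2 / 16)) * (S * exp (T\<^sup>2 / 16) * exp (- (x $ k)\<^sup>2 / 16))"
      unfolding norm_mult norm_of_real
    proof (rule mult_mono[OF _ v])
      show "\<bar>\<Prod>i\<in>UNIV - {k}. gbox \<epsilon> (c $ i) (d $ i) (x $ i)\<bar> \<le> (\<Prod>i\<in>UNIV - {k}. K i * exp (- (x $ i)\<^sup>2 / 16))"
        unfolding abs_prod abs_of_nonneg[OF gbox_nonneg] by (intro prod_mono conjI gbox_nonneg K(2) that)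
    qed (use K(1) in \<open>auto intro!: prod_nonneg\<close>)
    also have "\<dots> = D * (exp (- (x $ k)\<^sup>2 / 16) * (\<Prod>i\<in>UNIV - {k}. exp (- (x $ i)\<^sup>2 / 16)))"
      unfolding prod.distrib D_def by (simp add: mult_ac)
    also have "exp (- (x $ k)\<^sup>2 / 16) * (\<Prod>i\<in>UNIV - {k}. exp (- (x $ i)\<^sup>2 / 16)) = (\<Prod>i\<in>UNIV. exp (- (x $ i)\<^sup>2 / 16))"
      by (simp add: prod.remove[of UNIV k])
    also have "\<dots> = exp (- (1 / 16) * (norm x)\<^sup>2)"
      unfolding norm_power2_vec sum_distrib_left by (simp add: exp_sum)
    finally show ?thesis .
  qed
  have i: "integrable lborel (\<lambda>x. D * (norm (u x) * exp (- (1 / 16) * (norm x)\<^sup>2)))"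
    by (intro integrable_mult_right u_gauss) simp
  have uG: "norm (u x * ?G \<epsilon> x) \<le> D * (norm (u x) * exp (- (1 / 16) * (norm x)\<^sup>2))" if "0 < \<epsilon>" "\<epsilon> \<le> 1" for \<epsilon> x
    using mult_left_mono[OF G_le[OF that, of x] norm_ge_zero[of "u x"]] by (simp only: norm_mult mult_ac)
  have uGi: "integrable lborel (\<lambda>x. u x * ?G \<epsilon> x)" if "0 < \<epsilon>" "\<epsilon> \<le> 1" for \<epsilon>
    by (rule Bochner_Integration.integrable_bound[OF i]) (use order_trans[OF uG[OF that] abs_ge_self] in auto)
  have "(\<lambda>m. LINT x|lborel. u x * ?G (1 / real (Suc m)) x) \<longlonglongrightarrow>
      (LINT x|lborel. u x * (complex_of_real (side_indicator c d x) * vd \<sigma> (x $ k)))"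
  proof (rule integral_dominated_convergence[OF _ _ i])
    have "AE x in lborel. \<forall>i\<in>UNIV. (x::real^'n) $ i \<noteq> c $ i \<and> x $ i \<noteq> d $ i"
      by (rule AE_finite_allI) (auto intro!: AE_conjI AE_lborel_coord_neq)
    then show "AE x in lborel. (\<lambda>m. u x * ?G (1 / real (Suc m)) x) \<longlonglongrightarrow> u x * (complex_of_real (side_indicator c d x) * vd \<sigma> (x $ k))"
    proof eventually_elim
      case (elim x)
      then show ?case unfolding side_indicator_def
        by (intro tendsto_intros gbox_tendsto) auto
    qed
    show "AE x in lborel. norm (u x * ?G (1 / real (Suc m)) x) \<le> D * (norm (u x) * exp (- (1 / 16) * (norm x)\<^sup>2))" for m
      by (intro AE_I2 uG) auto
    show "(\<lambda>x. u x * (complex_of_real (side_indicator c d x) * vd \<sigma> (x $ k))) \<in> borel_measurable lborel"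
      unfolding side_indicator_def by measurable
  qed measurable
  moreover have "(LINT x|lborel. u x * ?G (1 / real (Suc m)) x) = 0" for m
    by (rule strip_identity_gbox[OF \<sigma>]) (use uGi[of "1 / real (Suc m)"] in auto)
  ultimately show ?thesis by (simp add: LIMSEQ_const_iff)
qed

end

subsection \<open>Vanishing in the lower half-space\<close>

text \<open>Dynkin's pi-lambda argument with boxes as intersection-stable generator. The fixed
  bounded box keeps all integrals finite, v being only locally integrable, and settles the
  complement step.\<close>

lemma set_integral_zero_of_boxes:
  fixes v :: "real^'n::finite \<Rightarrow> complex"
  assumes int: "\<And>R. set_integrable lborel (ball 0 R) v"
    and box: "\<And>c d. (LINT x|lborel. indicator (box c d) x *\<^sub>R v x) = 0"
    and A: "A \<in> sets borel"
  shows "(LINT x:A \<inter> box p q|lborel. v x) = 0"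
proof -
  let ?Q = "box p q"
  obtain R where R: "?Q \<subseteq> ball 0 R"
    using bounded_subset_ballD[OF bounded_box] by blast
  have si: "set_integrable lborel (B \<inter> ?Q) v" if "B \<in> sets borel" for B
    by (rule set_integrable_subset[OF int[of R]]) (use that R in auto)
  have gen: "sets borel = sigma_sets UNIV (range (\<lambda>(a, b). box a b :: (real^'n) set))"
    by (subst borel_eq_box) (simp add: sets_measure_of)
  have stable: "Int_stable (range (\<lambda>(a, b). box a b :: (real^'n) set))"
    unfolding Int_stable_def by (auto simp: box_Int_box)
  have "range (\<lambda>(a, b). box a b :: (real^'n) set) \<subseteq> Pow UNIV" by simp
  from stable this A[unfolded gen] show ?thesis
  proof (induction rule: sigma_sets_induct_disjoint)
    case (basic B)
    then obtain a b where B: "B = box a b" by auto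
    have "B \<inter> ?Q \<in> range (\<lambda>(a, b). box a b :: (real^'n) set)"
      using stable basic unfolding Int_stable_def by blast
    then show ?case using box by (auto simp: set_lebesgue_integral_def)
  next
    case empty
    then show ?case by (simp add: set_lebesgue_integral_def)
  next
    case (compl B)
    have B: "B \<in> sets borel" using compl(1) unfolding gen .
    have "(LINT x:(B \<inter> ?Q) \<union> ((UNIV - B) \<inter> ?Q)|lborel. v x) = (LINT x:B \<inter> ?Q|lborel. v x) + (LINT x:(UNIV - B) \<inter> ?Q|lborel. v x)"
      by (rule set_integral_Un) (use si B in auto)
    moreover have "(B \<inter> ?Q) \<union> ((UNIV - B) \<inter> ?Q) = ?Q" by blast
    ultimately show ?case using compl(2) box[of p q] by (simp add: set_lebesgue_integral_def)
  next
    case (union B)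
    have B: "B i \<in> sets borel" for i using union(2) unfolding gen by blast
    have "(LINT x:(\<Union>i. B i \<inter> ?Q)|lborel. v x) = (\<Sum>i. LINT x:B i \<inter> ?Q|lborel. v x)"
    proof (rule lebesgue_integral_countable_add)
      show "B i \<inter> ?Q \<in> sets lborel" for i using B by auto
      show "(B i \<inter> ?Q) \<inter> (B j \<inter> ?Q) = {}" if "i \<noteq> j" for i j
        using union(1) that by (auto simp: disjoint_family_on_def)
      have "(\<Union>i. B i) \<in> sets borel" using B by blast
      then have "set_integrable lborel ((\<Union>i. B i) \<inter> ?Q) v" by (rule si)
      then show "set_integrable lborel (\<Union>i. B i \<inter> ?Q) v" by (simp only: Int_commute Int_UN_distrib UN_extend_simps)
    qed
    moreover have "(\<Union>i. B i \<inter> ?Q) = (\<Union>i. B i) \<inter> ?Q" by blast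
    ultimately show ?case using union(3) by simp
  qed
qed

text \<open>For l one of Re, -Re, Im, -Im the set where l v >= 0 is Borel, so l v has integral zero
  over a set where it is nonnegative and hence vanishes there almost everywhere. The four sets
  together cover everything.\<close>

lemma AE_zero_of_boxes:
  fixes v :: "real^'n::finite \<Rightarrow> complex"
  assumes m [measurable]: "v \<in> borel_measurable borel"
    and int: "\<And>R. set_integrable lborel (ball 0 R) v"
    and box: "\<And>c d. (LINT x|lborel. indicator (box c d) x *\<^sub>R v x) = 0"
  shows "AE x in lborel. v x = 0"
proof -
  have one: "AE x in lborel. x \<in> A \<inter> box p q \<longrightarrow> l (v x) = 0"
    if l: "bounded_linear l" and A: "A \<in> sets borel" and pos: "\<And>x. x \<in> A \<Longrightarrow> l (v x) \<ge> 0"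
    for l :: "complex \<Rightarrow> real" and A p q
  proof -
    obtain R where R: "box p q \<subseteq> ball 0 R"
      using bounded_subset_ballD[OF bounded_box] by blast
    have si: "set_integrable lborel (A \<inter> box p q) v"
      by (rule set_integrable_subset[OF int[of R]]) (use A R in auto)
    have eq: "indicator (A \<inter> box p q) x * l (v x) = l (indicator (A \<inter> box p q) x *\<^sub>R v x)" for x
      using l by (simp add: bounded_linear.linear linear_scale)
    have i: "integrable lborel (\<lambda>x. indicator (A \<inter> box p q) x * l (v x))"
      unfolding eq by (rule integrable_bounded_linear[OF l]) (use si in \<open>simp add: set_integrable_def\<close>)
    have "(LINT x|lborel. indicator (A \<inter> box p q) x * l (v x)) = l (LINT x:A \<inter> box p q|lborel. v x)"
      unfolding eq set_lebesgue_integral_def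
      by (rule integral_bounded_linear[OF l]) (use si in \<open>simp add: set_integrable_def\<close>)
    also have "\<dots> = 0"
      unfolding set_integral_zero_of_boxes[OF int box A] using l by (simp add: bounded_linear.linear linear_0)
    finally have "AE x in lborel. indicator (A \<inter> box p q) x * l (v x) = 0"
      by (subst (asm) integral_nonneg_eq_0_iff_AE[OF i]) (auto simp: indicator_def pos)
    then show ?thesis by eventually_elim (auto simp: indicator_def split: if_splits)
  qed
  have "AE x in lborel. x \<in> box (\<chi> i. - real N) (\<chi> i. real N) \<longrightarrow> v x = 0" for N
  proof -
    let ?p = "\<chi> i. - real N :: real^'n" and ?q = "\<chi> i. real N :: real^'n"
    have "AE x in lborel. x \<in> {x. Re (v x) \<ge> 0} \<inter> box ?p ?q \<longrightarrow> Re (v x) = 0"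
      by (rule one[OF bounded_linear_Re]) auto
    moreover have "AE x in lborel. x \<in> {x. - Re (v x) \<ge> 0} \<inter> box ?p ?q \<longrightarrow> - Re (v x) = 0"
      by (rule one[OF bounded_linear_minus[OF bounded_linear_Re]]) auto
    moreover have "AE x in lborel. x \<in> {x. Im (v x) \<ge> 0} \<inter> box ?p ?q \<longrightarrow> Im (v x) = 0"
      by (rule one[OF bounded_linear_Im]) auto
    moreover have "AE x in lborel. x \<in> {x. - Im (v x) \<ge> 0} \<inter> box ?p ?q \<longrightarrow> - Im (v x) = 0"
      by (rule one[OF bounded_linear_minus[OF bounded_linear_Im]]) auto
    ultimately show ?thesis
      by eventually_elim (auto simp: complex_eq_iff linorder_le_cases)
  qed
  then have "AE x in lborel. \<forall>N. x \<in> box (\<chi> i. - real N) (\<chi> i. real N) \<longrightarrow> v x = 0"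
    by (subst AE_all_countable) (rule allI)
  then show ?thesis
  proof eventually_elim
    case (elim x)
    obtain N where N: "norm x < real N" using reals_Archimedean2 by blast
    have "- real N < x $ i \<and> x $ i < real N" for i
      using component_le_norm_cart[of x i] N by linarith
    then have "x \<in> box (\<chi> i. - real N) (\<chi> i. real N)" by (simp add: mem_box_cart)
    with elim show ?case by blast
  qed
qed

section \<open>Smooth approximations of a strip and their translates\<close>

lemma flatfn_le_1: "flatfn 0 t \<le> 1" and flatfn_nonneg: "flatfn 0 t \<ge> 0"
  by (auto simp: flatfn_def)

lemma flatfn_tendsto: "(\<lambda>m. flatfn 0 (real (Suc m) * t)) \<longlonglongrightarrow> (if t > 0 then 1 else 0)"
proof (cases "t > 0")
  case True
  have "(\<lambda>m. exp (- (1 / real (Suc m)) * (1 / t))) \<longlonglongrightarrow> exp (- 0 * (1 / t))"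
    by (intro tendsto_intros LIMSEQ_Suc[OF lim_1_over_n])
  with True show ?thesis by (simp add: flatfn_def)
qed (simp add: flatfn_def zero_less_mult_iff)

text \<open>Tends to the indicator of the open interval from a to b, as exp (-1/((m+1) s)) tends to
  1 for s > 0. The support stays inside the same interval for all m, so translates by multiples of b
  - a never overlap.\<close>

definition strip_bump :: "real \<Rightarrow> real \<Rightarrow> nat \<Rightarrow> real \<Rightarrow> real" where
  "strip_bump a b m t = flatfn 0 (real (Suc m) * (t - a)) * flatfn 0 (real (Suc m) * (b - t))"

lemma strip_bump_bounds: "0 \<le> strip_bump a b m t" "strip_bump a b m t \<le> 1"
  unfolding strip_bump_def by (auto intro!: mult_le_one flatfn_le_1 flatfn_nonneg mult_nonneg_nonneg)

lemma strip_bump_outside: "t \<le> a \<or> b \<le> t \<Longrightarrow> strip_bump a b m t = 0"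
  by (auto simp: strip_bump_def flatfn_def zero_less_mult_iff)

lemma strip_bump_tendsto: "(\<lambda>m. strip_bump a b m t) \<longlonglongrightarrow> (if a < t \<and> t < b then 1 else 0)"
proof -
  have "(\<lambda>m. strip_bump a b m t) \<longlonglongrightarrow> (if t - a > 0 then 1 else 0) * (if b - t > 0 then 1 else 0)"
    unfolding strip_bump_def by (intro tendsto_mult flatfn_tendsto)
  also have "(if t - a > 0 then 1 else 0) * (if b - t > 0 then 1 else 0) = (if a < t \<and> t < b then 1 else (0::real))"
    by auto
  finally show ?thesis .
qed

lemma smooth_strip_bump: "smooth (\<lambda>t. of_real (strip_bump a b m t))"
proof -
  let ?n = "real (Suc m)"
  have "smooth (\<lambda>t. of_real (flatfn 0 (?n * t + - ?n * a)) * of_real (flatfn 0 (- ?n * t + ?n * b)))"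
    by (intro smooth_mult smooth_affine[OF smooth_flat])
  also have "(\<lambda>t. of_real (flatfn 0 (?n * t + - ?n * a)) * of_real (flatfn 0 (- ?n * t + ?n * b))) = (\<lambda>t. complex_of_real (strip_bump a b m t))"
    by (simp add: strip_bump_def fun_eq_iff algebra_simps)
  finally show ?thesis .
qed

lemma smooth_primitive:
  assumes "smooth g" "\<And>t. (G has_vector_derivative g t) (at t)"
  shows "smooth G"
  unfolding smooth_def
proof
  fix m
  have "Ck (Suc m) G" using assms by (intro Ck_SucI) (auto simp: smooth_def)
  then show "Ck m G" by (rule Ck_Suc_D)
qed

text \<open>Translates by the width of the support are disjointly supported, so at most one summand
  is nonzero at each point.\<close>

lemma sum_shifts_le_1:
  fixes h :: "real \<Rightarrow> real"
  assumes "\<And>t. 0 \<le> h t" "\<And>t. h t \<le> 1" "\<And>t. t \<le> a \<or> b \<le> t \<Longrightarrow> h t = 0"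
  shows "(\<Sum>j<N. h (t + real j * (b - a))) \<le> 1"
proof (cases "\<exists>j<N. h (t + real j * (b - a)) \<noteq> 0")
  case True
  then obtain j where j: "j < N" "h (t + real j * (b - a)) \<noteq> 0" by blast
  have jj: "a < t + real j * (b - a)" "t + real j * (b - a) < b" using assms(3) j(2) by (meson not_le)+
  have "h (t + real i * (b - a)) = 0" if "i \<noteq> j" for i
  proof (cases "i < j")
    case True
    then have "real i + 1 \<le> real j" by linarith
    then have "(real i + 1) * (b - a) \<le> real j * (b - a)" using jj by (intro mult_right_mono) auto
    with jj(2) have "t + real i * (b - a) \<le> a" by (simp add: algebra_simps)
    then show ?thesis using assms(3) by blast
  next
    case False
    with that have "real j + 1 \<le> real i" by linarith
    then have "(real j + 1) * (b - a) \<le> real i * (b - a)" using jj by (intro mult_right_mono) auto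
    with jj(1) have "b \<le> t + real i * (b - a)" by (simp add: algebra_simps)
    then show ?thesis using assms(3) by blast
  qed
  then have "(\<Sum>i<N. h (t + real i * (b - a))) = (\<Sum>i<N. if i = j then h (t + real j * (b - a)) else 0)"
    by (intro sum.cong) auto
  also have "\<dots> \<le> 1" using j(1) assms(2) by simp
  finally show ?thesis .
qed auto

section \<open>Independence of the normal variable and conclusion for Borel representatives\<close>

context helmholtz
begin

lemma u_mult_integrable:
  assumes [measurable]: "w \<in> borel_measurable borel" and "\<And>x. norm (w x) \<le> B" "\<And>x. norm x \<ge> R \<Longrightarrow> w x = 0"
  shows "integrable lborel (\<lambda>x. u x * w x)"
proof (rule Bochner_Integration.integrable_bound)
  show "integrable lborel (\<lambda>x. B *\<^sub>R (indicator (ball 0 R) x *\<^sub>R u x))"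
    using u_loc[of R] by (intro integrable_scaleR_right) (simp add: set_integrable_def)
  show "AE x in lborel. norm (u x * w x) \<le> norm (B *\<^sub>R (indicator (ball 0 R) x *\<^sub>R u x))"
  proof (rule AE_I2)
    fix x
    show "norm (u x * w x) \<le> norm (B *\<^sub>R (indicator (ball 0 R) x *\<^sub>R u x))"
    proof (cases "norm x < R")
      case True
      have "norm (u x) * norm (w x) \<le> norm (u x) * \<bar>B\<bar>"
        using assms(2)[of x] by (intro mult_left_mono) auto
      with True show ?thesis by (simp add: norm_mult mult.commute)
    qed (use assms(3) in simp)
  qed
qed measurable

lemma side_indicator_cases:
  "side_indicator c d x = (if \<forall>i. i \<noteq> k \<longrightarrow> c $ i < x $ i \<and> x $ i < d $ i then 1 else 0)"
proof (cases "\<forall>i. i \<noteq> k \<longrightarrow> c $ i < x $ i \<and> x $ i < d $ i")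
  case False
  then obtain i where "i \<noteq> k" "\<not> (c $ i < x $ i \<and> x $ i < d $ i)" by blast
  then have "side_indicator c d x = 0"
    unfolding side_indicator_def by (intro prod_zero) auto
  with False show ?thesis by simp
qed (simp add: side_indicator_def)

lemma side_indicator_measurable [measurable]: "side_indicator c d \<in> borel_measurable borel"
  unfolding side_indicator_def[abs_def] by measurable

lemma norm_le_of_side:
  assumes "side_indicator c d x \<noteq> 0"
  shows "norm x \<le> (\<Sum>i\<in>UNIV. \<bar>c $ i\<bar> + \<bar>d $ i\<bar>) + \<bar>x $ k\<bar>"
proof -
  have "\<bar>x $ i\<bar> \<le> \<bar>c $ i\<bar> + \<bar>d $ i\<bar>" if "i \<noteq> k" for i
  proof -
    have "c $ i < x $ i \<and> x $ i < d $ i" using assms that by (simp add: side_indicator_cases split: if_splits)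
    then show ?thesis by linarith
  qed
  then have "(\<Sum>i\<in>UNIV - {k}. \<bar>x $ i\<bar>) \<le> (\<Sum>i\<in>UNIV - {k}. \<bar>c $ i\<bar> + \<bar>d $ i\<bar>)"
    by (intro sum_mono) auto
  also have "\<dots> \<le> (\<Sum>i\<in>UNIV. \<bar>c $ i\<bar> + \<bar>d $ i\<bar>)" by (intro sum_mono2) auto
  finally have "(\<Sum>i\<in>UNIV. \<bar>x $ i\<bar>) \<le> (\<Sum>i\<in>UNIV. \<bar>c $ i\<bar> + \<bar>d $ i\<bar>) + \<bar>x $ k\<bar>"
    by (simp add: sum.remove[of UNIV k])
  with norm_le_l1_cart[of x] show ?thesis by linarith
qed

lemma u_side_integrable:
  fixes h :: "real \<Rightarrow> real"
  assumes [measurable]: "h \<in> borel_measurable borel" and "\<And>t. \<bar>h t\<bar> \<le> B" "\<And>t. \<bar>t\<bar> \<ge> R \<Longrightarrow> h t = 0"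
  shows "integrable lborel (\<lambda>x. u x * complex_of_real (side_indicator c d x * h (x $ k)))"
proof (rule u_mult_integrable[where R = "(\<Sum>i\<in>UNIV. \<bar>c $ i\<bar> + \<bar>d $ i\<bar>) + R + 1"])
  show "norm (complex_of_real (side_indicator c d x * h (x $ k))) \<le> B" for x
    using assms(2)[of "x $ k"] by (auto simp: side_indicator_cases)
  show "complex_of_real (side_indicator c d x * h (x $ k)) = 0"
    if "norm x \<ge> (\<Sum>i\<in>UNIV. \<bar>c $ i\<bar> + \<bar>d $ i\<bar>) + R + 1" for x
    using norm_le_of_side[of c d x] assms(3)[of "x $ k"] that by (cases "side_indicator c d x = 0") auto
qed measurable

text \<open>Apply the previous lemma to a primitive \<open>\<sigma>\<close> of the difference of two translates of the bump.\<close>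

lemma strip_shift:
  assumes ab: "a < b" "b \<le> 0" and "L > 0"
  shows "(LINT x|lborel. u x * complex_of_real (side_indicator c d x * strip_bump a b m (x $ k)))
     = (LINT x|lborel. u x * complex_of_real (side_indicator c d x * strip_bump a b m (x $ k + L)))"
proof -
  let ?h = "strip_bump a b m"
  define g where "g t = complex_of_real (?h t) - complex_of_real (?h (t + L))" for t
  define \<sigma> where "\<sigma> t = (LINT s|lborel. (if s < t then g s else 0))" for t
  have sh: "smooth (\<lambda>t. complex_of_real (?h (t + L)))"
    using smooth_affine[OF smooth_strip_bump[of a b m], of 1 L] by simp
  have "smooth (\<lambda>t. complex_of_real (?h t) + (- 1) * complex_of_real (?h (t + L)))"
    by (intro smooth_add smooth_mult smooth_const smooth_strip_bump sh)
  then have g: "smooth g" by (simp add: g_def[abs_def])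
  define T where "T = \<bar>a\<bar> + L + 1"
  have T: "T > 0" using \<open>L > 0\<close> by (simp add: T_def)
  have h_out: "?h t = 0" if "t \<le> a \<or> b \<le> t" for t using that by (rule strip_bump_outside)
  have g_left: "g t = 0" if "t \<le> a - L" for t
    using that \<open>L > 0\<close> h_out[of t] h_out[of "t + L"] by (simp add: g_def)
  have g_right: "g t = 0" if "t \<ge> b" for t
    using that \<open>L > 0\<close> h_out[of t] h_out[of "t + L"] by (simp add: g_def)
  have g_out: "g t = 0" if "\<bar>t\<bar> \<ge> T" for t
    using that g_left[of t] g_right[of t] ab \<open>L > 0\<close> by (cases "t \<ge> 0") (auto simp: T_def)
  have hi: "integrable lborel (\<lambda>t. complex_of_real (?h t))"
    by (rule integrable_of_bounded_support[OF smooth_continuous[OF smooth_strip_bump], of T])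
       (use ab \<open>L > 0\<close> h_out in \<open>auto simp: T_def abs_if split: if_splits\<close>)
  have hi': "integrable lborel (\<lambda>t. complex_of_real (?h (t + L)))"
    using lborel_integrable_real_affine[OF hi, of 1 L] by (simp add: add.commute)
  have gi: "integrable lborel g" unfolding g_def[abs_def] by (intro Bochner_Integration.integrable_diff hi hi')
  \<comment> \<open>By translation invariance g has total integral zero. Its primitive therefore
    returns to zero right of the strip, and so vanishes for t >= 0 as
    \<open>strip_identity_box\<close> requires.\<close>
  have total: "integral\<^sup>L lborel g = 0"
  proof -
    have "(LINT t|lborel. complex_of_real (?h t)) = (LINT t|lborel. complex_of_real (?h (t + L)))"
      using lborel_integral_real_affine[of 1 "\<lambda>t. complex_of_real (?h t)" L] by (simp only: add.commute mult_1 abs_one scaleR_one one_neq_zero not_False_eq_True)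
    then show ?thesis unfolding g_def[abs_def] Bochner_Integration.integral_diff[OF hi hi'] by simp
  qed
  have d\<sigma>: "(\<sigma> has_vector_derivative g t) (at t)" for t
    unfolding \<sigma>_def[abs_def] by (rule primitive_has_vector_derivative(1)[OF smooth_continuous[OF g] gi])
  have s\<sigma>: "smooth \<sigma>" by (rule smooth_primitive[OF g d\<sigma>])
  have \<sigma>_right: "\<sigma> t = 0" if "t \<ge> b" for t
  proof -
    have "(\<lambda>s. if s < t then g s else 0) = g" using g_right that by (auto simp: fun_eq_iff)
    then show ?thesis by (simp add: \<sigma>_def total)
  qed
  have \<sigma>_out: "\<sigma> t = 0" if "\<bar>t\<bar> \<ge> T" for t
  proof (cases "t \<ge> 0")
    case True then show ?thesis using \<sigma>_right[of t] ab by simp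
  next
    case False
    then have "t \<le> a - L" using that \<open>L > 0\<close> ab by (auto simp: T_def)
    then have "(\<lambda>s. if s < t then g s else 0) = (\<lambda>_. 0)" using g_left by (auto simp: fun_eq_iff)
    then show ?thesis by (simp add: \<sigma>_def)
  qed
  have "(LINT x|lborel. u x * (complex_of_real (side_indicator c d x) * vd \<sigma> (x $ k))) = 0"
    by (rule strip_identity_box[OF s\<sigma> \<sigma>_out T]) (use \<sigma>_right ab in auto)
  then have z: "(LINT x|lborel. u x * complex_of_real (side_indicator c d x * ?h (x $ k)) - u x * complex_of_real (side_indicator c d x * ?h (x $ k + L))) = 0"
    unfolding vd_eqI[OF d\<sigma>] by (simp add: g_def algebra_simps)
  have [measurable]: "?h \<in> borel_measurable borel"
    unfolding strip_bump_def[abs_def] flatfn_def by measurable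
  have h_abs: "\<bar>?h t\<bar> \<le> 1" for t by (simp add: strip_bump_bounds)
  have i1: "integrable lborel (\<lambda>x. u x * complex_of_real (side_indicator c d x * ?h (x $ k)))"
    by (rule u_side_integrable[where B = 1 and R = T])
       (use h_abs h_out ab \<open>L > 0\<close> in \<open>auto simp: T_def abs_if split: if_splits\<close>)
  have i2: "integrable lborel (\<lambda>x. u x * complex_of_real (side_indicator c d x * ?h (x $ k + L)))"
    by (rule u_side_integrable[where B = 1 and R = "T + L" and h = "\<lambda>t. ?h (t + L)"])
       (use h_abs h_out ab \<open>L > 0\<close> in \<open>auto simp: T_def abs_if split: if_splits\<close>)
  show ?thesis using z unfolding Bochner_Integration.integral_diff[OF i1 i2] by simp
qed

text \<open>The integral equals its average over \<open>N\<close> disjoint translates of the strip, which is at most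
  \<open>O(1/N)\<close> times the \<open>L\<^sup>1\<close> norm of \<open>u\<close> on a cylinder of length \<open>O(N)\<close>; that norm is \<open>o(N)\<close>.\<close>

lemma strip_integral_zero:
  assumes ab: "a < b" "b \<le> 0"
  shows "(LINT x|lborel. u x * complex_of_real (side_indicator c d x * strip_bump a b m (x $ k))) = 0"
proof -
  let ?h = "strip_bump a b m"
  define J where "J = (LINT x|lborel. u x * complex_of_real (side_indicator c d x * ?h (x $ k)))"
  define L where "L = b - a"
  have L: "L > 0" using ab by (simp add: L_def)
  have [measurable]: "?h \<in> borel_measurable borel"
    unfolding strip_bump_def[abs_def] flatfn_def by measurable
  have h_abs: "\<bar>?h t\<bar> \<le> 1" for t by (simp add: strip_bump_bounds)
  have h_out: "?h t = 0" if "t \<le> a \<or> b \<le> t" for t using that by (rule strip_bump_outside)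
  define \<Theta> where "\<Theta> N t = (\<Sum>j<N. ?h (t + real j * L))" for N t
  have \<Theta>: "0 \<le> \<Theta> N t" "\<Theta> N t \<le> 1" for N t
    unfolding \<Theta>_def L_def by (intro sum_nonneg strip_bump_bounds sum_shifts_le_1; use h_out in blast)+
  have [measurable]: "\<Theta> N \<in> borel_measurable borel" for N unfolding \<Theta>_def[abs_def] by measurable
  have \<Theta>_out: "\<Theta> N t = 0" if "t \<le> a - real N * L \<or> b \<le> t" for N t
    unfolding \<Theta>_def
  proof (rule sum.neutral, rule ballI)
    fix j assume j: "j \<in> {..<N}"
    have "real j * L \<le> real N * L" using j L by (intro mult_right_mono) auto
    moreover have "0 \<le> real j * L" using L by simp
    ultimately show "?h (t + real j * L) = 0" using that by (intro h_out) linarith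
  qed
  have NJ: "of_nat N * J = (LINT x|lborel. u x * complex_of_real (side_indicator c d x * \<Theta> N (x $ k)))" for N
  proof -
    have i: "integrable lborel (\<lambda>x. u x * complex_of_real (side_indicator c d x * ?h (x $ k + real j * L)))" for j
    proof (rule u_side_integrable[where B = 1 and R = "\<bar>a\<bar> + \<bar>b\<bar> + real j * L" and h = "\<lambda>t. ?h (t + real j * L)"])
      have "0 \<le> real j * L" using L by simp
      then show "?h (t + real j * L) = 0" if "\<bar>t\<bar> \<ge> \<bar>a\<bar> + \<bar>b\<bar> + real j * L" for t
        using that ab by (intro h_out) linarith
    qed (simp_all add: h_abs)
    have eq: "J = (LINT x|lborel. u x * complex_of_real (side_indicator c d x * ?h (x $ k + real j * L)))" for j
      using strip_shift[OF ab, of "real j * L" c d m] L by (cases "j = 0") (simp_all add: J_def)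
    have "of_nat N * J = (\<Sum>j<N. LINT x|lborel. u x * complex_of_real (side_indicator c d x * ?h (x $ k + real j * L)))"
      unfolding eq[symmetric] by simp
    also have "\<dots> = (LINT x|lborel. (\<Sum>j<N. u x * complex_of_real (side_indicator c d x * ?h (x $ k + real j * L))))"
      by (rule Bochner_Integration.integral_sum[symmetric]) (rule i)
    finally show ?thesis by (simp add: \<Theta>_def sum_distrib_left)
  qed
  \<comment> \<open>Chosen so that the cylinder over the cross-section, long enough for N = n + 1
    translates, lies in the ball of radius C1 N.\<close>
  define C1 where "C1 = (\<Sum>i\<in>UNIV. \<bar>c $ i\<bar> + \<bar>d $ i\<bar>) + \<bar>a\<bar> + \<bar>b\<bar> + L + 1"
  have C1: "C1 \<ge> 1" unfolding C1_def using L by (simp add: sum_nonneg add_nonneg_nonneg)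
  define R where "R n = C1 * real (Suc n)" for n
  let ?U = "\<lambda>R. LINT x:ball 0 R|lborel. (norm (u x))\<^sup>2"
  obtain e where e0: "\<And>n. e n > 0" and e_lim: "(\<lambda>n. sqrt (e n)) \<longlonglongrightarrow> 0"
    and Ue: "\<And>n. ?U (R n) \<le> R n * e n"
    using u_mean_square[OF C1] unfolding R_def by blast
  \<comment> \<open>The (n-1)-dimensional volume of the cross-section.\<close>
  define W where "W = (\<Prod>i\<in>UNIV - {k}. measure lborel {c $ i<..<d $ i})"
  have W0: "W \<ge> 0" unfolding W_def by (intro prod_nonneg) auto
  have bd: "norm J \<le> (C1 + 2 * L * W) * sqrt (e n)" for n
  proof -
    define N where "N = Suc n"
    define s where "s = sqrt (e n)"
    have s0: "s > 0" and s2: "s * s = e n" using e0[of n] by (auto simp: s_def)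
    define g where "g i t = (if i = k then indicator {a - real N * L<..<b} t else indicator {c $ i<..<d $ i} t :: real)" for i t
    define S where "S x = (\<Prod>i\<in>UNIV. g i (x $ i))" for x :: "real^'n"
    have gi: "integrable lborel (g i)" for i
      unfolding g_def[abs_def] by (cases "i = k") (auto intro!: integrable_real_indicator emeasure_bounded_finite)
    have Si: "integrable lborel S" unfolding S_def[abs_def] by (rule integrable_prod_coords[OF gi])
    have gI: "integral\<^sup>L lborel (g i) = (if i = k then L + real N * L else measure lborel {c $ i<..<d $ i})" for i
    proof (cases "i = k")
      case True
      have "0 \<le> real N * L" using L by simp
      then have "a - real N * L \<le> b" using ab by linarith
      from measure_lborel_Ioo[OF this] have "measure lborel {a - real N * L<..<b} = L + real N * L"
        by (simp add: L_def)
      with True show ?thesis by (simp add: g_def[abs_def])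
    qed (simp add: g_def[abs_def])
    have "integral\<^sup>L lborel S = (\<Prod>i\<in>UNIV. integral\<^sup>L lborel (g i))"
      unfolding S_def[abs_def] by (rule integral_prod_coords[OF gi])
    also have "\<dots> = (L + real N * L) * W"
      unfolding gI W_def by (subst prod.remove[of UNIV k]) (auto intro!: prod.cong)
    also have "\<dots> \<le> (2 * L * real N) * W"
      using L W0 by (intro mult_right_mono) (auto simp: N_def algebra_simps)
    finally have SI: "integral\<^sup>L lborel S \<le> (2 * L * real N) * W" .
    have S_eq: "S x = side_indicator c d x * indicator {a - real N * L<..<b} (x $ k)" for x
    proof -
      have "S x = g k (x $ k) * (\<Prod>i\<in>UNIV - {k}. g i (x $ i))" unfolding S_def by (simp add: prod.remove[of UNIV k])
      also have "(\<Prod>i\<in>UNIV - {k}. g i (x $ i)) = side_indicator c d x"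
        unfolding side_indicator_def by (intro prod.cong) (auto simp: g_def indicator_def)
      finally show ?thesis by (simp add: g_def)
    qed
    have i1: "integrable lborel (\<lambda>x. indicator (ball 0 (R n)) x *\<^sub>R (norm (u x))\<^sup>2)"
      using u_square[of "R n"] unfolding set_integrable_def .
    have "norm (of_nat N * J) \<le> (LINT x|lborel. (1 / s) * (indicator (ball 0 (R n)) x *\<^sub>R (norm (u x))\<^sup>2) + s * S x)"
      unfolding NJ
    proof (rule norm_lebesgue_integral_le)
      show "integrable lborel (\<lambda>x. (1 / s) * (indicator (ball 0 (R n)) x *\<^sub>R (norm (u x))\<^sup>2) + s * S x)"
        using i1 Si by simp
      fix x
      show "norm (u x * complex_of_real (side_indicator c d x * \<Theta> N (x $ k)))
          \<le> (1 / s) * (indicator (ball 0 (R n)) x *\<^sub>R (norm (u x))\<^sup>2) + s * S x"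
      proof (cases "side_indicator c d x = 0 \<or> x $ k \<notin> {a - real N * L<..<b}")
        case True
        then have "side_indicator c d x * \<Theta> N (x $ k) = 0" using \<Theta>_out[of "x $ k" N] by auto
        then have "norm (u x * complex_of_real (side_indicator c d x * \<Theta> N (x $ k))) = 0" by simp
        also have "\<dots> \<le> (1 / s) * (indicator (ball 0 (R n)) x *\<^sub>R (norm (u x))\<^sup>2) + s * S x"
          using s0 by (auto intro!: add_nonneg_nonneg simp: S_eq side_indicator_cases indicator_def)
        finally show ?thesis .
      next
        case False
        have "side_indicator c d x = 0 \<or> side_indicator c d x = 1" by (simp add: side_indicator_cases)
        with False have side: "side_indicator c d x = 1" by blast
        have "a - real N * L < x $ k" "x $ k < b" "0 \<le> real N * L" using False L by auto
        then have "\<bar>x $ k\<bar> \<le> \<bar>a\<bar> + \<bar>b\<bar> + real N * L" by linarith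
        then have "norm x \<le> (\<Sum>i\<in>UNIV. \<bar>c $ i\<bar> + \<bar>d $ i\<bar>) + (\<bar>a\<bar> + \<bar>b\<bar> + real N * L)"
          using norm_le_of_side[of c d x] False by linarith
        also have "\<dots> < R n"
        proof -
          have "1 * (\<Sum>i\<in>UNIV. \<bar>c $ i\<bar> + \<bar>d $ i\<bar>) \<le> real N * (\<Sum>i\<in>UNIV. \<bar>c $ i\<bar> + \<bar>d $ i\<bar>)"
            by (intro mult_right_mono sum_nonneg) (auto simp: N_def)
          moreover have "1 * (\<bar>a\<bar> + \<bar>b\<bar>) \<le> real N * (\<bar>a\<bar> + \<bar>b\<bar>)"
            by (intro mult_right_mono) (auto simp: N_def)
          moreover have "real N > 0" by (simp add: N_def)
          ultimately show ?thesis by (simp add: R_def C1_def N_def[symmetric] algebra_simps)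
        qed
        finally have ball: "norm x < R n" .
        have "norm (u x * complex_of_real (side_indicator c d x * \<Theta> N (x $ k))) \<le> norm (u x)"
          using \<Theta>[of N "x $ k"] side by (simp add: norm_mult mult_left_le)
        \<comment> \<open>Young's inequality again with s = sqrt (e n): the first part is controlled
          by the mean square of u, the second by the volume of the cylinder. Both are of order N s,
          while the left side is N |J|.\<close>
        also have "\<dots> \<le> (1 / s) * (norm (u x))\<^sup>2 + s"
        proof -
          have "0 \<le> (1 / s) * (norm (u x) - s)\<^sup>2" using s0 by simp
          also have "\<dots> = (1 / s) * (norm (u x))\<^sup>2 + s - 2 * norm (u x)"
            using s0 by (simp add: power2_eq_square field_simps)
          finally show ?thesis using norm_ge_zero[of "u x"] by linarith
        qed
        finally show ?thesis using ball False side by (simp add: S_eq)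
      qed
    qed
    also have "\<dots> = (1 / s) * ?U (R n) + s * integral\<^sup>L lborel S"
      using i1 Si unfolding set_lebesgue_integral_def by simp
    also have "\<dots> \<le> (1 / s) * (R n * e n) + s * ((2 * L * real N) * W)"
      by (intro add_mono mult_left_mono SI Ue) (use s0 in auto)
    also have "\<dots> = ((C1 + 2 * L * W) * s) * real N"
      unfolding s2[symmetric] R_def N_def using s0 by (simp add: field_simps)
    finally have "norm J * real N \<le> ((C1 + 2 * L * W) * s) * real N"
      by (simp add: norm_mult mult.commute)
    then show ?thesis by (simp add: s_def N_def)
  qed
  have "(\<lambda>n. (C1 + 2 * L * W) * sqrt (e n)) \<longlonglongrightarrow> (C1 + 2 * L * W) * 0"
    by (intro tendsto_intros e_lim)
  then have "norm J \<le> (C1 + 2 * L * W) * 0"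
    by (rule LIMSEQ_le_const) (use bd in auto)
  then show ?thesis by (simp add: J_def)
qed

text \<open>Dominated limit of \<open>strip_integral_zero\<close> as the bumps fill the interval;
  the indicator of the closed interval majorises all of them.\<close>

lemma box_integral_zero:
  assumes "d $ k \<le> 0"
  shows "(LINT x|lborel. indicator (box c d) x *\<^sub>R u x) = 0"
proof (cases "c $ k < d $ k")
  case True
  let ?h = "\<lambda>m. strip_bump (c $ k) (d $ k) m"
  have [measurable]: "?h m \<in> borel_measurable borel" for m
    unfolding strip_bump_def[abs_def] flatfn_def by measurable
  have eq: "indicator (box c d) x *\<^sub>R u x = u x * complex_of_real (side_indicator c d x * (if c $ k < x $ k \<and> x $ k < d $ k then 1 else 0))" for x
    by (auto simp: mem_box_cart side_indicator_cases indicator_def)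
  let ?i = "indicator {c $ k..d $ k} :: real \<Rightarrow> real"
  have i: "integrable lborel (\<lambda>x. u x * complex_of_real (side_indicator c d x * ?i (x $ k)))"
    by (rule u_side_integrable[where B = 1 and R = "\<bar>c $ k\<bar> + \<bar>d $ k\<bar> + 1"]) (auto simp: indicator_def)
  have "(\<lambda>m. LINT x|lborel. u x * complex_of_real (side_indicator c d x * ?h m (x $ k))) \<longlonglongrightarrow>
      (LINT x|lborel. indicator (box c d) x *\<^sub>R u x)"
    unfolding eq
  proof (rule integral_dominated_convergence[OF _ _ integrable_norm[OF i]])
    show "AE x in lborel. (\<lambda>m. u x * complex_of_real (side_indicator c d x * ?h m (x $ k)))
        \<longlonglongrightarrow> u x * complex_of_real (side_indicator c d x * (if c $ k < x $ k \<and> x $ k < d $ k then 1 else 0))"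
      by (intro AE_I2 tendsto_mult tendsto_of_real tendsto_const strip_bump_tendsto)
    show "AE x in lborel. norm (u x * complex_of_real (side_indicator c d x * ?h m (x $ k)))
        \<le> norm (u x * complex_of_real (side_indicator c d x * ?i (x $ k)))" for m
    proof (rule AE_I2)
      fix x
      have "\<bar>?h m (x $ k)\<bar> \<le> \<bar>?i (x $ k)\<bar>"
        using strip_bump_bounds[of "c $ k" "d $ k" m "x $ k"] strip_bump_outside[of "x $ k" "c $ k" "d $ k" m]
        by (cases "x $ k \<in> {c $ k..d $ k}") auto
      then show "norm (u x * complex_of_real (side_indicator c d x * ?h m (x $ k)))
        \<le> norm (u x * complex_of_real (side_indicator c d x * ?i (x $ k)))"
        unfolding norm_mult norm_of_real abs_mult by (intro mult_left_mono) auto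
    qed
  qed measurable
  moreover have "(LINT x|lborel. u x * complex_of_real (side_indicator c d x * ?h m (x $ k))) = 0" for m
    by (rule strip_integral_zero[OF True assms])
  ultimately show ?thesis by (simp add: LIMSEQ_const_iff)
next
  case False
  then have "box c d = {}" by (auto simp: mem_box_cart set_eq_iff) (meson less_trans not_less)
  then show ?thesis by simp
qed

lemma vanishes_below: "AE x in lborel. x $ k < 0 \<longrightarrow> u x = 0"
proof -
  define v where "v x = (if x $ k < 0 then u x else 0)" for x
  have vm [measurable]: "v \<in> borel_measurable borel" unfolding v_def[abs_def] by measurable
  have "AE x in lborel. v x = 0"
  proof (rule AE_zero_of_boxes[OF vm])
    show "set_integrable lborel (ball 0 R) v" for R
      unfolding set_integrable_def
      by (rule Bochner_Integration.integrable_bound[OF u_loc[of R, unfolded set_integrable_def]])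
         (auto simp: v_def indicator_def)
    fix c d :: "real^'n"
    \<comment> \<open>Clipping the box at the hyperplane exchanges the truncated function for u on a
      box in the lower half-space.\<close>
    define d' where "d' = (\<chi> i. if i = k then min (d $ k) 0 else d $ i)"
    have "x \<in> box c d' \<longleftrightarrow> x \<in> box c d \<and> x $ k < 0" for x
      unfolding mem_box_cart d'_def by auto
    then have "indicator (box c d) x *\<^sub>R v x = indicator (box c d') x *\<^sub>R u x" for x
      by (auto simp: v_def indicator_def)
    then show "(LINT x|lborel. indicator (box c d) x *\<^sub>R v x) = 0"
      using box_integral_zero[of d' c] by (simp add: d'_def)
  qed
  then show ?thesis by eventually_elim (auto simp: v_def split: if_splits)
qed

end

section \<open>Passage from Lebesgue to Borel representatives\<close>

lemma lebesgue_ex_borel: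
  fixes u :: "'a::euclidean_space \<Rightarrow> complex"
  assumes [measurable]: "u \<in> borel_measurable lebesgue"
  obtains u0 where "u0 \<in> borel_measurable borel" "AE x in lborel. u x = u0 x"
proof -
  have "(\<lambda>x. Re (u x)) \<in> borel_measurable lebesgue" "(\<lambda>x. Im (u x)) \<in> borel_measurable lebesgue"
    by measurable
  then obtain r i where ri: "r \<in> borel_measurable lborel" "AE x in lborel. Re (u x) = r x"
    "i \<in> borel_measurable lborel" "AE x in lborel. Im (u x) = i x"
    using completion_ex_borel_measurable_real by metis
  have m: "r \<in> borel_measurable borel" "i \<in> borel_measurable borel" using ri by auto
  show ?thesis
  proof (rule that)
    show "(\<lambda>x. Complex (r x) (i x)) \<in> borel_measurable borel"
      unfolding complex_eq_iff Complex_eq using m by measurable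
    show "AE x in lborel. u x = Complex (r x) (i x)"
      using ri(2,4) by eventually_elim (simp add: complex_eq_iff)
  qed
qed

lemma integral_lebesgue_eq_lborel:
  fixes g g0 :: "'a::euclidean_space \<Rightarrow> 'b::{banach, second_countable_topology}"
  assumes g: "g \<in> borel_measurable lebesgue" and g0: "g0 \<in> borel_measurable borel"
    and ae: "AE x in lborel. g x = g0 x"
  shows "integral\<^sup>L lebesgue g = integral\<^sup>L lborel g0"
    and "integrable lebesgue g \<longleftrightarrow> integrable lborel g0"
proof -
  have g0l: "g0 \<in> borel_measurable lborel" using g0 by simp
  note g0' = g0l measurable_completion[OF g0l]
  have ae': "AE x in lebesgue. g x = g0 x" using ae by (rule AE_completion)
  have "integral\<^sup>L lebesgue g = integral\<^sup>L lebesgue g0"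
    by (rule integral_cong_AE[OF g g0'(2) ae'])
  then show "integral\<^sup>L lebesgue g = integral\<^sup>L lborel g0"
    using integral_completion[OF g0'(1)] by simp
  have "integrable lebesgue g \<longleftrightarrow> integrable lebesgue g0"
    by (rule integrable_cong_AE[OF g g0'(2) ae'])
  then show "integrable lebesgue g \<longleftrightarrow> integrable lborel g0"
    using integrable_completion[OF g0'(1)] by simp
qed

lemma iter_pderiv_borel:
  assumes "test_fun \<phi>"
  shows "iter_pderiv is \<phi> \<in> borel_measurable borel"
proof (rule borel_measurable_continuous_onI)
  have "\<And>x. iter_pderiv is \<phi> differentiable (at x)" using assms by (simp add: test_fun_def)
  then show "continuous_on UNIV (iter_pderiv is \<phi>)"
    by (auto intro!: continuous_at_imp_continuous_on differentiable_imp_continuous_within)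
qed

theorem theorem3:
  fixes u f :: "real^'n::finite \<Rightarrow> complex" and lam :: real and k :: 'n
  assumes "CARD('n) \<ge> 2"
    and "lam > 0"
    and "Bstar2 u"
    and "solves_helmholtz lam u f"
    and "\<forall>\<gamma>>0. L2 (\<lambda>x. complex_of_real (exp (\<gamma> * sqrt (1 + (norm x)\<^sup>2))) * f x)"
    and "AE x in lebesgue. x $ k < 0 \<longrightarrow> f x = 0"
  shows "AE x in lebesgue. x $ k < 0 \<longrightarrow> u x = 0"
proof -
  let ?w = "\<lambda>\<gamma> x::real^'n. exp (\<gamma> * sqrt (1 + (norm x)\<^sup>2))"
  have u: "L2_loc u" and lim: "((\<lambda>R. (1 / R) * (LINT x : ball 0 R | lebesgue. (norm (u x))\<^sup>2)) \<longlongrightarrow> 0) at_top"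
    using assms(3) by (auto simp: Bstar2_def Bstar0_def)
  have um [measurable]: "u \<in> borel_measurable lebesgue" using u by (simp add: L2_loc_def)
  have wf: "(\<lambda>x. complex_of_real (?w \<gamma> x) * f x) \<in> borel_measurable lebesgue"
    "integrable lebesgue (\<lambda>x. (norm (complex_of_real (?w \<gamma> x) * f x))\<^sup>2)" if "\<gamma> > 0" for \<gamma>
    using assms(5) that by (auto simp: L2_def)
  have wm: "(\<lambda>x. complex_of_real (?w \<gamma> x)) \<in> borel_measurable borel" for \<gamma> by measurable
  have fm [measurable]: "f \<in> borel_measurable lebesgue"
  proof -
    \<comment> \<open>Measurability is given for the weighted function; multiplying by the
      reciprocal weight recovers it for f.\<close>
    have "(\<lambda>x. complex_of_real (?w (-1) x) * (complex_of_real (?w 1 x) * f x)) \<in> borel_measurable lebesgue"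
    proof (rule borel_measurable_times)
      show "(\<lambda>x. complex_of_real (?w (-1) x)) \<in> borel_measurable lebesgue"
        by (rule measurable_completion) (use wm in simp)
    qed (rule wf(1), simp)
    moreover have "complex_of_real (?w (-1) x) * (complex_of_real (?w 1 x) * f x) = f x" for x
      unfolding mult.assoc[symmetric] of_real_mult[symmetric] exp_add[symmetric] by simp
    ultimately show ?thesis by (simp only:)
  qed
  obtain u0 where u0 [measurable]: "u0 \<in> borel_measurable borel" and u0_ae: "AE x in lborel. u x = u0 x"
    using lebesgue_ex_borel[OF um] by metis
  obtain f0 where f0 [measurable]: "f0 \<in> borel_measurable borel" and f0_ae: "AE x in lborel. f x = f0 x"
    using lebesgue_ex_borel[OF fm] by metis
  \<comment> \<open>Changed on a null set so that it vanishes at every point below the hyperplane,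
    not merely almost every one.\<close>
  define f1 where "f1 x = (if x $ k < 0 then 0 else f0 x)" for x
  have f1 [measurable]: "f1 \<in> borel_measurable borel" unfolding f1_def[abs_def] by measurable
  have "AE x in lborel. x $ k < 0 \<longrightarrow> f x = 0" using assms(6) by (simp add: AE_completion_iff)
  with f0_ae have f1_ae: "AE x in lborel. f x = f1 x"
    by eventually_elim (auto simp: f1_def)
  have ball_eq: "(LINT x:ball 0 R|lebesgue. (norm (u x))\<^sup>2) = (LINT x:ball 0 R|lborel. (norm (u0 x))\<^sup>2)"
    "set_integrable lebesgue (ball 0 R) (\<lambda>x. (norm (u x))\<^sup>2) \<longleftrightarrow> set_integrable lborel (ball 0 R) (\<lambda>x. (norm (u0 x))\<^sup>2)" for R
  proof -
    have b: "ball (0::real^'n) R \<in> sets borel" "ball (0::real^'n) R \<in> sets lebesgue" by auto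
    have m1: "(\<lambda>x. indicator (ball 0 R) x *\<^sub>R (norm (u x))\<^sup>2) \<in> borel_measurable lebesgue"
      using b by (intro borel_measurable_scaleR borel_measurable_indicator) auto
    have m2: "(\<lambda>x. indicator (ball 0 R) x *\<^sub>R (norm (u0 x))\<^sup>2) \<in> borel_measurable borel"
      using b by (intro borel_measurable_scaleR borel_measurable_indicator) auto
    have ae: "AE x in lborel. indicator (ball 0 R) x *\<^sub>R (norm (u x))\<^sup>2 = indicator (ball 0 R) x *\<^sub>R (norm (u0 x))\<^sup>2"
      using u0_ae by eventually_elim simp
    show "(LINT x:ball 0 R|lebesgue. (norm (u x))\<^sup>2) = (LINT x:ball 0 R|lborel. (norm (u0 x))\<^sup>2)"
      "set_integrable lebesgue (ball 0 R) (\<lambda>x. (norm (u x))\<^sup>2) \<longleftrightarrow> set_integrable lborel (ball 0 R) (\<lambda>x. (norm (u0 x))\<^sup>2)"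
      unfolding set_lebesgue_integral_def set_integrable_def
      by (rule integral_lebesgue_eq_lborel[OF m1 m2 ae])+
  qed
  have weak_eq: "(LINT x|lebesgue. g x * complex_of_real (h x)) = (LINT x|lborel. g0 x * complex_of_real (h x))"
    if [measurable]: "g \<in> borel_measurable lebesgue" "g0 \<in> borel_measurable borel" "h \<in> borel_measurable borel"
      and ae: "AE x in lborel. g x = g0 x" for g g0 and h :: "real^'n \<Rightarrow> real"
  proof (rule integral_lebesgue_eq_lborel(1))
    have "(\<lambda>x. complex_of_real (h x)) \<in> borel_measurable lborel" by measurable
    from measurable_completion[OF this] show "(\<lambda>x. g x * complex_of_real (h x)) \<in> borel_measurable lebesgue"
      using that(1) by (rule borel_measurable_times[rotated])
    show "AE x in lborel. g x * complex_of_real (h x) = g0 x * complex_of_real (h x)"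
      using ae by eventually_elim simp
  qed measurable
  interpret helmholtz u0 f1 lam k
  proof
    show "lam > 0" by (rule assms(2))
    show "set_integrable lborel (ball 0 R) (\<lambda>x. (norm (u0 x))\<^sup>2)" for R
    proof -
      have "set_integrable lebesgue (cball 0 R) (\<lambda>x. (norm (u x))\<^sup>2)"
        using u by (simp add: L2_loc_def)
      then have "set_integrable lebesgue (ball 0 R) (\<lambda>x. (norm (u x))\<^sup>2)"
        by (rule set_integrable_subset) auto
      then show ?thesis by (simp add: ball_eq(2))
    qed
    show "((\<lambda>R. (1 / R) * (LINT x:ball 0 R|lborel. (norm (u0 x))\<^sup>2)) \<longlongrightarrow> 0) at_top"
      using lim unfolding ball_eq(1) .
    show "f1 x = 0" if "x $ k < 0" for x using that by (simp add: f1_def)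
    show "integrable lborel (\<lambda>x. norm (f1 x) * exp (\<gamma> * norm x))" for \<gamma>
    proof (rule Bochner_Integration.integrable_bound)
      \<comment> \<open>The surplus 1 in the rate leaves a factor exp (-|x|), and the product of the
        weighted |f| with it is at most the sum of the squares, both integrable. The maximum with 0
        covers negative \<gamma>.\<close>
      define c where "c = max \<gamma> 0 + 1"
      have c: "c > 0" by (simp add: c_def)
      have ae: "AE x in lborel. (norm (complex_of_real (?w c x) * f x))\<^sup>2 = (norm (complex_of_real (?w c x) * f1 x))\<^sup>2"
        using f1_ae by eventually_elim simp
      have "(\<lambda>x. (norm (complex_of_real (?w c x) * f x))\<^sup>2) \<in> borel_measurable lebesgue"
        using wf(1)[OF c] by measurable
      from integral_lebesgue_eq_lborel(2)[OF this _ ae] wf(2)[OF c]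
      have i: "integrable lborel (\<lambda>x. (norm (complex_of_real (?w c x) * f1 x))\<^sup>2)" by auto
      show "integrable lborel (\<lambda>x. (norm (complex_of_real (?w c x) * f1 x))\<^sup>2 + exp (- 2 * norm x))"
        by (intro Bochner_Integration.integrable_add i integrable_exp_norm) simp
      show "AE x in lborel. norm (norm (f1 x) * exp (\<gamma> * norm x)) \<le> norm ((norm (complex_of_real (?w c x) * f1 x))\<^sup>2 + exp (- 2 * norm x))"
      proof (rule AE_I2)
        fix x :: "real^'n"
        let ?p = "?w c x * norm (f1 x)" and ?q = "exp (- norm x)"
        have "norm x \<le> sqrt (1 + (norm x)\<^sup>2)" by (rule real_le_rsqrt) simp
        then have "c * norm x \<le> c * sqrt (1 + (norm x)\<^sup>2)" using c by (intro mult_left_mono) auto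
        moreover have "\<gamma> * norm x \<le> (c - 1) * norm x" by (intro mult_right_mono) (auto simp: c_def)
        ultimately have "\<gamma> * norm x \<le> c * sqrt (1 + (norm x)\<^sup>2) + - norm x" by (simp add: algebra_simps)
        then have "exp (\<gamma> * norm x) \<le> ?w c x * ?q" unfolding exp_add[symmetric] by simp
        then have "norm (f1 x) * exp (\<gamma> * norm x) \<le> norm (f1 x) * (?w c x * ?q)"
          by (rule mult_left_mono) simp
        also have "\<dots> = ?p * ?q" by (simp add: mult_ac)
        also have "\<dots> \<le> ?p\<^sup>2 + ?q\<^sup>2"
        proof -
          have "0 \<le> (?p - ?q)\<^sup>2" by simp
          then have "2 * (?p * ?q) \<le> ?p\<^sup>2 + ?q\<^sup>2" by (simp add: power2_diff mult.assoc)
          moreover have "0 \<le> ?p * ?q" by simp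
          ultimately show ?thesis by linarith
        qed
        also have "\<dots> = (norm (complex_of_real (?w c x) * f1 x))\<^sup>2 + exp (- 2 * norm x)"
          by (simp add: norm_mult exp_double[symmetric] flip: exp_of_nat_mult)
        finally show "norm (norm (f1 x) * exp (\<gamma> * norm x)) \<le> norm ((norm (complex_of_real (?w c x) * f1 x))\<^sup>2 + exp (- 2 * norm x))"
          by simp
      qed
    qed measurable
    fix \<phi> :: "real^'n \<Rightarrow> real" assume \<phi>: "test_fun \<phi>"
    have [measurable]: "\<phi> \<in> borel_measurable borel" "iter_pderiv [i, i] \<phi> \<in> borel_measurable borel" for i
      using iter_pderiv_borel[OF \<phi>, of "[]"] iter_pderiv_borel[OF \<phi>, of "[i, i]"] by auto
    have L: "(\<lambda>x. - (\<Sum>i\<in>UNIV. iter_pderiv [i, i] \<phi> x) - lam * \<phi> x) \<in> borel_measurable borel" by measurable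
    show "(LINT x | lborel. u0 x * complex_of_real (- (\<Sum>i\<in>UNIV. iter_pderiv [i, i] \<phi> x) - lam * \<phi> x))
        = (LINT x | lborel. f1 x * complex_of_real (\<phi> x))"
      using assms(4) \<phi> unfolding solves_helmholtz_def
      using weak_eq[OF um u0 L u0_ae] weak_eq[OF fm f1 _ f1_ae, of \<phi>] by auto
  qed measurable
  have "AE x in lborel. x $ k < 0 \<longrightarrow> u x = 0"
    using vanishes_below u0_ae by eventually_elim auto
  then show ?thesis by (rule AE_completion)
qed

end
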